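(* Let $R$ be a commutative ring and let $\mathcal P$ be a (reduced) right symmetric operad in $R$-modules with $\mathcal P(1)=R$. Then for all $\mathcal P$-algebras $A$, $B$, $C$ there is a natural isomorphism $(A\otimes B)\otimes C\cong A\otimes(B\otimes C)$, where $\otimes$ denotes the bilinear product on the semi-abelian category of $\mathcal P$-algebras.
   Context: **Operads.** A (reduced, i.e. constant-free) right symmetric operad $\mathcal P$ in $R$-modules consists of $R$-modules $\mathcal P(n)$, $n\ge 1$, with $R$-linear left actions $\star$ of the symmetric groups $\mathfrak S_n$ on $\mathcal P(n)$, an identity $1\in\mathcal P(1)$, and $R$-linear maps $\gamma_{k_1,\dots,k_n;n}\colon \mathcal P(k_1)\otimes_R\cdots\otimes_R\mathcal P(k_n)\otimes_R\mathcal P(n)\to\mathcal P(k_1+\cdots+k_n)$ such that: (identity) $\gamma_{1,\dots,1;n}(1\otimes\cdots\otimes1\otimes\theta)=\theta=\gamma_{n;1}(\theta\otimes1)$; (associativity) composing $\theta_{i,j}$'s into the $\theta_i$'s and then the results into $\theta$ equals composing the $\theta_i$'s into $\theta$ and then all the $\theta_{i,j}$'s into the result; (equivariance 1) for $t\in\mathfrak S_n$, $\gamma_{k_1,\dots,k_n;n}(\theta_1\otimes\cdots\otimes\theta_n\otimes(t\star\theta))=t'\star\gamma_{k_{t(1)},\dots,k_{t(n)};n}(\theta_{t(1)}\otimes\cdots\otimes\theta_{t(n)}\otimes\theta)$, where $t'$ is the block permutation which rearranges a sequence consisting of consecutive blocks of sizes $k_1,\dots,k_n$ into the sequence of blocks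 number $t(1),\dots,t(n)$; (equivariance 2) for $s_i\in\mathfrak S_{k_i}$, $\gamma((s_1\star\theta_1)\otimes\cdots\otimes(s_n\star\theta_n)\otimes\theta)=(s_1,\dots,s_n)\star\gamma(\theta_1\otimes\cdots\otimes\theta_n\otimes\theta)$, where $(s_1,\dots,s_n)$ permutes the $i$-th block by $s_i$. Then $\mathcal P(1)$ is a unital $R$-algebra with multiplication $\gamma_{1;1}$; the hypothesis $\mathcal P(1)=R$ is as $R$-algebras. A $\mathcal P$-algebra is an $R$-module $A$ with $R$-linear maps $\mu_n\colon A^{\otimes n}\otimes_R\mathcal P(n)\to A$, $n\geq1$, with $\mu_1(a\otimes1)=a$, compatible with composition, i.e. $\mu_{k_1+\cdots+k_n}(a_1\otimes\cdots\otimes a_{k_1+\cdots+k_n}\otimes\gamma(\theta_1\otimes\cdots\otimes\theta_n\otimes\theta))=\mu_n(\mu_{k_1}(a_1\otimes\cdots\otimes a_{k_1}\otimes\theta_1)\otimes\cdots\otimes\mu_{k_n}(\cdots\otimes a_{k_1+\cdots+k_n}\otimes\theta_n)\otimes\theta)$, and such that $\mu_n(a_1\otimes\cdots\otimes a_n\otimes(t\star\theta))=\mu_n(a_{t(1)}\otimes\cdots\otimes a_{t(n)}\otimes\theta)$. Morphisms are $R$-linear maps commuting with all $\mu_n$. The category of $\mathcal P$-algebras is a semi-abelian variety. **Bilinear product.** In a semi-abelian category $\mathcal X$, the cosmash product $X\diamond Y$ is the kernel of the canonical morphism $X+Y\to X\times Y$, and the ternary cosmash product $X\diamond Y\diamond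 Z$ is the kernel of the canonical morphism $X+Y+Z\to(X+Y)\times(X+Z)\times(Y+Z)$ whose components kill $Z$, $Y$, $X$ respectively. The commutator $[X,X,X]$ is the image of $X\diamond X\diamond X\to X+X+X\to X$ (the last arrow being the codiagonal). $X$ is two-nilpotent if $[X,X,X]=0$; the two-nilpotent objects form a full reflective subcategory $\mathsf{Nil}_2(\mathcal X)$ with reflector $\mathrm{nil}_2(X)=X/[X,X,X]$. The bilinear product $X\otimes Y$ is the cosmash product of $\mathrm{nil}_2(X)$ and $\mathrm{nil}_2(Y)$ computed in $\mathsf{Nil}_2(\mathcal X)$. *)

theory Defs
  imports "HOL-Algebra.Module" "HOL-Algebra.RingHom" "HOL-Combinatorics.Permutations"
begin

section \<open>Multilinear maps\<close>

definition lin_maps ::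
  "('r, 'm) ring_scheme \<Rightarrow> ('r, 'a, 'k) module_scheme \<Rightarrow> ('r, 'b, 'l) module_scheme \<Rightarrow> ('a \<Rightarrow> 'b) set"
  where "lin_maps R M N =
    {f \<in> carrier M \<rightarrow> carrier N.
       (\<forall>x\<in>carrier M. \<forall>y\<in>carrier M. f (x \<oplus>\<^bsub>M\<^esub> y) = f x \<oplus>\<^bsub>N\<^esub> f y) \<and>
       (\<forall>r\<in>carrier R. \<forall>x\<in>carrier M. f (r \<odot>\<^bsub>M\<^esub> x) = r \<odot>\<^bsub>N\<^esub> f x)}"

text \<open>A linear map out of the tensor product of the modules in the (nonempty) list \<open>Ms\<close> is
  given as a multilinear function of the list of its arguments.\<close>

definition multilinear ::
  "('r, 'm) ring_scheme \<Rightarrow> ('r, 'a, 'k) module_scheme list \<Rightarrow> ('r, 'b, 'l) module_scheme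
    \<Rightarrow> ('a list \<Rightarrow> 'b) \<Rightarrow> bool"
  where "multilinear R Ms N f \<longleftrightarrow>
    (\<forall>xs i. length xs = length Ms \<longrightarrow> i < length Ms \<longrightarrow>
       (\<forall>j<length Ms. j \<noteq> i \<longrightarrow> xs ! j \<in> carrier (Ms ! j)) \<longrightarrow>
       (\<lambda>x. f (xs[i := x])) \<in> lin_maps R (Ms ! i) N)"


section \<open>Operads\<close>

text \<open>Permutations of \<open>n\<close> letters are functions \<open>t\<close> with \<open>t permutes {..<n}\<close>; positions in a
  sequence are counted from \<open>0\<close>.  The library's \<open>permute_list t\<close> sends the sequence
  \<open>a\<^sub>0, a\<^sub>1, \<dots>\<close> to \<open>a\<^bsub>t(0)\<^esub>, a\<^bsub>t(1)\<^esub>, \<dots>\<close>.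

  For block sizes \<open>ks\<close>, \<open>block ks i\<close> lists the positions in the \<open>i\<close>-th block.  A permutation is
  given below by the list of its values, that is, by the rearrangement of \<open>0, 1, 2, \<dots>\<close>.\<close>

definition block :: "nat list \<Rightarrow> nat \<Rightarrow> nat list"
  where "block ks i = [sum_list (take i ks)..<sum_list (take (Suc i) ks)]"

definition perm_of_list :: "nat list \<Rightarrow> nat \<Rightarrow> nat"
  where "perm_of_list xs j = (if j < length xs then xs ! j else j)"

definition block_perm :: "nat list \<Rightarrow> (nat \<Rightarrow> nat) \<Rightarrow> nat \<Rightarrow> nat"
  where "block_perm ks t = perm_of_list (concat (map (\<lambda>i. block ks (t i)) [0..<length ks]))"

definition block_sum :: "nat list \<Rightarrow> (nat \<Rightarrow> nat \<Rightarrow> nat) \<Rightarrow> nat \<Rightarrow> nat"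
  where "block_sum ks s =
    perm_of_list (concat (map (\<lambda>i. permute_list (s i) (block ks i)) [0..<length ks]))"

text \<open>\<open>opcomp P [k\<^sub>1,\<dots>,k\<^sub>n] [\<theta>\<^sub>1,\<dots>,\<theta>\<^sub>n] \<theta>\<close> is \<open>\<gamma>(\<theta>\<^sub>1 \<otimes> \<dots> \<otimes> \<theta>\<^sub>n \<otimes> \<theta>)\<close>, where \<open>\<theta>\<^sub>i\<close> has
  arity \<open>k\<^sub>i\<close>; \<open>operm P n t \<theta>\<close> is \<open>t \<star> \<theta>\<close>.  Operads are reduced: nothing is required of
  \<open>ops P 0\<close>, and it is never used.\<close>

record ('r, 'p) operad =
  ops :: "nat \<Rightarrow> ('r, 'p) module"
  operm :: "nat \<Rightarrow> (nat \<Rightarrow> nat) \<Rightarrow> 'p \<Rightarrow> 'p"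
  opid :: 'p
  opcomp :: "nat list \<Rightarrow> 'p list \<Rightarrow> 'p \<Rightarrow> 'p"

definition arity_list :: "nat list \<Rightarrow> bool"
  where "arity_list ks \<longleftrightarrow> ks \<noteq> [] \<and> (\<forall>k\<in>set ks. 1 \<le> k)"

definition opseqs :: "('r, 'p) operad \<Rightarrow> nat list \<Rightarrow> 'p list set"
  where "opseqs P ks = {\<theta>s. list_all2 (\<lambda>k \<theta>. \<theta> \<in> carrier (ops P k)) ks \<theta>s}"

locale operad = R?: cring R for R (structure) and P :: "('r, 'p) operad" +
  assumes ops_module: "1 \<le> n \<Longrightarrow> module R (ops P n)"
    and perm_linear: "\<lbrakk>1 \<le> n; t permutes {..<n}\<rbrakk> \<Longrightarrow> operm P n t \<in> lin_maps R (ops P n) (ops P n)"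
    and perm_id: "\<lbrakk>1 \<le> n; \<theta> \<in> carrier (ops P n)\<rbrakk> \<Longrightarrow> operm P n id \<theta> = \<theta>"
    and perm_comp: "\<lbrakk>1 \<le> n; s permutes {..<n}; t permutes {..<n}; \<theta> \<in> carrier (ops P n)\<rbrakk>
      \<Longrightarrow> operm P n (s \<circ> t) \<theta> = operm P n s (operm P n t \<theta>)"
    and opid_closed: "opid P \<in> carrier (ops P 1)"
    and comp_multilinear: "\<lbrakk>arity_list ks; \<theta> \<in> carrier (ops P (length ks))\<rbrakk>
      \<Longrightarrow> multilinear R (map (ops P) ks) (ops P (sum_list ks)) (\<lambda>\<theta>s. opcomp P ks \<theta>s \<theta>)"
    and comp_linear: "\<lbrakk>arity_list ks; \<theta>s \<in> opseqs P ks\<rbrakk>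
      \<Longrightarrow> (\<lambda>\<theta>. opcomp P ks \<theta>s \<theta>) \<in> lin_maps R (ops P (length ks)) (ops P (sum_list ks))"
    and comp_id_left: "\<lbrakk>1 \<le> n; \<theta> \<in> carrier (ops P n)\<rbrakk>
      \<Longrightarrow> opcomp P (replicate n 1) (replicate n (opid P)) \<theta> = \<theta>"
    and comp_id_right: "\<lbrakk>1 \<le> n; \<theta> \<in> carrier (ops P n)\<rbrakk> \<Longrightarrow> opcomp P [n] [\<theta>] (opid P) = \<theta>"
    and comp_assoc: "\<lbrakk>kss \<noteq> []; \<forall>ks\<in>set kss. arity_list ks;
        list_all2 (\<lambda>ks \<theta>s. \<theta>s \<in> opseqs P ks) kss \<theta>ss;
        \<theta>s \<in> opseqs P (map length kss); \<theta> \<in> carrier (ops P (length kss))\<rbrakk>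
      \<Longrightarrow> opcomp P (map sum_list kss)
             (map (\<lambda>i. opcomp P (kss ! i) (\<theta>ss ! i) (\<theta>s ! i)) [0..<length kss]) \<theta>
           = opcomp P (concat kss) (concat \<theta>ss) (opcomp P (map length kss) \<theta>s \<theta>)"
    and comp_equivariant1: "\<lbrakk>arity_list ks; t permutes {..<length ks}; \<theta>s \<in> opseqs P ks;
        \<theta> \<in> carrier (ops P (length ks))\<rbrakk>
      \<Longrightarrow> opcomp P ks \<theta>s (operm P (length ks) t \<theta>)
           = operm P (sum_list ks) (block_perm ks t)
               (opcomp P (permute_list t ks) (permute_list t \<theta>s) \<theta>)"
    and comp_equivariant2: "\<lbrakk>arity_list ks; \<forall>i<length ks. p i permutes {..<ks ! i}; \<theta>s \<in> opseqs P ks;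
        \<theta> \<in> carrier (ops P (length ks))\<rbrakk>
      \<Longrightarrow> opcomp P ks (map (\<lambda>i. operm P (ks ! i) (p i) (\<theta>s ! i)) [0..<length ks]) \<theta>
           = operm P (sum_list ks) (block_sum ks p) (opcomp P ks \<theta>s \<theta>)"

text \<open>\<open>R\<close> and the algebra of unary operations are isomorphic as \<open>R\<close>-algebras.\<close>

definition unary_ops_are_scalars :: "('r, 'm) ring_scheme \<Rightarrow> ('r, 'p) operad \<Rightarrow> bool"
  where "unary_ops_are_scalars R P \<longleftrightarrow>
    (\<exists>\<phi>. bij_betw \<phi> (carrier R) (carrier (ops P 1)) \<and>
       (\<forall>r\<in>carrier R. \<forall>s\<in>carrier R. \<phi> (r \<oplus>\<^bsub>R\<^esub> s) = \<phi> r \<oplus>\<^bsub>ops P 1\<^esub> \<phi> s) \<and>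
       (\<forall>r\<in>carrier R. \<forall>s\<in>carrier R. \<phi> (r \<otimes>\<^bsub>R\<^esub> s) = r \<odot>\<^bsub>ops P 1\<^esub> \<phi> s) \<and>
       (\<forall>r\<in>carrier R. \<forall>s\<in>carrier R. \<phi> (r \<otimes>\<^bsub>R\<^esub> s) = opcomp P [1] [\<phi> r] (\<phi> s)) \<and>
       \<phi> \<one>\<^bsub>R\<^esub> = opid P)"


section \<open>The category of algebras over an operad\<close>

text \<open>\<open>mu A [a\<^sub>1,\<dots>,a\<^sub>n] \<theta>\<close> is \<open>\<mu>\<^sub>n(a\<^sub>1 \<otimes> \<dots> \<otimes> a\<^sub>n \<otimes> \<theta>)\<close>; the arity is the length of the list.
  The ring multiplication and unit which the library's module records inherit are junk.\<close>

record ('r, 'p, 'a) palg = "('r, 'a) module" +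
  mu :: "'a list \<Rightarrow> 'p \<Rightarrow> 'a"

locale palgebra = operad R P + A?: module R A
  for R (structure) and P :: "('r, 'p) operad" and A :: "('r, 'p, 'a) palg" (structure) +
  assumes mu_multilinear: "\<lbrakk>1 \<le> n; \<theta> \<in> carrier (ops P n)\<rbrakk>
      \<Longrightarrow> multilinear R (replicate n A) A (\<lambda>as. mu A as \<theta>)"
    and mu_linear: "\<lbrakk>as \<noteq> []; set as \<subseteq> carrier A\<rbrakk>
      \<Longrightarrow> (\<lambda>\<theta>. mu A as \<theta>) \<in> lin_maps R (ops P (length as)) A"
    and mu_opid: "a \<in> carrier A \<Longrightarrow> mu A [a] (opid P) = a"
    and mu_comp: "\<lbrakk>arity_list ks; \<theta>s \<in> opseqs P ks; \<theta> \<in> carrier (ops P (length ks));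
        map length ass = ks; \<forall>as\<in>set ass. set as \<subseteq> carrier A\<rbrakk>
      \<Longrightarrow> mu A (concat ass) (opcomp P ks \<theta>s \<theta>) = mu A (map2 (mu A) ass \<theta>s) \<theta>"
    and mu_perm: "\<lbrakk>as \<noteq> []; set as \<subseteq> carrier A; t permutes {..<length as};
        \<theta> \<in> carrier (ops P (length as))\<rbrakk>
      \<Longrightarrow> mu A as (operm P (length as) t \<theta>) = mu A (permute_list t as) \<theta>"

definition palg_hom ::
  "('r, 'm) ring_scheme \<Rightarrow> ('r, 'p) operad \<Rightarrow> ('r, 'p, 'a) palg \<Rightarrow> ('r, 'p, 'b) palg \<Rightarrow> ('a \<Rightarrow> 'b) set"
  where "palg_hom R P A B =
    {f \<in> lin_maps R A B. \<forall>as \<theta>. as \<noteq> [] \<longrightarrow> set as \<subseteq> carrier A \<longrightarrow> \<theta> \<in> carrier (ops P (length as)) \<longrightarrow>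
       f (mu A as \<theta>) = mu B (map f as) \<theta>}"

definition palg_iso ::
  "('r, 'm) ring_scheme \<Rightarrow> ('r, 'p) operad \<Rightarrow> ('r, 'p, 'a) palg \<Rightarrow> ('r, 'p, 'b) palg \<Rightarrow> ('a \<Rightarrow> 'b) set"
  where "palg_iso R P A B = {f \<in> palg_hom R P A B. bij_betw f (carrier A) (carrier B)}"


subsection \<open>Products, kernels and quotients\<close>

definition palg_prod :: "('r, 'p, 'a) palg \<Rightarrow> ('r, 'p, 'b) palg \<Rightarrow> ('r, 'p, 'a \<times> 'b) palg"
  where "palg_prod A B =
    \<lparr>carrier = carrier A \<times> carrier B,
     monoid.mult = (\<lambda>_ _. undefined), monoid.one = undefined,
     zero = (\<zero>\<^bsub>A\<^esub>, \<zero>\<^bsub>B\<^esub>),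
     add = (\<lambda>x y. (fst x \<oplus>\<^bsub>A\<^esub> fst y, snd x \<oplus>\<^bsub>B\<^esub> snd y)),
     smult = (\<lambda>r x. (r \<odot>\<^bsub>A\<^esub> fst x, r \<odot>\<^bsub>B\<^esub> snd x)),
     mu = (\<lambda>xs \<theta>. (mu A (map fst xs) \<theta>, mu B (map snd xs) \<theta>))\<rparr>"

definition palg_kernel ::
  "('r, 'p, 'a) palg \<Rightarrow> ('r, 'p, 'b) palg \<Rightarrow> ('a \<Rightarrow> 'b) \<Rightarrow> ('r, 'p, 'a) palg"
  where "palg_kernel A B f = A\<lparr>carrier := a_kernel A B f\<rparr>"

text \<open>The elements of the quotient by an ideal \<open>I\<close> are the cosets \<open>I +> x\<close>.  The unions below are
  unions of one and the same coset.\<close>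

definition palg_quot :: "('r, 'p, 'a) palg \<Rightarrow> 'a set \<Rightarrow> ('r, 'p, 'a set) palg"
  where "palg_quot A I =
    \<lparr>carrier = a_rcosets\<^bsub>A\<^esub> I,
     monoid.mult = (\<lambda>_ _. undefined), monoid.one = undefined,
     zero = I,
     add = (\<lambda>C D. C <+>\<^bsub>A\<^esub> D),
     smult = (\<lambda>r C. \<Union>x\<in>C. I +>\<^bsub>A\<^esub> (r \<odot>\<^bsub>A\<^esub> x)),
     mu = (\<lambda>Cs \<theta>. \<Union>{I +>\<^bsub>A\<^esub> mu A xs \<theta> | xs. list_all2 (\<in>) xs Cs})\<rparr>"

text \<open>The map induced by \<open>f\<close> on a set of classes on each of which \<open>f\<close> is constant.\<close>

definition class_lift :: "('a \<Rightarrow> 'b) \<Rightarrow> 'a set \<Rightarrow> 'b"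
  where "class_lift f C = the_elem (f ` C)"


subsection \<open>Coproducts\<close>

text \<open>The algebra presented by a set \<open>G\<close> of generators and a set \<open>E\<close> of relations: its elements are
  the classes of terms under the least congruence which contains \<open>E\<close> and satisfies the laws of
  \<open>P\<close>-algebras.\<close>

datatype ('r, 'p, 'x) pterm =
    Gen 'x
  | Zero
  | Plus "('r, 'p, 'x) pterm" "('r, 'p, 'x) pterm"
  | Scal 'r "('r, 'p, 'x) pterm"
  | Op 'p "('r, 'p, 'x) pterm list"

inductive_set pterms :: "('r, 'm) ring_scheme \<Rightarrow> ('r, 'p) operad \<Rightarrow> 'x set \<Rightarrow> ('r, 'p, 'x) pterm set"
  for R :: "('r, 'm) ring_scheme" and P :: "('r, 'p) operad" and G :: "'x set" where
  pterm_Gen: "x \<in> G \<Longrightarrow> Gen x \<in> pterms R P G"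
| pterm_Zero: "Zero \<in> pterms R P G"
| pterm_Plus: "\<lbrakk>s \<in> pterms R P G; t \<in> pterms R P G\<rbrakk> \<Longrightarrow> Plus s t \<in> pterms R P G"
| pterm_Scal: "\<lbrakk>r \<in> carrier R; t \<in> pterms R P G\<rbrakk> \<Longrightarrow> Scal r t \<in> pterms R P G"
| pterm_Op: "\<lbrakk>ts \<noteq> []; \<forall>t\<in>set ts. t \<in> pterms R P G; \<theta> \<in> carrier (ops P (length ts))\<rbrakk>
    \<Longrightarrow> Op \<theta> ts \<in> pterms R P G"

inductive pres_eq ::
  "('r, 'm) ring_scheme \<Rightarrow> ('r, 'p) operad \<Rightarrow> 'x set
    \<Rightarrow> (('r, 'p, 'x) pterm \<times> ('r, 'p, 'x) pterm) set
    \<Rightarrow> ('r, 'p, 'x) pterm \<Rightarrow> ('r, 'p, 'x) pterm \<Rightarrow> bool"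
  for R :: "('r, 'm) ring_scheme" and P :: "('r, 'p) operad" and G :: "'x set"
    and E :: "(('r, 'p, 'x) pterm \<times> ('r, 'p, 'x) pterm) set" where
  peq_rel: "\<lbrakk>(s, t) \<in> E; s \<in> pterms R P G; t \<in> pterms R P G\<rbrakk> \<Longrightarrow> pres_eq R P G E s t"
| peq_refl: "t \<in> pterms R P G \<Longrightarrow> pres_eq R P G E t t"
| peq_sym: "pres_eq R P G E s t \<Longrightarrow> pres_eq R P G E t s"
| peq_trans: "\<lbrakk>pres_eq R P G E s t; pres_eq R P G E t u\<rbrakk> \<Longrightarrow> pres_eq R P G E s u"
| peq_Plus_cong: "\<lbrakk>pres_eq R P G E s s'; pres_eq R P G E t t'\<rbrakk>
    \<Longrightarrow> pres_eq R P G E (Plus s t) (Plus s' t')"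
| peq_Scal_cong: "\<lbrakk>r \<in> carrier R; pres_eq R P G E t t'\<rbrakk> \<Longrightarrow> pres_eq R P G E (Scal r t) (Scal r t')"
| peq_Op_cong: "\<lbrakk>ts \<noteq> []; list_all2 (pres_eq R P G E) ts ts'; \<theta> \<in> carrier (ops P (length ts))\<rbrakk>
    \<Longrightarrow> pres_eq R P G E (Op \<theta> ts) (Op \<theta> ts')"
| peq_Plus_assoc: "\<lbrakk>s \<in> pterms R P G; t \<in> pterms R P G; u \<in> pterms R P G\<rbrakk>
    \<Longrightarrow> pres_eq R P G E (Plus (Plus s t) u) (Plus s (Plus t u))"
| peq_Plus_comm: "\<lbrakk>s \<in> pterms R P G; t \<in> pterms R P G\<rbrakk>
    \<Longrightarrow> pres_eq R P G E (Plus s t) (Plus t s)"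
| peq_Plus_Zero: "t \<in> pterms R P G \<Longrightarrow> pres_eq R P G E (Plus Zero t) t"
| peq_Plus_neg: "t \<in> pterms R P G \<Longrightarrow> pres_eq R P G E (Plus (Scal (\<ominus>\<^bsub>R\<^esub> \<one>\<^bsub>R\<^esub>) t) t) Zero"
| peq_Scal_add: "\<lbrakk>r \<in> carrier R; s \<in> carrier R; t \<in> pterms R P G\<rbrakk>
    \<Longrightarrow> pres_eq R P G E (Scal (r \<oplus>\<^bsub>R\<^esub> s) t) (Plus (Scal r t) (Scal s t))"
| peq_Scal_Plus: "\<lbrakk>r \<in> carrier R; t \<in> pterms R P G; u \<in> pterms R P G\<rbrakk>
    \<Longrightarrow> pres_eq R P G E (Scal r (Plus t u)) (Plus (Scal r t) (Scal r u))"
| peq_Scal_mult: "\<lbrakk>r \<in> carrier R; s \<in> carrier R; t \<in> pterms R P G\<rbrakk>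
    \<Longrightarrow> pres_eq R P G E (Scal (r \<otimes>\<^bsub>R\<^esub> s) t) (Scal r (Scal s t))"
| peq_Scal_one: "t \<in> pterms R P G \<Longrightarrow> pres_eq R P G E (Scal \<one>\<^bsub>R\<^esub> t) t"
| peq_Op_Plus: "\<lbrakk>\<forall>t\<in>set ts \<union> set us. t \<in> pterms R P G; s \<in> pterms R P G; s' \<in> pterms R P G;
      \<theta> \<in> carrier (ops P (length (ts @ s # us)))\<rbrakk>
    \<Longrightarrow> pres_eq R P G E (Op \<theta> (ts @ Plus s s' # us))
          (Plus (Op \<theta> (ts @ s # us)) (Op \<theta> (ts @ s' # us)))"
| peq_Op_Scal: "\<lbrakk>\<forall>t\<in>set ts \<union> set us. t \<in> pterms R P G; s \<in> pterms R P G; r \<in> carrier R;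
      \<theta> \<in> carrier (ops P (length (ts @ s # us)))\<rbrakk>
    \<Longrightarrow> pres_eq R P G E (Op \<theta> (ts @ Scal r s # us)) (Scal r (Op \<theta> (ts @ s # us)))"
| peq_Op_add: "\<lbrakk>ts \<noteq> []; \<forall>t\<in>set ts. t \<in> pterms R P G;
      \<theta> \<in> carrier (ops P (length ts)); \<theta>' \<in> carrier (ops P (length ts))\<rbrakk>
    \<Longrightarrow> pres_eq R P G E (Op (\<theta> \<oplus>\<^bsub>ops P (length ts)\<^esub> \<theta>') ts) (Plus (Op \<theta> ts) (Op \<theta>' ts))"
| peq_Op_smult: "\<lbrakk>ts \<noteq> []; \<forall>t\<in>set ts. t \<in> pterms R P G; r \<in> carrier R;
      \<theta> \<in> carrier (ops P (length ts))\<rbrakk>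
    \<Longrightarrow> pres_eq R P G E (Op (r \<odot>\<^bsub>ops P (length ts)\<^esub> \<theta>) ts) (Scal r (Op \<theta> ts))"
| peq_Op_opid: "t \<in> pterms R P G \<Longrightarrow> pres_eq R P G E (Op (opid P) [t]) t"
| peq_Op_comp: "\<lbrakk>arity_list ks; \<theta>s \<in> opseqs P ks; \<theta> \<in> carrier (ops P (length ks));
      map length tss = ks; \<forall>ts\<in>set tss. \<forall>t\<in>set ts. t \<in> pterms R P G\<rbrakk>
    \<Longrightarrow> pres_eq R P G E (Op (opcomp P ks \<theta>s \<theta>) (concat tss)) (Op \<theta> (map2 Op \<theta>s tss))"
| peq_Op_perm: "\<lbrakk>ts \<noteq> []; \<forall>t\<in>set ts. t \<in> pterms R P G; p permutes {..<length ts};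
      \<theta> \<in> carrier (ops P (length ts))\<rbrakk>
    \<Longrightarrow> pres_eq R P G E (Op (operm P (length ts) p \<theta>) ts) (Op \<theta> (permute_list p ts))"

definition presented ::
  "('r, 'm) ring_scheme \<Rightarrow> ('r, 'p) operad \<Rightarrow> 'x set
    \<Rightarrow> (('r, 'p, 'x) pterm \<times> ('r, 'p, 'x) pterm) set \<Rightarrow> ('r, 'p, ('r, 'p, 'x) pterm set) palg"
  where "presented R P G E =
    \<lparr>carrier = (\<lambda>t. Collect (pres_eq R P G E t)) ` pterms R P G,
     monoid.mult = (\<lambda>_ _. undefined), monoid.one = undefined,
     zero = Collect (pres_eq R P G E Zero),
     add = (\<lambda>C D. {u. \<exists>s\<in>C. \<exists>t\<in>D. pres_eq R P G E (Plus s t) u}),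
     smult = (\<lambda>r C. {u. \<exists>t\<in>C. pres_eq R P G E (Scal r t) u}),
     mu = (\<lambda>Cs \<theta>. {u. \<exists>ts. list_all2 (\<in>) ts Cs \<and> pres_eq R P G E (Op \<theta> ts) u})\<rparr>"

text \<open>The coproduct is generated by the disjoint union of the two algebras, subject to the
  relations which say that the two inclusions are morphisms.\<close>

definition hom_rels ::
  "('r, 'm) ring_scheme \<Rightarrow> ('r, 'p) operad \<Rightarrow> ('r, 'p, 'a) palg \<Rightarrow> ('a \<Rightarrow> 'x)
    \<Rightarrow> (('r, 'p, 'x) pterm \<times> ('r, 'p, 'x) pterm) set"
  where "hom_rels R P A j =
    {(Gen (j (a \<oplus>\<^bsub>A\<^esub> a')), Plus (Gen (j a)) (Gen (j a'))) | a a'. a \<in> carrier A \<and> a' \<in> carrier A} \<union>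
    {(Gen (j (r \<odot>\<^bsub>A\<^esub> a)), Scal r (Gen (j a))) | r a. r \<in> carrier R \<and> a \<in> carrier A} \<union>
    {(Gen (j (mu A as \<theta>)), Op \<theta> (map (\<lambda>a. Gen (j a)) as)) | as \<theta>.
        as \<noteq> [] \<and> set as \<subseteq> carrier A \<and> \<theta> \<in> carrier (ops P (length as))}"

definition coprod_rels ::
  "('r, 'm) ring_scheme \<Rightarrow> ('r, 'p) operad \<Rightarrow> ('r, 'p, 'a) palg \<Rightarrow> ('r, 'p, 'b) palg
    \<Rightarrow> (('r, 'p, 'a + 'b) pterm \<times> ('r, 'p, 'a + 'b) pterm) set"
  where "coprod_rels R P A B = hom_rels R P A Inl \<union> hom_rels R P B Inr"

type_synonym ('r, 'p, 'a, 'b) coprod = "('r, 'p, 'a + 'b) pterm set"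

definition coprod ::
  "('r, 'm) ring_scheme \<Rightarrow> ('r, 'p) operad \<Rightarrow> ('r, 'p, 'a) palg \<Rightarrow> ('r, 'p, 'b) palg
    \<Rightarrow> ('r, 'p, ('r, 'p, 'a, 'b) coprod) palg"
  where "coprod R P A B = presented R P (carrier A <+> carrier B) (coprod_rels R P A B)"

definition coprod_inl ::
  "('r, 'm) ring_scheme \<Rightarrow> ('r, 'p) operad \<Rightarrow> ('r, 'p, 'a) palg \<Rightarrow> ('r, 'p, 'b) palg
    \<Rightarrow> 'a \<Rightarrow> ('r, 'p, 'a, 'b) coprod"
  where "coprod_inl R P A B a =
    Collect (pres_eq R P (carrier A <+> carrier B) (coprod_rels R P A B) (Gen (Inl a)))"

definition coprod_inr ::
  "('r, 'm) ring_scheme \<Rightarrow> ('r, 'p) operad \<Rightarrow> ('r, 'p, 'a) palg \<Rightarrow> ('r, 'p, 'b) palg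
    \<Rightarrow> 'b \<Rightarrow> ('r, 'p, 'a, 'b) coprod"
  where "coprod_inr R P A B b =
    Collect (pres_eq R P (carrier A <+> carrier B) (coprod_rels R P A B) (Gen (Inr b)))"

primrec peval :: "('r, 'p, 'd) palg \<Rightarrow> ('x \<Rightarrow> 'd) \<Rightarrow> ('r, 'p, 'x) pterm \<Rightarrow> 'd" where
  "peval D g (Gen x) = g x"
| "peval D g Zero = \<zero>\<^bsub>D\<^esub>"
| "peval D g (Plus s t) = peval D g s \<oplus>\<^bsub>D\<^esub> peval D g t"
| "peval D g (Scal r t) = r \<odot>\<^bsub>D\<^esub> peval D g t"
| "peval D g (Op \<theta> ts) = mu D (map (peval D g) ts) \<theta>"

definition copair ::
  "('r, 'p, 'd) palg \<Rightarrow> ('a \<Rightarrow> 'd) \<Rightarrow> ('b \<Rightarrow> 'd) \<Rightarrow> ('r, 'p, 'a, 'b) coprod \<Rightarrow> 'd"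
  where "copair D f g = class_lift (peval D (case_sum f g))"


section \<open>Two-nilpotent algebras\<close>

definition zero_map :: "('r, 'p, 'd) palg \<Rightarrow> 'a \<Rightarrow> 'd"
  where "zero_map D = (\<lambda>_. \<zero>\<^bsub>D\<^esub>)"

definition cosmash3_map ::
  "('r, 'm) ring_scheme \<Rightarrow> ('r, 'p) operad
    \<Rightarrow> ('r, 'p, 'a) palg \<Rightarrow> ('r, 'p, 'b) palg \<Rightarrow> ('r, 'p, 'c) palg
    \<Rightarrow> ('r, 'p, ('r, 'p, 'a, 'b) coprod, 'c) coprod
    \<Rightarrow> (('r, 'p, 'a, 'b) coprod \<times> ('r, 'p, 'a, 'c) coprod) \<times> ('r, 'p, 'b, 'c) coprod"
  where "cosmash3_map R P X Y Z u =
    ((copair (coprod R P X Y) id (zero_map (coprod R P X Y)) u,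
      copair (coprod R P X Z)
        (copair (coprod R P X Z) (coprod_inl R P X Z) (zero_map (coprod R P X Z)))
        (coprod_inr R P X Z) u),
     copair (coprod R P Y Z)
       (copair (coprod R P Y Z) (zero_map (coprod R P Y Z)) (coprod_inl R P Y Z))
       (coprod_inr R P Y Z) u)"

definition cosmash3 ::
  "('r, 'm) ring_scheme \<Rightarrow> ('r, 'p) operad
    \<Rightarrow> ('r, 'p, 'a) palg \<Rightarrow> ('r, 'p, 'b) palg \<Rightarrow> ('r, 'p, 'c) palg
    \<Rightarrow> ('r, 'p, ('r, 'p, ('r, 'p, 'a, 'b) coprod, 'c) coprod) palg"
  where "cosmash3 R P X Y Z =
    palg_kernel (coprod R P (coprod R P X Y) Z)
      (palg_prod (palg_prod (coprod R P X Y) (coprod R P X Z)) (coprod R P Y Z))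
      (cosmash3_map R P X Y Z)"

text \<open>\<open>[X,X,X]\<close>\<close>

definition triple_comm :: "('r, 'm) ring_scheme \<Rightarrow> ('r, 'p) operad \<Rightarrow> ('r, 'p, 'a) palg \<Rightarrow> 'a set"
  where "triple_comm R P X = copair X (copair X id id) id ` carrier (cosmash3 R P X X X)"

definition two_nilpotent :: "('r, 'm) ring_scheme \<Rightarrow> ('r, 'p) operad \<Rightarrow> ('r, 'p, 'a) palg \<Rightarrow> bool"
  where "two_nilpotent R P X \<longleftrightarrow> triple_comm R P X = {\<zero>\<^bsub>X\<^esub>}"

definition nil2 :: "('r, 'm) ring_scheme \<Rightarrow> ('r, 'p) operad \<Rightarrow> ('r, 'p, 'a) palg \<Rightarrow> ('r, 'p, 'a set) palg"
  where "nil2 R P X = palg_quot X (triple_comm R P X)"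

definition nil2_proj ::
  "('r, 'm) ring_scheme \<Rightarrow> ('r, 'p) operad \<Rightarrow> ('r, 'p, 'a) palg \<Rightarrow> 'a \<Rightarrow> 'a set"
  where "nil2_proj R P X x = triple_comm R P X +>\<^bsub>X\<^esub> x"

definition nil2_map ::
  "('r, 'm) ring_scheme \<Rightarrow> ('r, 'p) operad \<Rightarrow> ('r, 'p, 'b) palg \<Rightarrow> ('a \<Rightarrow> 'b) \<Rightarrow> 'a set \<Rightarrow> 'b set"
  where "nil2_map R P Y f = class_lift (\<lambda>x. nil2_proj R P Y (f x))"


section \<open>The bilinear product\<close>

text \<open>Coproducts in a reflective subcategory are the reflections of coproducts in the ambient
  category; products are the same.\<close>

type_synonym ('r, 'p, 'a, 'b) coprod2 = "('r, 'p, 'a, 'b) coprod set"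

definition coprod2 ::
  "('r, 'm) ring_scheme \<Rightarrow> ('r, 'p) operad \<Rightarrow> ('r, 'p, 'a) palg \<Rightarrow> ('r, 'p, 'b) palg
    \<Rightarrow> ('r, 'p, ('r, 'p, 'a, 'b) coprod2) palg"
  where "coprod2 R P X Y = nil2 R P (coprod R P X Y)"

definition coprod2_inl ::
  "('r, 'm) ring_scheme \<Rightarrow> ('r, 'p) operad \<Rightarrow> ('r, 'p, 'a) palg \<Rightarrow> ('r, 'p, 'b) palg
    \<Rightarrow> 'a \<Rightarrow> ('r, 'p, 'a, 'b) coprod2"
  where "coprod2_inl R P X Y x = nil2_proj R P (coprod R P X Y) (coprod_inl R P X Y x)"

definition coprod2_inr ::
  "('r, 'm) ring_scheme \<Rightarrow> ('r, 'p) operad \<Rightarrow> ('r, 'p, 'a) palg \<Rightarrow> ('r, 'p, 'b) palg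
    \<Rightarrow> 'b \<Rightarrow> ('r, 'p, 'a, 'b) coprod2"
  where "coprod2_inr R P X Y y = nil2_proj R P (coprod R P X Y) (coprod_inr R P X Y y)"

definition copair2 ::
  "('r, 'p, 'd) palg \<Rightarrow> ('a \<Rightarrow> 'd) \<Rightarrow> ('b \<Rightarrow> 'd) \<Rightarrow> ('r, 'p, 'a, 'b) coprod2 \<Rightarrow> 'd"
  where "copair2 D f g = class_lift (copair D f g)"

definition cosmash2 ::
  "('r, 'm) ring_scheme \<Rightarrow> ('r, 'p) operad \<Rightarrow> ('r, 'p, 'a) palg \<Rightarrow> ('r, 'p, 'b) palg
    \<Rightarrow> ('r, 'p, ('r, 'p, 'a, 'b) coprod2) palg"
  where "cosmash2 R P X Y =
    palg_kernel (coprod2 R P X Y) (palg_prod X Y)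
      (\<lambda>u. (copair2 X id (zero_map X) u, copair2 Y (zero_map Y) id u))"

type_synonym ('r, 'p, 'a, 'b) bilin = "('r, 'p, 'a set, 'b set) coprod2"

definition bilin ::
  "('r, 'm) ring_scheme \<Rightarrow> ('r, 'p) operad \<Rightarrow> ('r, 'p, 'a) palg \<Rightarrow> ('r, 'p, 'b) palg
    \<Rightarrow> ('r, 'p, ('r, 'p, 'a, 'b) bilin) palg"
  where "bilin R P A B = cosmash2 R P (nil2 R P A) (nil2 R P B)"

text \<open>The action of the bilinear product on morphisms \<open>f : A \<rightarrow> A'\<close> and \<open>g : B \<rightarrow> B'\<close>.\<close>

definition bilin_map ::
  "('r, 'm) ring_scheme \<Rightarrow> ('r, 'p) operad \<Rightarrow> ('r, 'p, 'a1) palg \<Rightarrow> ('r, 'p, 'b1) palg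
    \<Rightarrow> ('a \<Rightarrow> 'a1) \<Rightarrow> ('b \<Rightarrow> 'b1) \<Rightarrow> ('r, 'p, 'a, 'b) bilin \<Rightarrow> ('r, 'p, 'a1, 'b1) bilin"
  where "bilin_map R P A' B' f g =
    copair2 (coprod2 R P (nil2 R P A') (nil2 R P B'))
      (\<lambda>x. coprod2_inl R P (nil2 R P A') (nil2 R P B') (nil2_map R P A' f x))
      (\<lambda>y. coprod2_inr R P (nil2 R P A') (nil2 R P B') (nil2_map R P B' g y))"

end

theory Submission
  imports Defs
begin

text \<open>Flattening iterated operations shows that every element of an algebra generated by \<open>G\<close> is a sum
  of operations applied to elements of \<open>G\<close>.  Applied to \<open>X + X + X\<close> this identifies \<open>[X,X,X]\<close> with
  the span of the values of all operations of arity at least three; applied to the two-nilpotent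
  coproduct it shows that \<open>A \<otimes> B\<close> is spanned by the binary products \<open>\<theta>(a, b)\<close>, and that on \<open>A \<otimes> B\<close>
  all operations of arity at least two vanish.  Given a trilinear \<open>\<beta>(a, b, \<theta>)\<close> with values in a
  module \<open>M\<close> that kills decomposable \<open>a\<close> and \<open>b\<close>, the module \<open>nil\<^sub>2 A \<times> nil\<^sub>2 B \<times> M\<close> becomes a
  two-nilpotent algebra in which the product of \<open>a\<close> and \<open>b\<close> is \<open>\<beta>(a, b, \<theta>)\<close>; here \<open>P(1) = R\<close> is
  what makes the unary operations act on \<open>M\<close>.  Hence \<open>A \<otimes> B\<close> is universal among such \<open>\<beta>\<close>, and
  \<open>\<theta>'(\<theta>(a, b), c) \<mapsto> \<theta>'(a, \<theta>(b, c))\<close> defines the natural isomorphism.\<close>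

section \<open>Linear and multilinear maps\<close>

text \<open>Write \<open>A'\<close> for A modulo all products of two or more factors. As a module, A
  \<otimes> B turns out to be the tensor product over R of \<open>A'\<close>, \<open>B'\<close> and
  P(2). Since products vanish on A \<otimes> B, both bracketings give \<open>A'\<close>,
  \<open>B'\<close>, \<open>C'\<close> and two copies of P(2). Here \<theta> is the inner and
  \<theta>' the outer operation on both sides; they are independent tensor factors, and no composite
  in the operad relates the two bracketings.

  The obstacle is that a coproduct is a set of classes of terms without normal forms. Spanning sets
  bound it from above; that nothing more gets identified is seen only by mapping it to an algebra
  built by hand, which is the purpose of the one with underlying module nil_2 A x nil_2 B x M. No
  tensor product of modules is constructed: existence of linear maps on A \<otimes> B and their
  determination by generators do its work. Between algebras whose products vanish, linear maps are
  already morphisms, so bijectivity and naturality become comparisons of formulas on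
  generators.\<close>

lemma lin_mapsI:
  assumes "\<And>x. x \<in> carrier M \<Longrightarrow> f x \<in> carrier N"
    and "\<And>x y. \<lbrakk>x \<in> carrier M; y \<in> carrier M\<rbrakk> \<Longrightarrow> f (x \<oplus>\<^bsub>M\<^esub> y) = f x \<oplus>\<^bsub>N\<^esub> f y"
    and "\<And>r x. \<lbrakk>r \<in> carrier R; x \<in> carrier M\<rbrakk> \<Longrightarrow> f (r \<odot>\<^bsub>M\<^esub> x) = r \<odot>\<^bsub>N\<^esub> f x"
  shows "f \<in> lin_maps R M N"
  using assms unfolding lin_maps_def by auto

lemma lin_mapsD:
  assumes "f \<in> lin_maps R M N"
  shows "x \<in> carrier M \<Longrightarrow> f x \<in> carrier N"
    and "\<lbrakk>x \<in> carrier M; y \<in> carrier M\<rbrakk> \<Longrightarrow> f (x \<oplus>\<^bsub>M\<^esub> y) = f x \<oplus>\<^bsub>N\<^esub> f y"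
    and "\<lbrakk>r \<in> carrier R; x \<in> carrier M\<rbrakk> \<Longrightarrow> f (r \<odot>\<^bsub>M\<^esub> x) = r \<odot>\<^bsub>N\<^esub> f x"
  using assms unfolding lin_maps_def by auto

lemma lin_maps_zero:
  assumes "f \<in> lin_maps R M N" "abelian_group M" "abelian_group N"
  shows "f \<zero>\<^bsub>M\<^esub> = \<zero>\<^bsub>N\<^esub>"
proof -
  interpret M: abelian_group M by fact
  interpret N: abelian_group N by fact
  have "f \<zero>\<^bsub>M\<^esub> \<oplus>\<^bsub>N\<^esub> f \<zero>\<^bsub>M\<^esub> = f \<zero>\<^bsub>M\<^esub>"
    using lin_mapsD(2)[OF assms(1) M.zero_closed M.zero_closed] by simp
  then show ?thesis using lin_mapsD(1)[OF assms(1) M.zero_closed] N.add.l_cancel_one' by metis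
qed

lemma lin_maps_comp:
  "\<lbrakk>f \<in> lin_maps R M N; g \<in> lin_maps R N L\<rbrakk> \<Longrightarrow> (\<lambda>x. g (f x)) \<in> lin_maps R M L"
  by (rule lin_mapsI) (simp_all add: lin_mapsD)

lemma lin_maps_id: "(\<lambda>x. x) \<in> lin_maps R M M"
  by (rule lin_mapsI) auto

lemma lin_maps_const_zero: "module R N \<Longrightarrow> (\<lambda>x. \<zero>\<^bsub>N\<^esub>) \<in> lin_maps R M N"
proof (rule lin_mapsI)
  assume "module R N"
  then interpret module R N .
  show "\<zero>\<^bsub>N\<^esub> \<in> carrier N" "\<zero>\<^bsub>N\<^esub> = \<zero>\<^bsub>N\<^esub> \<oplus>\<^bsub>N\<^esub> \<zero>\<^bsub>N\<^esub>" by simp_all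
  show "\<And>r. r \<in> carrier R \<Longrightarrow> \<zero>\<^bsub>N\<^esub> = r \<odot>\<^bsub>N\<^esub> \<zero>\<^bsub>N\<^esub>" by simp
qed

lemma lin_maps_into_subset:
  assumes "f \<in> lin_maps R N M" "\<And>x. x \<in> carrier N \<Longrightarrow> f x \<in> S"
  shows "f \<in> lin_maps R N (M\<lparr>carrier := S\<rparr>)"
  using assms(2) lin_mapsD(2,3)[OF assms(1)] by (intro lin_mapsI) auto

lemma lin_maps_sum:
  assumes "module R N" "f \<in> lin_maps R M N" "g \<in> lin_maps R M N"
  shows "(\<lambda>x. f x \<oplus>\<^bsub>N\<^esub> g x) \<in> lin_maps R M N"
proof -
  interpret N: module R N by fact
  show ?thesis
    by (rule lin_mapsI) (simp_all add: lin_mapsD[OF assms(2)] lin_mapsD[OF assms(3)] N.smult_r_distr N.M.a_ac)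
qed

lemma lin_maps_scale:
  assumes "module R N" "f \<in> lin_maps R M N" "s \<in> carrier R"
  shows "(\<lambda>x. s \<odot>\<^bsub>N\<^esub> f x) \<in> lin_maps R M N"
proof -
  interpret N: module R N by fact
  show ?thesis
    by (rule lin_mapsI)
      (use assms(3) in \<open>simp_all add: lin_mapsD[OF assms(2)] N.smult_r_distr flip: N.smult_assoc1\<close>,
       simp add: N.R.m_comm)
qed

text \<open>When all factors are equal, a slot can be marked by splitting the argument list as
  \<open>xs @ x # ys\<close> instead of updating at an index. The laws of \<open>pres_eq\<close>
  single out an argument in the same way.\<close>

lemma multilinear_replicate:
  "multilinear R (replicate n A) N f \<longleftrightarrow>
    (\<forall>xs ys. length xs + Suc (length ys) = n \<longrightarrow> set xs \<subseteq> carrier A \<longrightarrow> set ys \<subseteq> carrier A \<longrightarrow>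
      (\<lambda>x. f (xs @ x # ys)) \<in> lin_maps R A N)" (is "?L \<longleftrightarrow> ?R")
proof
  assume L: ?L
  show ?R
  proof (intro allI impI)
    fix xs ys
    assume len: "length xs + Suc (length ys) = n" and xs: "set xs \<subseteq> carrier A" and ys: "set ys \<subseteq> carrier A"
    \<comment> \<open>\<open>undefined\<close> only fills the slot that the list update
      overwrites.\<close>
    let ?zs = "xs @ undefined # ys"
    have "(\<lambda>x. f (?zs[length xs := x])) \<in> lin_maps R (replicate n A ! length xs) N"
    proof (rule L[unfolded multilinear_def, rule_format])
      fix j assume j: "j < length (replicate n A)" "j \<noteq> length xs"
      then have "?zs ! j \<in> set xs \<union> set ys"
        using len by (auto simp: nth_append nth_Cons split: nat.splits)
      then show "?zs ! j \<in> carrier (replicate n A ! j)" using xs ys j by auto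
    qed (use len in auto)
    then show "(\<lambda>x. f (xs @ x # ys)) \<in> lin_maps R A N" using len by simp
  qed
next
  assume R: ?R
  show ?L unfolding multilinear_def
  proof (intro allI impI)
    fix xs :: "'c list" and i
    assume a: "length xs = length (replicate n A)" "i < length (replicate n A)"
      "\<forall>j<length (replicate n A). j \<noteq> i \<longrightarrow> xs ! j \<in> carrier (replicate n A ! j)"
    have "(\<lambda>x. f (take i xs @ x # drop (Suc i) xs)) \<in> lin_maps R A N"
    proof (rule R[rule_format])
      show "set (take i xs) \<subseteq> carrier A"
        using a by (auto simp: in_set_conv_nth)
      show "set (drop (Suc i) xs) \<subseteq> carrier A"
        using a by (auto simp: in_set_conv_nth)
    qed (use a in auto)
    then show "(\<lambda>x. f (xs[i := x])) \<in> lin_maps R (replicate n A ! i) N"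
      using a by (simp add: upd_conv_take_nth_drop)
  qed
qed


section \<open>Additive spans\<close>

text \<open>Sums only, with neither negatives nor scalars: \<open>monomials\<close>,
  \<open>products\<close> and \<open>tensors\<close> absorb a scalar into the operation, so for them
  this is already the submodule generated. Adding one summand at a time gives a simple induction
  rule.\<close>

inductive_set aspan :: "('a, 'm) ring_scheme \<Rightarrow> 'a set \<Rightarrow> 'a set"
  for A :: "('a, 'm) ring_scheme" and S :: "'a set" where
  aspan_zero: "\<zero>\<^bsub>A\<^esub> \<in> aspan A S"
| aspan_step: "\<lbrakk>x \<in> S; y \<in> aspan A S\<rbrakk> \<Longrightarrow> x \<oplus>\<^bsub>A\<^esub> y \<in> aspan A S"

context abelian_group
begin

lemma aspan_closed: "x \<in> aspan G S \<Longrightarrow> S \<subseteq> carrier G \<Longrightarrow> x \<in> carrier G"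
  by (induction rule: aspan.induct) auto

lemma aspan_base: "x \<in> S \<Longrightarrow> S \<subseteq> carrier G \<Longrightarrow> x \<in> aspan G S"
  using aspan_step[OF _ aspan_zero, of x S G] r_zero by (metis subsetD)

lemma aspan_add:
  assumes "S \<subseteq> carrier G" "x \<in> aspan G S" "y \<in> aspan G S"
  shows "x \<oplus> y \<in> aspan G S"
  using assms(2)
proof induction
  case aspan_zero
  then show ?case using assms aspan_closed by simp
next
  case (aspan_step x z)
  then have "x \<in> carrier G" "z \<in> carrier G" "y \<in> carrier G" using assms aspan_closed by auto
  then show ?case using aspan.aspan_step[OF aspan_step(1,3)] by (simp add: a_assoc)
qed

end

lemma (in abelian_group) aspan_aspan:
  assumes "S \<subseteq> carrier G" "x \<in> aspan G (aspan G S)"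
  shows "x \<in> aspan G S"
  using assms(2) by induction (auto intro: aspan_zero aspan_add[OF assms(1)])

lemma aspan_map:
  assumes f: "f \<in> lin_maps R M N" and M: "abelian_group M" and N: "abelian_group N"
    and sub: "S \<subseteq> carrier M" and im: "f ` S \<subseteq> T" and x: "x \<in> aspan M S"
  shows "f x \<in> aspan N T"
  using x
proof induction
  case aspan_zero
  then show ?case using lin_maps_zero[OF f M N] aspan.aspan_zero by metis
next
  case (aspan_step x z)
  then have "x \<in> carrier M" "z \<in> carrier M" using sub abelian_group.aspan_closed[OF M] by auto
  then have "f (x \<oplus>\<^bsub>M\<^esub> z) = f x \<oplus>\<^bsub>N\<^esub> f z" using lin_mapsD(2)[OF f] by blast
  then show ?case using aspan.aspan_step[of "f x" T "f z" N] aspan_step im by auto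
qed

lemma lin_maps_eq_on_aspan:
  assumes f: "f \<in> lin_maps R M N" and g: "g \<in> lin_maps R M N"
    and M: "abelian_group M" and N: "abelian_group N"
    and sub: "S \<subseteq> carrier M" and eq: "\<And>x. x \<in> S \<Longrightarrow> f x = g x" and x: "x \<in> aspan M S"
  shows "f x = g x"
  using x
proof induction
  case aspan_zero
  then show ?case using lin_maps_zero[OF f M N] lin_maps_zero[OF g M N] by metis
next
  case (aspan_step x z)
  then have "x \<in> carrier M" "z \<in> carrier M" using sub abelian_group.aspan_closed[OF M] by auto
  then show ?case using lin_mapsD(2)[OF f] lin_mapsD(2)[OF g] aspan_step eq by simp
qed

lemma (in module) aspan_smult:
  assumes "S \<subseteq> carrier M" "\<And>r x. \<lbrakk>r \<in> carrier R; x \<in> S\<rbrakk> \<Longrightarrow> r \<odot>\<^bsub>M\<^esub> x \<in> S"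
    and "r \<in> carrier R" "x \<in> aspan M S"
  shows "r \<odot>\<^bsub>M\<^esub> x \<in> aspan M S"
  using assms(4)
proof induction
  case aspan_zero
  then show ?case using assms aspan.aspan_zero by simp
next
  case (aspan_step x z)
  then have "x \<in> carrier M" "z \<in> carrier M" using assms M.aspan_closed by auto
  then show ?case using aspan.aspan_step[OF assms(2)[OF assms(3) aspan_step(1)] aspan_step(3)] assms(3)
    by (simp add: smult_r_distr)
qed


section \<open>Algebras and their morphisms\<close>

context operad
begin

lemma comp_closed:
  "\<lbrakk>arity_list ks; \<theta>s \<in> opseqs P ks; \<theta> \<in> carrier (ops P (length ks))\<rbrakk>
    \<Longrightarrow> opcomp P ks \<theta>s \<theta> \<in> carrier (ops P (sum_list ks))"
  using comp_linear lin_mapsD(1) by fastforce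

lemma perm_closed:
  "\<lbrakk>1 \<le> n; t permutes {..<n}; \<theta> \<in> carrier (ops P n)\<rbrakk> \<Longrightarrow> operm P n t \<theta> \<in> carrier (ops P n)"
  using perm_linear lin_mapsD(1) by fastforce

end

lemma palgebraI:
  assumes "operad R P" "module R A"
    and slot: "\<And>xs ys \<theta>. \<lbrakk>set xs \<subseteq> carrier A; set ys \<subseteq> carrier A; \<theta> \<in> carrier (ops P (Suc (length xs + length ys)))\<rbrakk>
      \<Longrightarrow> (\<lambda>x. mu A (xs @ x # ys) \<theta>) \<in> lin_maps R A A"
    and op_slot: "\<And>as. \<lbrakk>as \<noteq> []; set as \<subseteq> carrier A\<rbrakk> \<Longrightarrow> mu A as \<in> lin_maps R (ops P (length as)) A"
    and opid: "\<And>a. a \<in> carrier A \<Longrightarrow> mu A [a] (opid P) = a"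
    and comp: "\<And>ks \<theta>s \<theta> ass. \<lbrakk>arity_list ks; \<theta>s \<in> opseqs P ks; \<theta> \<in> carrier (ops P (length ks));
        map length ass = ks; \<forall>as\<in>set ass. set as \<subseteq> carrier A\<rbrakk>
      \<Longrightarrow> mu A (concat ass) (opcomp P ks \<theta>s \<theta>) = mu A (map2 (mu A) ass \<theta>s) \<theta>"
    and perm: "\<And>as t \<theta>. \<lbrakk>as \<noteq> []; set as \<subseteq> carrier A; t permutes {..<length as};
        \<theta> \<in> carrier (ops P (length as))\<rbrakk>
      \<Longrightarrow> mu A as (operm P (length as) t \<theta>) = mu A (permute_list t as) \<theta>"
  shows "palgebra R P A"
proof -
  interpret operad R P by fact
  interpret module R A by fact
  show ?thesis
    by unfold_locales (auto simp: multilinear_replicate opid comp perm intro!: slot op_slot)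
qed

section \<open>Multilinearity of the operations\<close>

context palgebra
begin

lemma module_A: "module R A" by (rule A.module_axioms)
lemma group_A: "abelian_group A" by (rule module.axioms(2)[OF module_A])

lemma mu_closed:
  "\<lbrakk>as \<noteq> []; set as \<subseteq> carrier A; \<theta> \<in> carrier (ops P (length as))\<rbrakk> \<Longrightarrow> mu A as \<theta> \<in> carrier A"
  using lin_mapsD(1)[OF mu_linear] by blast

lemma mu_lin_slot:
  assumes "set xs \<subseteq> carrier A" "set ys \<subseteq> carrier A" "\<theta> \<in> carrier (ops P (Suc (length xs + length ys)))"
  shows "(\<lambda>x. mu A (xs @ x # ys) \<theta>) \<in> lin_maps R A A"
  using mu_multilinear[OF _ assms(3)] assms unfolding multilinear_replicate by auto

lemma mu_add:
  "\<lbrakk>set xs \<subseteq> carrier A; set ys \<subseteq> carrier A; x \<in> carrier A; y \<in> carrier A;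
     \<theta> \<in> carrier (ops P (Suc (length xs + length ys)))\<rbrakk>
   \<Longrightarrow> mu A (xs @ (x \<oplus>\<^bsub>A\<^esub> y) # ys) \<theta> = mu A (xs @ x # ys) \<theta> \<oplus>\<^bsub>A\<^esub> mu A (xs @ y # ys) \<theta>"
  using lin_mapsD(2)[OF mu_lin_slot] by blast

lemma mu_smult:
  "\<lbrakk>set xs \<subseteq> carrier A; set ys \<subseteq> carrier A; x \<in> carrier A; r \<in> carrier R;
     \<theta> \<in> carrier (ops P (Suc (length xs + length ys)))\<rbrakk>
   \<Longrightarrow> mu A (xs @ (r \<odot>\<^bsub>A\<^esub> x) # ys) \<theta> = r \<odot>\<^bsub>A\<^esub> mu A (xs @ x # ys) \<theta>"
  using lin_mapsD(3)[OF mu_lin_slot] by blast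

lemma mu_zero:
  assumes "\<zero>\<^bsub>A\<^esub> \<in> set as" "set as \<subseteq> carrier A" "\<theta> \<in> carrier (ops P (length as))"
  shows "mu A as \<theta> = \<zero>\<^bsub>A\<^esub>"
proof -
  obtain xs ys where as: "as = xs @ \<zero>\<^bsub>A\<^esub> # ys" using assms(1) by (meson split_list)
  then show ?thesis using lin_maps_zero[OF mu_lin_slot group_A group_A, of xs ys \<theta>] assms by auto
qed

lemma mu_add_op:
  "\<lbrakk>as \<noteq> []; set as \<subseteq> carrier A; \<theta> \<in> carrier (ops P (length as)); \<theta>' \<in> carrier (ops P (length as))\<rbrakk>
   \<Longrightarrow> mu A as (\<theta> \<oplus>\<^bsub>ops P (length as)\<^esub> \<theta>') = mu A as \<theta> \<oplus>\<^bsub>A\<^esub> mu A as \<theta>'"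
  using lin_mapsD(2)[OF mu_linear] by blast

lemma mu_smult_op:
  "\<lbrakk>as \<noteq> []; set as \<subseteq> carrier A; \<theta> \<in> carrier (ops P (length as)); r \<in> carrier R\<rbrakk>
   \<Longrightarrow> mu A as (r \<odot>\<^bsub>ops P (length as)\<^esub> \<theta>) = r \<odot>\<^bsub>A\<^esub> mu A as \<theta>"
  using lin_mapsD(3)[OF mu_linear] by blast

text \<open>Multilinearity as an induction rule: expanding every argument into a sum of generators
  makes the value a sum of values at lists of generators, so a predicate stable under sums need only
  be checked there.\<close>

lemma mu_aspan_induct:
  assumes S: "S \<subseteq> carrier A" and zs: "set zs \<subseteq> aspan A S" "zs \<noteq> []" and th: "\<theta> \<in> carrier (ops P (length zs))"
    and zero: "Q \<zero>\<^bsub>A\<^esub>"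
    and plus: "\<And>x y. \<lbrakk>x \<in> carrier A; y \<in> carrier A; Q x; Q y\<rbrakk> \<Longrightarrow> Q (x \<oplus>\<^bsub>A\<^esub> y)"
    and gen: "\<And>ys. \<lbrakk>set ys \<subseteq> S; length ys = length zs\<rbrakk> \<Longrightarrow> Q (mu A ys \<theta>)"
  shows "Q (mu A zs \<theta>)"
proof -
  \<comment> \<open>The arguments are expanded from left to right: \<open>xs\<close> holds those
    already replaced by generators, \<open>us\<close> those still in the span.\<close>
  have *: "Q (mu A (xs @ us) \<theta>)"
    if "set xs \<subseteq> S" "set us \<subseteq> aspan A S" "length xs + length us = length zs" for xs us
    using that
  proof (induction us arbitrary: xs)
    case Nil
    then show ?case using gen by simp
  next
    case (Cons u us)
    have cus: "set us \<subseteq> carrier A" and cxs: "set xs \<subseteq> carrier A"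
      using Cons.prems S M.aspan_closed by auto
    have th': "\<theta> \<in> carrier (ops P (Suc (length xs + length us)))" using th Cons.prems by simp
    have "u \<in> aspan A S" using Cons.prems by simp
    then show ?case
    proof induction
      case aspan_zero
      have "mu A (xs @ \<zero>\<^bsub>A\<^esub> # us) \<theta> = \<zero>\<^bsub>A\<^esub>"
        by (rule mu_zero) (use cus cxs th' in auto)
      then show ?case using zero by simp
    next
      case (aspan_step x y)
      have c: "x \<in> carrier A" "y \<in> carrier A" using aspan_step S M.aspan_closed by auto
      have "Q (mu A ((xs @ [x]) @ us) \<theta>)"
        by (rule Cons.IH) (use Cons.prems aspan_step in auto)
      then show ?case
        using aspan_step mu_add[OF cxs cus c th'] plus mu_closed[of "xs @ x # us" \<theta>] mu_closed[of "xs @ y # us" \<theta>]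
          cus cxs th' c by auto
    qed
  qed
  show ?thesis using *[of "[]" zs] zs by simp
qed

end

section \<open>Morphisms\<close>

lemma palg_homI:
  assumes "f \<in> lin_maps R A B"
    and "\<And>as \<theta>. \<lbrakk>as \<noteq> []; set as \<subseteq> carrier A; \<theta> \<in> carrier (ops P (length as))\<rbrakk>
      \<Longrightarrow> f (mu A as \<theta>) = mu B (map f as) \<theta>"
  shows "f \<in> palg_hom R P A B"
  using assms unfolding palg_hom_def by auto

lemma palg_hom_lin: "f \<in> palg_hom R P A B \<Longrightarrow> f \<in> lin_maps R A B"
  unfolding palg_hom_def by auto

lemma palg_homD:
  assumes "f \<in> palg_hom R P A B"
  shows "x \<in> carrier A \<Longrightarrow> f x \<in> carrier B"
    and "\<lbrakk>x \<in> carrier A; y \<in> carrier A\<rbrakk> \<Longrightarrow> f (x \<oplus>\<^bsub>A\<^esub> y) = f x \<oplus>\<^bsub>B\<^esub> f y"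
    and "\<lbrakk>r \<in> carrier R; x \<in> carrier A\<rbrakk> \<Longrightarrow> f (r \<odot>\<^bsub>A\<^esub> x) = r \<odot>\<^bsub>B\<^esub> f x"
    and "\<lbrakk>as \<noteq> []; set as \<subseteq> carrier A; \<theta> \<in> carrier (ops P (length as))\<rbrakk>
      \<Longrightarrow> f (mu A as \<theta>) = mu B (map f as) \<theta>"
  using assms lin_mapsD[of f R A B] unfolding palg_hom_def by auto

lemma palg_hom_zero:
  "\<lbrakk>f \<in> palg_hom R P A B; palgebra R P A; palgebra R P B\<rbrakk> \<Longrightarrow> f \<zero>\<^bsub>A\<^esub> = \<zero>\<^bsub>B\<^esub>"
  by (metis lin_maps_zero palg_hom_lin palgebra.group_A)

lemma palg_hom_comp:
  assumes "f \<in> palg_hom R P A B" "g \<in> palg_hom R P B C"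
  shows "(\<lambda>x. g (f x)) \<in> palg_hom R P A C"
proof (rule palg_homI)
  fix as \<theta> assume a: "as \<noteq> []" "set as \<subseteq> carrier A" "\<theta> \<in> carrier (ops P (length as))"
  have "set (map f as) \<subseteq> carrier B" using a palg_homD(1)[OF assms(1)] by auto
  then show "g (f (mu A as \<theta>)) = mu C (map (\<lambda>x. g (f x)) as) \<theta>"
    using a palg_homD(4)[OF assms(1) a] palg_homD(4)[OF assms(2), of "map f as" \<theta>]
    by (simp add: comp_def)
qed (rule lin_maps_comp[OF assms[THEN palg_hom_lin]])

lemma palg_hom_id: "id \<in> palg_hom R P A A"
  by (rule palg_homI) (use lin_maps_id in \<open>auto simp: id_def\<close>)

lemma zero_map_apply: "zero_map D x = \<zero>\<^bsub>D\<^esub>"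
  unfolding zero_map_def ..

lemma zero_map_hom:
  fixes A :: "('r, 'p, 'a) palg"
  assumes "palgebra R P D"
  shows "zero_map D \<in> palg_hom R P (A :: ('r, 'p, 'a) palg) D"
proof -
  interpret palgebra R P D by fact
  show ?thesis
  proof (rule palg_homI)
    show "zero_map D \<in> lin_maps R A D"
      unfolding zero_map_def by (rule lin_maps_const_zero[OF module_A])
    fix as :: "'a list" and \<theta> assume "as \<noteq> []" "\<theta> \<in> carrier (ops P (length as))"
    then show "zero_map D (mu A as \<theta>) = mu D (map (zero_map D) as) \<theta>"
      unfolding zero_map_def by (cases as) (auto intro!: mu_zero[symmetric])
  qed
qed

section \<open>Transport of the algebra laws along surjections\<close>

lemma subset_image_list: "set bs \<subseteq> f ` C \<Longrightarrow> \<exists>as. bs = map f as \<and> set as \<subseteq> C"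
  by (intro exI[of _ "map (inv_into C f) bs"])
    (auto simp: comp_def f_inv_into_f subset_iff intro!: map_idI[symmetric] inv_into_into)

text \<open>\<open>A\<close> is not assumed to satisfy any laws: below it is an algebra or the set of terms.\<close>

lemma palgebra_quotient:
  assumes op: "operad R P" and car: "carrier Q = \<pi> ` carrier A"
    and closed: "\<zero>\<^bsub>A\<^esub> \<in> carrier A"
      "\<And>x y. \<lbrakk>x \<in> carrier A; y \<in> carrier A\<rbrakk> \<Longrightarrow> x \<oplus>\<^bsub>A\<^esub> y \<in> carrier A"
      "\<And>r x. \<lbrakk>r \<in> carrier R; x \<in> carrier A\<rbrakk> \<Longrightarrow> r \<odot>\<^bsub>A\<^esub> x \<in> carrier A"
      "\<And>as \<theta>. \<lbrakk>as \<noteq> []; set as \<subseteq> carrier A; \<theta> \<in> carrier (ops P (length as))\<rbrakk> \<Longrightarrow> mu A as \<theta> \<in> carrier A"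
    and add: "\<And>x y. \<lbrakk>x \<in> carrier A; y \<in> carrier A\<rbrakk> \<Longrightarrow> \<pi> x \<oplus>\<^bsub>Q\<^esub> \<pi> y = \<pi> (x \<oplus>\<^bsub>A\<^esub> y)"
    and zero: "\<zero>\<^bsub>Q\<^esub> = \<pi> \<zero>\<^bsub>A\<^esub>"
    and smult: "\<And>r x. \<lbrakk>r \<in> carrier R; x \<in> carrier A\<rbrakk> \<Longrightarrow> r \<odot>\<^bsub>Q\<^esub> \<pi> x = \<pi> (r \<odot>\<^bsub>A\<^esub> x)"
    and mu: "\<And>as \<theta>. \<lbrakk>as \<noteq> []; set as \<subseteq> carrier A; \<theta> \<in> carrier (ops P (length as))\<rbrakk>
      \<Longrightarrow> mu Q (map \<pi> as) \<theta> = \<pi> (mu A as \<theta>)"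
    and group: "\<And>x y z. \<lbrakk>x \<in> carrier A; y \<in> carrier A; z \<in> carrier A\<rbrakk>
        \<Longrightarrow> \<pi> ((x \<oplus>\<^bsub>A\<^esub> y) \<oplus>\<^bsub>A\<^esub> z) = \<pi> (x \<oplus>\<^bsub>A\<^esub> (y \<oplus>\<^bsub>A\<^esub> z))"
      "\<And>x y. \<lbrakk>x \<in> carrier A; y \<in> carrier A\<rbrakk> \<Longrightarrow> \<pi> (x \<oplus>\<^bsub>A\<^esub> y) = \<pi> (y \<oplus>\<^bsub>A\<^esub> x)"
      "\<And>x. x \<in> carrier A \<Longrightarrow> \<pi> (\<zero>\<^bsub>A\<^esub> \<oplus>\<^bsub>A\<^esub> x) = \<pi> x"
      "\<And>x. x \<in> carrier A \<Longrightarrow> \<pi> ((\<ominus>\<^bsub>R\<^esub> \<one>\<^bsub>R\<^esub>) \<odot>\<^bsub>A\<^esub> x \<oplus>\<^bsub>A\<^esub> x) = \<pi> \<zero>\<^bsub>A\<^esub>"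
    and scalars: "\<And>r s x. \<lbrakk>r \<in> carrier R; s \<in> carrier R; x \<in> carrier A\<rbrakk>
        \<Longrightarrow> \<pi> ((r \<oplus>\<^bsub>R\<^esub> s) \<odot>\<^bsub>A\<^esub> x) = \<pi> (r \<odot>\<^bsub>A\<^esub> x \<oplus>\<^bsub>A\<^esub> s \<odot>\<^bsub>A\<^esub> x)"
      "\<And>r x y. \<lbrakk>r \<in> carrier R; x \<in> carrier A; y \<in> carrier A\<rbrakk>
        \<Longrightarrow> \<pi> (r \<odot>\<^bsub>A\<^esub> (x \<oplus>\<^bsub>A\<^esub> y)) = \<pi> (r \<odot>\<^bsub>A\<^esub> x \<oplus>\<^bsub>A\<^esub> r \<odot>\<^bsub>A\<^esub> y)"
      "\<And>r s x. \<lbrakk>r \<in> carrier R; s \<in> carrier R; x \<in> carrier A\<rbrakk>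
        \<Longrightarrow> \<pi> ((r \<otimes>\<^bsub>R\<^esub> s) \<odot>\<^bsub>A\<^esub> x) = \<pi> (r \<odot>\<^bsub>A\<^esub> (s \<odot>\<^bsub>A\<^esub> x))"
      "\<And>x. x \<in> carrier A \<Longrightarrow> \<pi> (\<one>\<^bsub>R\<^esub> \<odot>\<^bsub>A\<^esub> x) = \<pi> x"
    and slot: "\<And>xs x y ys \<theta>. \<lbrakk>set xs \<subseteq> carrier A; set ys \<subseteq> carrier A; x \<in> carrier A; y \<in> carrier A;
          \<theta> \<in> carrier (ops P (Suc (length xs + length ys)))\<rbrakk>
        \<Longrightarrow> \<pi> (mu A (xs @ (x \<oplus>\<^bsub>A\<^esub> y) # ys) \<theta>) = \<pi> (mu A (xs @ x # ys) \<theta> \<oplus>\<^bsub>A\<^esub> mu A (xs @ y # ys) \<theta>)"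
      "\<And>xs x r ys \<theta>. \<lbrakk>set xs \<subseteq> carrier A; set ys \<subseteq> carrier A; x \<in> carrier A; r \<in> carrier R;
          \<theta> \<in> carrier (ops P (Suc (length xs + length ys)))\<rbrakk>
        \<Longrightarrow> \<pi> (mu A (xs @ (r \<odot>\<^bsub>A\<^esub> x) # ys) \<theta>) = \<pi> (r \<odot>\<^bsub>A\<^esub> mu A (xs @ x # ys) \<theta>)"
    and op_slot: "\<And>as \<theta> \<theta>'. \<lbrakk>as \<noteq> []; set as \<subseteq> carrier A; \<theta> \<in> carrier (ops P (length as)); \<theta>' \<in> carrier (ops P (length as))\<rbrakk>
        \<Longrightarrow> \<pi> (mu A as (\<theta> \<oplus>\<^bsub>ops P (length as)\<^esub> \<theta>')) = \<pi> (mu A as \<theta> \<oplus>\<^bsub>A\<^esub> mu A as \<theta>')"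
      "\<And>as \<theta> r. \<lbrakk>as \<noteq> []; set as \<subseteq> carrier A; \<theta> \<in> carrier (ops P (length as)); r \<in> carrier R\<rbrakk>
        \<Longrightarrow> \<pi> (mu A as (r \<odot>\<^bsub>ops P (length as)\<^esub> \<theta>)) = \<pi> (r \<odot>\<^bsub>A\<^esub> mu A as \<theta>)"
    and opid: "\<And>a. a \<in> carrier A \<Longrightarrow> \<pi> (mu A [a] (opid P)) = \<pi> a"
    and comp: "\<And>ks \<theta>s \<theta> ass. \<lbrakk>arity_list ks; \<theta>s \<in> opseqs P ks; \<theta> \<in> carrier (ops P (length ks));
        map length ass = ks; \<forall>as\<in>set ass. set as \<subseteq> carrier A\<rbrakk>
      \<Longrightarrow> \<pi> (mu A (concat ass) (opcomp P ks \<theta>s \<theta>)) = \<pi> (mu A (map2 (mu A) ass \<theta>s) \<theta>)"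
    and perm: "\<And>as t \<theta>. \<lbrakk>as \<noteq> []; set as \<subseteq> carrier A; t permutes {..<length as};
        \<theta> \<in> carrier (ops P (length as))\<rbrakk>
      \<Longrightarrow> \<pi> (mu A as (operm P (length as) t \<theta>)) = \<pi> (mu A (permute_list t as) \<theta>)"
  shows "palgebra R P Q"
proof -
  interpret operad R P by fact
  \<comment> \<open>Any list of elements of Q is the image of a list from A, so every law for Q
    becomes a law stated under \<pi>.\<close>
  have lift: "\<exists>as. bs = map \<pi> as \<and> set as \<subseteq> carrier A" if "set bs \<subseteq> carrier Q" for bs
    using subset_image_list that unfolding car by blast
  have ag: "abelian_group Q"
  proof (rule abelian_groupI)
    fix x assume "x \<in> carrier Q"
    then obtain a where a: "a \<in> carrier A" "x = \<pi> a" using car by auto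
    then show "\<exists>y\<in>carrier Q. y \<oplus>\<^bsub>Q\<^esub> x = \<zero>\<^bsub>Q\<^esub>"
      using group(4)[OF a(1)] closed(3)[of "\<ominus>\<^bsub>R\<^esub> \<one>\<^bsub>R\<^esub>" a]
      by (intro bexI[of _ "\<pi> ((\<ominus>\<^bsub>R\<^esub> \<one>\<^bsub>R\<^esub>) \<odot>\<^bsub>A\<^esub> a)"]) (auto simp: car add zero)
  next
    fix x y assume "x \<in> carrier Q" "y \<in> carrier Q"
    then show "x \<oplus>\<^bsub>Q\<^esub> y = y \<oplus>\<^bsub>Q\<^esub> x" using group(2) by (auto simp: car add)
  qed (auto simp: car add zero closed group(1,3))
  have mod: "module R Q"
    by (rule moduleI) (use ag in \<open>auto simp: car add zero smult closed R.is_cring scalars\<close>)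
  show ?thesis
  proof (rule palgebraI[OF op mod])
    fix bs assume b: "bs \<noteq> []" "set bs \<subseteq> carrier Q"
    obtain as where as: "bs = map \<pi> as" "set as \<subseteq> carrier A" using lift[OF b(2)] by blast
    interpret O: module R "ops P (length bs)" using ops_module[of "length bs"] b by (cases bs) auto
    show "mu Q bs \<in> lin_maps R (ops P (length bs)) Q"
      by (rule lin_mapsI) (use as b mu[of as] closed(4)[of as] op_slot[of as] add smult car O.M.a_closed O.smult_closed in auto)
    show "mu Q bs (operm P (length bs) t \<theta>) = mu Q (permute_list t bs) \<theta>"
      if "t permutes {..<length bs}" "\<theta> \<in> carrier (ops P (length bs))" for t \<theta>
    proof -
      have tp: "t permutes {..<length as}" using as that by simp
      have l: "length bs \<ge> 1" using b(1) by (cases bs) auto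
      have "set (permute_list t as) \<subseteq> carrier A" "permute_list t as \<noteq> []"
        using as b set_permute_list[OF tp] by (auto simp: permute_list_def)
      then show ?thesis
        using mu[of as "operm P (length as) t \<theta>"] mu[of "permute_list t as" \<theta>] as b perm[of as t \<theta>]
          permute_list_map[OF tp, of \<pi>] perm_closed[OF l that] that tp by simp
    qed
  next
    fix xs ys \<theta> assume b: "set xs \<subseteq> carrier Q" "set ys \<subseteq> carrier Q"
      "\<theta> \<in> carrier (ops P (Suc (length xs + length ys)))"
    obtain as where as: "xs = map \<pi> as" "set as \<subseteq> carrier A" using lift[OF b(1)] by blast
    obtain cs where cs: "ys = map \<pi> cs" "set cs \<subseteq> carrier A" using lift[OF b(2)] by blast
    have m: "mu Q (map \<pi> as @ \<pi> d # map \<pi> cs) \<theta> = \<pi> (mu A (as @ d # cs) \<theta>)"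
      "mu A (as @ d # cs) \<theta> \<in> carrier A" if "d \<in> carrier A" for d
      using mu[of "as @ d # cs" \<theta>] closed(4)[of "as @ d # cs" \<theta>] as cs b that by simp_all
    show "(\<lambda>x. mu Q (xs @ x # ys) \<theta>) \<in> lin_maps R Q Q"
      by (rule lin_mapsI) (use as cs b in \<open>auto simp: car add smult closed m slot\<close>)
  next
    fix b assume "b \<in> carrier Q"
    then obtain a where "b = \<pi> a" "a \<in> carrier A" using car by auto
    then show "mu Q [b] (opid P) = b" using mu[of "[a]" "opid P"] opid opid_closed by simp
  next
    fix ks \<theta>s \<theta> bss
    assume b: "arity_list ks" "\<theta>s \<in> opseqs P ks" "\<theta> \<in> carrier (ops P (length ks))"
      "map length bss = ks" "\<forall>bs\<in>set bss. set bs \<subseteq> carrier Q"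
    have "\<forall>bs\<in>set bss. \<exists>as. bs = map \<pi> as \<and> set as \<subseteq> carrier A" using b(5) lift by blast
    then have "set bss \<subseteq> map \<pi> ` {as. set as \<subseteq> carrier A}" by blast
    then obtain ass where ass: "bss = map (map \<pi>) ass" "set ass \<subseteq> {as. set as \<subseteq> carrier A}"
      using subset_image_list by blast
    have len: "map length ass = ks" using b(4) ass(1) by (simp add: comp_def)
    have ne: "\<forall>as\<in>set ass. as \<noteq> []" "ass \<noteq> []" using b(1) len unfolding arity_list_def by auto
    have las: "length ass = length \<theta>s" "length ass = length ks"
      using b(2) len unfolding opseqs_def by (auto dest: list_all2_lengthD)
    have th: "as \<in> set ass \<and> as \<noteq> [] \<and> set as \<subseteq> carrier A \<and> \<eta> \<in> carrier (ops P (length as))"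
      if "(as, \<eta>) \<in> set (zip ass \<theta>s)" for as \<eta>
      using that set_zip_leftD[OF that] b(2) len ne ass(2) unfolding opseqs_def
      by (auto simp: list_all2_conv_all_nth set_zip)
    have "mu Q (concat bss) (opcomp P ks \<theta>s \<theta>) = \<pi> (mu A (concat ass) (opcomp P ks \<theta>s \<theta>))"
      using mu[of "concat ass" "opcomp P ks \<theta>s \<theta>"] ass ne comp_closed[OF b(1-3)] len
      by (auto simp: map_concat length_concat neq_Nil_conv)
    also have "\<dots> = \<pi> (mu A (map2 (mu A) ass \<theta>s) \<theta>)" using ass(2) by (intro comp[OF b(1-3) len]) auto
    also have "\<dots> = mu Q (map \<pi> (map2 (mu A) ass \<theta>s)) \<theta>"
    proof (rule mu[symmetric])
      show "set (map2 (mu A) ass \<theta>s) \<subseteq> carrier A" using th closed(4) by fastforce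
    qed (use ne las b(3) in auto)
    also have "map \<pi> (map2 (mu A) ass \<theta>s) = map (\<lambda>(as, \<eta>). mu Q (map \<pi> as) \<eta>) (zip ass \<theta>s)"
      unfolding map_map by (intro map_cong refl) (use th mu in \<open>simp split: prod.split, metis\<close>)
    also have "\<dots> = map2 (mu Q) bss \<theta>s"
      unfolding ass(1) by (simp add: zip_map1 comp_def case_prod_unfold)
    finally show "mu Q (concat bss) (opcomp P ks \<theta>s \<theta>) = mu Q (map2 (mu Q) bss \<theta>s) \<theta>" .
  qed
qed

lemma palgebra_image:
  assumes A: "palgebra R P A" and car: "carrier Q = \<pi> ` carrier A"
    and add: "\<And>x y. \<lbrakk>x \<in> carrier A; y \<in> carrier A\<rbrakk> \<Longrightarrow> \<pi> x \<oplus>\<^bsub>Q\<^esub> \<pi> y = \<pi> (x \<oplus>\<^bsub>A\<^esub> y)"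
    and zero: "\<zero>\<^bsub>Q\<^esub> = \<pi> \<zero>\<^bsub>A\<^esub>"
    and smult: "\<And>r x. \<lbrakk>r \<in> carrier R; x \<in> carrier A\<rbrakk> \<Longrightarrow> r \<odot>\<^bsub>Q\<^esub> \<pi> x = \<pi> (r \<odot>\<^bsub>A\<^esub> x)"
    and mu: "\<And>as \<theta>. \<lbrakk>as \<noteq> []; set as \<subseteq> carrier A; \<theta> \<in> carrier (ops P (length as))\<rbrakk>
      \<Longrightarrow> mu Q (map \<pi> as) \<theta> = \<pi> (mu A as \<theta>)"
  shows "palgebra R P Q" and "\<pi> \<in> palg_hom R P A Q"
proof -
  interpret palgebra R P A by fact
  show "palgebra R P Q"
    by (rule palgebra_quotient[OF operad_axioms car _ _ _ _ add zero smult mu])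
      (simp_all add: mu_closed M.a_ac A.smult_l_minus M.r_neg A.smult_l_distr A.smult_r_distr A.smult_assoc1
        mu_add mu_smult mu_add_op mu_smult_op mu_opid mu_comp mu_perm)
  show "\<pi> \<in> palg_hom R P A Q"
    by (rule palg_homI, rule lin_mapsI) (auto simp: car add smult mu)
qed

lemma palgebra_sub:
  assumes A: "palgebra R P A" and sub: "S \<subseteq> carrier A"
    and zero: "\<zero>\<^bsub>A\<^esub> \<in> S"
    and add: "\<And>x y. \<lbrakk>x \<in> S; y \<in> S\<rbrakk> \<Longrightarrow> x \<oplus>\<^bsub>A\<^esub> y \<in> S"
    and smult: "\<And>r x. \<lbrakk>r \<in> carrier R; x \<in> S\<rbrakk> \<Longrightarrow> r \<odot>\<^bsub>A\<^esub> x \<in> S"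
    and mu: "\<And>as \<theta>. \<lbrakk>as \<noteq> []; set as \<subseteq> S; \<theta> \<in> carrier (ops P (length as))\<rbrakk> \<Longrightarrow> mu A as \<theta> \<in> S"
  shows "palgebra R P (A\<lparr>carrier := S\<rparr>)"
proof -
  interpret palgebra R P A by fact
  have S: "x \<in> carrier A" if "x \<in> S" for x using that sub by auto
  \<comment> \<open>A subalgebra is treated as a quotient of itself by the identity map, so that
    each law is simply the law of A.\<close>
  show ?thesis
    by (rule palgebra_quotient[of R P _ "\<lambda>x. x" "A\<lparr>carrier := S\<rparr>"])
      (auto simp: operad_axioms zero add smult mu S subset_eq M.a_ac A.smult_l_minus M.r_neg A.smult_l_distr
        A.smult_r_distr A.smult_assoc1 intro!: mu_add mu_smult mu_add_op mu_smult_op mu_opid mu_comp mu_perm)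
qed

section \<open>Generators and monomials\<close>

inductive_set generated :: "('r, 'm) ring_scheme \<Rightarrow> ('r, 'p) operad \<Rightarrow> ('r, 'p, 'a) palg \<Rightarrow> 'a set \<Rightarrow> 'a set"
  for R :: "('r, 'm) ring_scheme" and P :: "('r, 'p) operad" and A :: "('r, 'p, 'a) palg" and G :: "'a set" where
  generated_base: "x \<in> G \<Longrightarrow> x \<in> generated R P A G"
| generated_zero: "\<zero>\<^bsub>A\<^esub> \<in> generated R P A G"
| generated_add: "\<lbrakk>x \<in> generated R P A G; y \<in> generated R P A G\<rbrakk> \<Longrightarrow> x \<oplus>\<^bsub>A\<^esub> y \<in> generated R P A G"
| generated_smult: "\<lbrakk>r \<in> carrier R; x \<in> generated R P A G\<rbrakk> \<Longrightarrow> r \<odot>\<^bsub>A\<^esub> x \<in> generated R P A G"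
| generated_mu: "\<lbrakk>xs \<noteq> []; \<forall>x\<in>set xs. x \<in> generated R P A G; \<theta> \<in> carrier (ops P (length xs))\<rbrakk>
    \<Longrightarrow> mu A xs \<theta> \<in> generated R P A G"

definition monomials :: "('r, 'p) operad \<Rightarrow> ('r, 'p, 'a) palg \<Rightarrow> 'a set \<Rightarrow> 'a set"
  where "monomials P A G =
    {mu A xs \<theta> | xs \<theta>. xs \<noteq> [] \<and> set xs \<subseteq> G \<and> \<theta> \<in> carrier (ops P (length xs))}"

lemma generated_hom_image:
  assumes f: "f \<in> palg_hom R P A B" and A: "palgebra R P A" and B: "palgebra R P B"
    and sub: "G \<subseteq> carrier A" and im: "f ` G \<subseteq> generated R P B H" and x: "x \<in> generated R P A G"
  shows "f x \<in> generated R P B H"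
proof -
  interpret A: palgebra R P A by fact
  from x have "x \<in> carrier A \<and> f x \<in> generated R P B H"
  proof induction
    case generated_zero
    then show ?case using palg_hom_zero[OF f A B] generated.generated_zero by simp
  next
    case (generated_mu xs \<theta>)
    then have "set xs \<subseteq> carrier A" by auto
    then show ?case
      using generated_mu A.mu_closed[of xs \<theta>] palg_homD(4)[OF f, of xs \<theta>]
        generated.generated_mu[of "map f xs" R P B H \<theta>] by auto
  qed (use sub im palg_homD[OF f] generated.intros in auto)
  then show ?thesis ..
qed

context palgebra
begin

lemma monomials_closed: "G \<subseteq> carrier A \<Longrightarrow> monomials P A G \<subseteq> carrier A"
  unfolding monomials_def using mu_closed by auto

text \<open>A single use of the composition axiom; \<eta> is the composite of the operations
  \<open>H y\<close> into \<theta>. The expansions depend on the value of an argument and not on its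
  position, so that they are given by functions \<open>X\<close> and \<open>H\<close> mapped over
  the list; equal arguments are then expanded equally.\<close>

lemma mu_expand:
  assumes ys: "ys \<noteq> []" and th: "\<theta> \<in> carrier (ops P (length ys))"
    and X: "\<And>y. y \<in> set ys \<Longrightarrow> y = mu A (X y) (H y) \<and> X y \<noteq> [] \<and> set (X y) \<subseteq> carrier A \<and>
      H y \<in> carrier (ops P (length (X y)))"
  shows "\<exists>\<eta>\<in>carrier (ops P (length (concat (map X ys)))). mu A ys \<theta> = mu A (concat (map X ys)) \<eta>"
proof -
  define ass \<theta>s ks where d: "ass = map X ys" "\<theta>s = map H ys" "ks = map (\<lambda>y. length (X y)) ys"
  have ks: "arity_list ks" using X ys unfolding arity_list_def d by (auto simp: Suc_le_eq)
  have ths: "\<theta>s \<in> opseqs P ks"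
    unfolding opseqs_def d using X by (auto simp: list_all2_map1 list_all2_map2 list_all2_same)
  have thk: "\<theta> \<in> carrier (ops P (length ks))" using th d by simp
  have "map2 (mu A) ass \<theta>s = map (\<lambda>y. mu A (X y) (H y)) ys"
    unfolding d by (simp add: map2_map_map)
  also have "\<dots> = ys" using X by (intro map_idI) metis
  finally have "mu A ys \<theta> = mu A (concat ass) (opcomp P ks \<theta>s \<theta>)"
    using mu_comp[OF ks ths thk, of ass] X unfolding d by (simp add: comp_def subset_iff)
  moreover have "opcomp P ks \<theta>s \<theta> \<in> carrier (ops P (length (concat ass)))"
    using comp_closed[OF ks ths thk] by (simp add: d length_concat comp_def)
  ultimately show ?thesis unfolding d by blast
qed

lemma mu_monomials:
  assumes G: "G \<subseteq> carrier A" and ys: "set ys \<subseteq> monomials P A G" "ys \<noteq> []"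
    and th: "\<theta> \<in> carrier (ops P (length ys))"
  shows "mu A ys \<theta> \<in> monomials P A G"
proof -
  have "\<forall>y\<in>set ys. \<exists>xs \<eta>. y = mu A xs \<eta> \<and> xs \<noteq> [] \<and> set xs \<subseteq> G \<and> \<eta> \<in> carrier (ops P (length xs))"
    using ys unfolding monomials_def by auto
  then obtain X H where XH: "\<And>y. y \<in> set ys \<Longrightarrow> y = mu A (X y) (H y) \<and> X y \<noteq> [] \<and> set (X y) \<subseteq> G \<and>
      H y \<in> carrier (ops P (length (X y)))"
    by metis
  obtain \<eta> where "\<eta> \<in> carrier (ops P (length (concat (map X ys))))" "mu A ys \<theta> = mu A (concat (map X ys)) \<eta>"
    using mu_expand[OF ys(2) th, of X H] XH G by (meson subset_trans)
  moreover have "set (concat (map X ys)) \<subseteq> G" using XH by fastforce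
  moreover have "concat (map X ys) \<noteq> []" using XH ys(2) by (cases ys) auto
  ultimately show ?thesis unfolding monomials_def by blast
qed

text \<open>A generator is a monomial through the identity operation. The span is stable under
  operations since multilinearity reduces to monomial arguments, and an operation applied to
  monomials flattens to a monomial.\<close>

lemma generated_aspan_monomials:
  assumes G: "G \<subseteq> carrier A" and x: "x \<in> generated R P A G"
  shows "x \<in> aspan A (monomials P A G)"
  using x
proof induction
  case (generated_base x)
  have "x = mu A [x] (opid P)" using mu_opid generated_base G by auto
  then have "x \<in> monomials P A G"
    unfolding monomials_def using generated_base opid_closed by fastforce
  then show ?case using M.aspan_base monomials_closed[OF G] by blast
next
  case generated_zero
  then show ?case by (rule aspan_zero)
next
  case (generated_add x y)
  then show ?case using M.aspan_add monomials_closed[OF G] by blast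
next
  case (generated_smult r x)
  show ?case
  proof (rule A.aspan_smult[OF monomials_closed[OF G] _ generated_smult(1,3)])
    fix r x assume r: "r \<in> carrier R" and "x \<in> monomials P A G"
    then obtain xs \<theta> where xs: "x = mu A xs \<theta>" "xs \<noteq> []" "set xs \<subseteq> G" "\<theta> \<in> carrier (ops P (length xs))"
      unfolding monomials_def by blast
    interpret O: module R "ops P (length xs)" using ops_module[of "length xs"] xs(2) by (cases xs) auto
    \<comment> \<open>The scalar moves into the operation, so the set of monomials is itself stable
      under scalars.\<close>
    have "r \<odot>\<^bsub>A\<^esub> x = mu A xs (r \<odot>\<^bsub>ops P (length xs)\<^esub> \<theta>)"
      using mu_smult_op[of xs \<theta> r] xs r G by auto
    then show "r \<odot>\<^bsub>A\<^esub> x \<in> monomials P A G"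
      unfolding monomials_def using xs r O.smult_closed[of r \<theta>] by blast
  qed
next
  case (generated_mu xs \<theta>)
  show ?case
  proof (rule mu_aspan_induct[OF monomials_closed[OF G], of xs])
    fix ys assume "set ys \<subseteq> monomials P A G" "length ys = length xs"
    then show "mu A ys \<theta> \<in> aspan A (monomials P A G)"
      using M.aspan_base[OF mu_monomials[OF G, of ys \<theta>]] monomials_closed[OF G] generated_mu by force
  qed (use generated_mu M.aspan_add monomials_closed[OF G] in \<open>auto intro: aspan_zero\<close>)
qed

end


section \<open>Presented algebras and coproducts\<close>

lemma class_lift_eq:
  assumes "t \<in> C" "\<And>u. u \<in> C \<Longrightarrow> f u = f t"
  shows "class_lift f C = f t"
  unfolding class_lift_def by (rule the_elem_image_unique) (use assms(1) in blast, rule assms(2))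

text \<open>The class that \<open>presented\<close>, \<open>coprod_inl\<close> and
  \<open>coprod_inr\<close> write out in full; the name lets it serve as a quotient map.\<close>

definition pres_class ::
  "('r, 'm) ring_scheme \<Rightarrow> ('r, 'p) operad \<Rightarrow> 'x set
    \<Rightarrow> (('r, 'p, 'x) pterm \<times> ('r, 'p, 'x) pterm) set \<Rightarrow> ('r, 'p, 'x) pterm \<Rightarrow> ('r, 'p, 'x) pterm set"
  where "pres_class R P G E t = Collect (pres_eq R P G E t)"

lemma pres_class_eqI: "pres_eq R P G E s t \<Longrightarrow> pres_class R P G E s = pres_class R P G E t"
  unfolding pres_class_def by (auto intro: peq_sym peq_trans)

text \<open>The operations on classes collect the results over all representatives; the congruence
  rules of \<open>pres_eq\<close> make the result a single class, computed from any chosen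
  representatives.\<close>

lemma presented_simps:
  shows "carrier (presented R P G E) = pres_class R P G E ` pterms R P G"
    and "\<zero>\<^bsub>presented R P G E\<^esub> = pres_class R P G E Zero"
    and "\<lbrakk>s \<in> pterms R P G; t \<in> pterms R P G\<rbrakk> \<Longrightarrow>
      pres_class R P G E s \<oplus>\<^bsub>presented R P G E\<^esub> pres_class R P G E t = pres_class R P G E (Plus s t)"
    and "\<lbrakk>r \<in> carrier R; t \<in> pterms R P G\<rbrakk> \<Longrightarrow>
      r \<odot>\<^bsub>presented R P G E\<^esub> pres_class R P G E t = pres_class R P G E (Scal r t)"
    and "\<lbrakk>ts \<noteq> []; set ts \<subseteq> pterms R P G; \<theta> \<in> carrier (ops P (length ts))\<rbrakk> \<Longrightarrow>
      mu (presented R P G E) (map (pres_class R P G E) ts) \<theta> = pres_class R P G E (Op \<theta> ts)"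
proof -
  show "carrier (presented R P G E) = pres_class R P G E ` pterms R P G"
    "\<zero>\<^bsub>presented R P G E\<^esub> = pres_class R P G E Zero"
    by (simp_all add: presented_def pres_class_def[abs_def])
  show "pres_class R P G E s \<oplus>\<^bsub>presented R P G E\<^esub> pres_class R P G E t = pres_class R P G E (Plus s t)"
    if "s \<in> pterms R P G" "t \<in> pterms R P G"
    using that by (auto simp: presented_def pres_class_def intro: peq_refl peq_Plus_cong peq_trans)
  show "r \<odot>\<^bsub>presented R P G E\<^esub> pres_class R P G E t = pres_class R P G E (Scal r t)"
    if "r \<in> carrier R" "t \<in> pterms R P G"
    using that by (auto simp: presented_def pres_class_def intro: peq_refl peq_Scal_cong peq_trans)
  show "mu (presented R P G E) (map (pres_class R P G E) ts) \<theta> = pres_class R P G E (Op \<theta> ts)"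
    if ts: "ts \<noteq> []" "set ts \<subseteq> pterms R P G" "\<theta> \<in> carrier (ops P (length ts))"
  proof (intro equalityI subsetI)
    fix u assume "u \<in> mu (presented R P G E) (map (pres_class R P G E) ts) \<theta>"
    then obtain us where us: "list_all2 (\<in>) us (map (pres_class R P G E) ts)" "pres_eq R P G E (Op \<theta> us) u"
      by (auto simp: presented_def pres_class_def)
    then have "list_all2 (pres_eq R P G E) ts us"
      by (auto simp: list_all2_conv_all_nth pres_class_def)
    then show "u \<in> pres_class R P G E (Op \<theta> ts)"
      using us(2) peq_Op_cong[OF ts(1) _ ts(3)] peq_trans unfolding pres_class_def by blast
  next
    fix u assume "u \<in> pres_class R P G E (Op \<theta> ts)"
    moreover have "list_all2 (\<in>) ts (map (pres_class R P G E) ts)"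
      using ts(2) by (auto simp: list_all2_conv_all_nth pres_class_def intro!: peq_refl)
    ultimately show "u \<in> mu (presented R P G E) (map (pres_class R P G E) ts) \<theta>"
      by (auto simp: presented_def pres_class_def)
  qed
qed

lemma presented_palgebra:
  fixes R :: "('r, 'm) ring_scheme" and P :: "('r, 'p) operad" and G :: "'x set"
  assumes op: "operad R P"
  shows "palgebra R P (presented R P G E)"
proof -
  interpret operad R P by fact
  \<comment> \<open>The raw term algebra, which satisfies none of the laws. Each law holds after
    passing to classes because it is one of the rules of \<open>pres_eq\<close>.\<close>
  define T :: "('r, 'p, ('r, 'p, 'x) pterm) palg" where "T = \<lparr>carrier = pterms R P G, monoid.mult = (\<lambda>_ _. undefined), monoid.one = undefined,
    zero = Zero, add = Plus, smult = Scal, mu = (\<lambda>ts \<theta>. Op \<theta> ts)\<rparr>"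
  have T: "carrier T = pterms R P G" "\<zero>\<^bsub>T\<^esub> = Zero" "s \<oplus>\<^bsub>T\<^esub> t = Plus s t" "r \<odot>\<^bsub>T\<^esub> t = Scal r t"
    "mu T = (\<lambda>ts \<theta>. Op \<theta> ts)" for s t r
    by (simp_all add: T_def)
  \<comment> \<open>\<open>Op\<close> takes the operation first, \<open>mu\<close> takes the list
    first; the two forms of the composition law differ by this exchange.\<close>
  have m2: "map2 (\<lambda>ts \<theta>. Op \<theta> ts) tss \<theta>s = map2 Op \<theta>s tss" for \<theta>s and tss :: "('r, 'p, 'x) pterm list list"
    by (simp add: zip_commute[of tss] case_prod_unfold comp_def)
  show ?thesis
    by (rule palgebra_quotient[of R P _ "pres_class R P G E" T])
      (unfold T m2, simp_all only: presented_simps,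
       auto simp: op subset_iff intro: pterms.intros
         intro!: presented_simps(5) pres_class_eqI peq_Plus_assoc peq_Plus_comm peq_Plus_Zero peq_Plus_neg peq_Scal_add peq_Scal_Plus
           peq_Scal_mult peq_Scal_one peq_Op_Plus peq_Op_Scal peq_Op_add peq_Op_smult peq_Op_opid peq_Op_comp
           peq_Op_perm del: equalityI)
qed

lemma peval_closed:
  assumes "palgebra R P D" and g: "\<And>x. x \<in> G \<Longrightarrow> g x \<in> carrier D" and t: "t \<in> pterms R P G"
  shows "peval D g t \<in> carrier D"
proof -
  interpret palgebra R P D by fact
  show ?thesis
    using t by induction (auto simp: g intro!: mu_closed)
qed

text \<open>Soundness: apart from the given relations, every rule of \<open>pres_eq\<close> is a law
  valid in all algebras or a rule of congruence. Relations are checked between well-formed terms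
  only, as \<open>peq_rel\<close> uses only these.\<close>

lemma peval_pres_eq:
  assumes D: "palgebra R P D" and g: "\<And>x. x \<in> G \<Longrightarrow> g x \<in> carrier D"
    and E: "\<And>s t. \<lbrakk>(s, t) \<in> E; s \<in> pterms R P G; t \<in> pterms R P G\<rbrakk> \<Longrightarrow> peval D g s = peval D g t"
    and st: "pres_eq R P G E s t"
  shows "peval D g s = peval D g t"
proof -
  interpret palgebra R P D by fact
  note c = peval_closed[OF D g]
  show ?thesis
    using st
  proof induction
    case (peq_Op_cong ts ts' \<theta>)
    then have "map (peval D g) ts = map (peval D g) ts'"
      by (auto simp: list_all2_conv_all_nth intro!: nth_equalityI)
    then show ?case by simp
  next
    case (peq_Plus_neg t)
    then show ?case by (simp add: c A.smult_l_minus M.l_neg)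
  next
    case (peq_Op_Plus ts us s s' \<theta>)
    then have "set (map (peval D g) ts) \<subseteq> carrier D" "set (map (peval D g) us) \<subseteq> carrier D"
      by (auto intro!: c)
    then show ?case
      using mu_add[of "map (peval D g) ts" "map (peval D g) us" "peval D g s" "peval D g s'" \<theta>] peq_Op_Plus
      by (simp add: c)
  next
    case (peq_Op_Scal ts us s r \<theta>)
    then have "set (map (peval D g) ts) \<subseteq> carrier D" "set (map (peval D g) us) \<subseteq> carrier D"
      by (auto intro!: c)
    then show ?case
      using mu_smult[of "map (peval D g) ts" "map (peval D g) us" "peval D g s" r \<theta>] peq_Op_Scal
      by (simp add: c)
  next
    case (peq_Op_add ts \<theta> \<theta>')
    then have "set (map (peval D g) ts) \<subseteq> carrier D" by (auto intro!: c)
    then show ?case using mu_add_op[of "map (peval D g) ts" \<theta> \<theta>'] peq_Op_add by simp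
  next
    case (peq_Op_smult ts r \<theta>)
    then have "set (map (peval D g) ts) \<subseteq> carrier D" by (auto intro!: c)
    then show ?case using mu_smult_op[of "map (peval D g) ts" \<theta> r] peq_Op_smult by simp
  next
    case (peq_Op_comp ks \<theta>s \<theta> tss)
    have "mu D (concat (map (map (peval D g)) tss)) (opcomp P ks \<theta>s \<theta>)
        = mu D (map2 (mu D) (map (map (peval D g)) tss) \<theta>s) \<theta>"
      using peq_Op_comp by (intro mu_comp) (auto simp: comp_def intro!: c)
    moreover have "map (peval D g) (map2 Op \<theta>s tss) = map2 (mu D) (map (map (peval D g)) tss) \<theta>s"
      by (simp add: zip_map1 zip_commute[of tss] comp_def case_prod_unfold)
    ultimately show ?case by (simp add: map_concat)
  next
    case (peq_Op_perm ts p \<theta>)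
    then have "set (map (peval D g) ts) \<subseteq> carrier D" by (auto intro!: c)
    then show ?case
      using mu_perm[of "map (peval D g) ts" p \<theta>] peq_Op_perm by (simp add: permute_list_map)
  qed (auto simp: E c M.a_ac mu_opid A.smult_l_distr A.smult_r_distr A.smult_assoc1)
qed

text \<open>The existence half of the universal property of a presentation: evaluation of terms is
  constant on classes by soundness.\<close>

lemma presented_lift:
  assumes D: "palgebra R P D" and g: "\<And>x. x \<in> G \<Longrightarrow> g x \<in> carrier D"
    and E: "\<And>s t. \<lbrakk>(s, t) \<in> E; s \<in> pterms R P G; t \<in> pterms R P G\<rbrakk> \<Longrightarrow> peval D g s = peval D g t"
  shows "class_lift (peval D g) \<in> palg_hom R P (presented R P G E) D"
    and "x \<in> G \<Longrightarrow> class_lift (peval D g) (pres_class R P G E (Gen x)) = g x"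
proof -
  interpret palgebra R P D by fact
  let ?f = "class_lift (peval D g)" and ?c = "pres_class R P G E"
  have eq: "?f (?c t) = peval D g t" if "t \<in> pterms R P G" for t
    by (rule class_lift_eq) (use that peq_refl peval_pres_eq[OF D g E] in \<open>auto simp: pres_class_def\<close>)
  note tm = pterm_Zero pterm_Plus pterm_Scal
  show "?f \<in> palg_hom R P (presented R P G E) D"
  proof (rule palg_homI[OF lin_mapsI])
    fix Cs \<theta> assume a: "Cs \<noteq> []" "set Cs \<subseteq> carrier (presented R P G E)" "\<theta> \<in> carrier (ops P (length Cs))"
    have "set Cs \<subseteq> ?c ` pterms R P G" using a(2) by (simp add: presented_simps(1))
    then obtain ts where ts: "Cs = map ?c ts" "set ts \<subseteq> pterms R P G"
      using subset_image_list[of Cs ?c "pterms R P G"] by metis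
    have mp: "map (peval D g) ts = map ?f Cs" using ts eq by auto
    have "Op \<theta> ts \<in> pterms R P G" using a ts by (intro pterm_Op) auto
    then have "?f (mu (presented R P G E) Cs \<theta>) = mu D (map (peval D g) ts) \<theta>"
      using eq[of "Op \<theta> ts"] presented_simps(5)[of ts R P G \<theta> E] ts a by simp
    then show "?f (mu (presented R P G E) Cs \<theta>) = mu D (map ?f Cs) \<theta>" unfolding mp .
  qed (auto simp: presented_simps eq tm peval_closed[OF D g])
  show "?f (?c (Gen x)) = g x" if "x \<in> G"
    using eq[OF pterm_Gen[OF that]] by simp
qed

text \<open>Takes the place of the uniqueness half of the universal property: later arguments read
  off the contents of a coproduct from its generators.\<close>

lemma presented_generated:
  assumes "C \<in> carrier (presented R P G E)"
  shows "C \<in> generated R P (presented R P G E) ((\<lambda>x. pres_class R P G E (Gen x)) ` G)"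
proof -
  obtain t where t: "t \<in> pterms R P G" "C = pres_class R P G E t"
    using assms unfolding presented_simps by blast
  let ?g = "generated R P (presented R P G E) ((\<lambda>x. pres_class R P G E (Gen x)) ` G)"
  \<comment> \<open>Well-formedness is carried through the induction because the computation rules
    for classes ask for it.\<close>
  from t(1) have "t \<in> pterms R P G \<and> pres_class R P G E t \<in> ?g"
  proof induction
    case pterm_Zero
    then show ?case using generated_zero presented_simps(2) pterms.pterm_Zero by metis
  next
    case (pterm_Plus s t)
    then show ?case using generated_add presented_simps(3) pterms.pterm_Plus by metis
  next
    case (pterm_Scal r t)
    then show ?case using generated_smult presented_simps(4) pterms.pterm_Scal by metis
  next
    case (pterm_Op ts \<theta>)
    then have "mu (presented R P G E) (map (pres_class R P G E) ts) \<theta> \<in> ?g"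
      by (intro generated_mu) auto
    moreover have "set ts \<subseteq> pterms R P G" using pterm_Op by blast
    ultimately show ?case
      using pterm_Op presented_simps(5)[of ts R P G \<theta> E] pterms.pterm_Op[of ts R P G \<theta>] by auto
  qed (auto intro: pterms.intros generated_base)
  then show ?thesis using t(2) by simp
qed

section \<open>Coproducts and their universal property\<close>

lemma coprod_palgebra: "operad R P \<Longrightarrow> palgebra R P (coprod R P A B)"
  unfolding coprod_def by (rule presented_palgebra)

lemma hom_relsI:
  shows "\<lbrakk>a \<in> carrier A; a' \<in> carrier A\<rbrakk>
      \<Longrightarrow> (Gen (j (a \<oplus>\<^bsub>A\<^esub> a')), Plus (Gen (j a)) (Gen (j a'))) \<in> hom_rels R P A j"
    and "\<lbrakk>r \<in> carrier R; a \<in> carrier A\<rbrakk>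
      \<Longrightarrow> (Gen (j (r \<odot>\<^bsub>A\<^esub> a)), Scal r (Gen (j a))) \<in> hom_rels R P A j"
    and "\<lbrakk>as \<noteq> []; set as \<subseteq> carrier A; \<theta> \<in> carrier (ops P (length as))\<rbrakk>
      \<Longrightarrow> (Gen (j (mu A as \<theta>)), Op \<theta> (map (\<lambda>a. Gen (j a)) as)) \<in> hom_rels R P A j"
  unfolding hom_rels_def by auto

text \<open>The set \<open>E\<close> may contain further relations, so that the same statement
  serves both inclusions into a coproduct.\<close>

lemma hom_rels_hom:
  assumes A: "palgebra R P A" and sub: "hom_rels R P A j \<subseteq> E" and j: "\<And>a. a \<in> carrier A \<Longrightarrow> j a \<in> G"
  shows "(\<lambda>a. pres_class R P G E (Gen (j a))) \<in> palg_hom R P A (presented R P G E)"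
proof -
  interpret palgebra R P A by fact
  let ?c = "pres_class R P G E"
  have G: "Gen (j a) \<in> pterms R P G" if "a \<in> carrier A" for a by (rule pterm_Gen[OF j[OF that]])
  note pc = pres_class_eqI[OF peq_rel]
  show ?thesis
  proof (rule palg_homI[OF lin_mapsI])
    fix a b assume ab: "a \<in> carrier A" "b \<in> carrier A"
    then have "(Gen (j (a \<oplus>\<^bsub>A\<^esub> b)), Plus (Gen (j a)) (Gen (j b))) \<in> E"
      by (rule subsetD[OF sub hom_relsI(1)])
    then show "?c (Gen (j (a \<oplus>\<^bsub>A\<^esub> b))) = ?c (Gen (j a)) \<oplus>\<^bsub>presented R P G E\<^esub> ?c (Gen (j b))"
      using ab G by (simp add: presented_simps pterm_Plus pc)
  next
    fix r a assume ra: "r \<in> carrier R" "a \<in> carrier A"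
    then have "(Gen (j (r \<odot>\<^bsub>A\<^esub> a)), Scal r (Gen (j a))) \<in> E"
      by (rule subsetD[OF sub hom_relsI(2)])
    then show "?c (Gen (j (r \<odot>\<^bsub>A\<^esub> a))) = r \<odot>\<^bsub>presented R P G E\<^esub> ?c (Gen (j a))"
      using ra G by (simp add: presented_simps pterm_Scal pc)
  next
    fix as \<theta> assume a: "as \<noteq> []" "set as \<subseteq> carrier A" "\<theta> \<in> carrier (ops P (length as))"
    then have "(Gen (j (mu A as \<theta>)), Op \<theta> (map (\<lambda>a. Gen (j a)) as)) \<in> E"
      by (rule subsetD[OF sub hom_relsI(3)])
    moreover have "Op \<theta> (map (\<lambda>a. Gen (j a)) as) \<in> pterms R P G" using a G by (intro pterm_Op) auto
    ultimately have "?c (Gen (j (mu A as \<theta>))) = ?c (Op \<theta> (map (\<lambda>a. Gen (j a)) as))"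
      using a G mu_closed by (intro pc) auto
    also have "\<dots> = mu (presented R P G E) (map ?c (map (\<lambda>a. Gen (j a)) as)) \<theta>"
      using a G by (intro presented_simps(5)[symmetric]) auto
    finally show "?c (Gen (j (mu A as \<theta>))) = mu (presented R P G E) (map (\<lambda>a. ?c (Gen (j a))) as) \<theta>"
      by (simp add: comp_def)
  qed (use G in \<open>auto simp: presented_simps\<close>)
qed

lemma coprod_inl_hom:
  "palgebra R P A \<Longrightarrow> coprod_inl R P A B \<in> palg_hom R P A (coprod R P A B)"
  unfolding coprod_def coprod_inl_def[abs_def] pres_class_def[symmetric] by (rule hom_rels_hom) (auto simp: coprod_rels_def)

lemma coprod_inr_hom:
  "palgebra R P B \<Longrightarrow> coprod_inr R P A B \<in> palg_hom R P B (coprod R P A B)"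
  unfolding coprod_def coprod_inr_def[abs_def] pres_class_def[symmetric] by (rule hom_rels_hom) (auto simp: coprod_rels_def)

lemma coprod_generated:
  assumes "u \<in> carrier (coprod R P A B)"
  shows "u \<in> generated R P (coprod R P A B) (coprod_inl R P A B ` carrier A \<union> coprod_inr R P A B ` carrier B)"
proof -
  have "(\<lambda>x. pres_class R P (carrier A <+> carrier B) (coprod_rels R P A B) (Gen x)) ` (carrier A <+> carrier B)
      = coprod_inl R P A B ` carrier A \<union> coprod_inr R P A B ` carrier B"
    unfolding coprod_inl_def[abs_def] coprod_inr_def[abs_def] pres_class_def Plus_def image_Un image_image ..
  then show ?thesis
    using presented_generated[OF assms[unfolded coprod_def]] unfolding coprod_def by simp
qed

lemma hom_rels_eval:
  assumes "palgebra R P A" "f \<in> palg_hom R P A D" "(s, t) \<in> hom_rels R P A j" "\<And>a. g (j a) = f a"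
  shows "peval D g s = peval D g t"
  using assms(3) palg_homD[OF assms(2)] assms(4) unfolding hom_rels_def
  by (auto simp: comp_def)

lemma copair:
  assumes A: "palgebra R P A" and B: "palgebra R P B" and D: "palgebra R P D"
    and f: "f \<in> palg_hom R P A D" and g: "g \<in> palg_hom R P B D"
  shows copair_hom: "copair D f g \<in> palg_hom R P (coprod R P A B) D"
    and copair_inl: "a \<in> carrier A \<Longrightarrow> copair D f g (coprod_inl R P A B a) = f a"
    and copair_inr: "b \<in> carrier B \<Longrightarrow> copair D f g (coprod_inr R P A B b) = g b"
proof -
  let ?G = "carrier A <+> carrier B" and ?h = "case_sum f g"
  have G: "?h x \<in> carrier D" if "x \<in> ?G" for x
    using that palg_homD(1)[OF f] palg_homD(1)[OF g] by auto
  have E: "peval D ?h s = peval D ?h t" if "(s, t) \<in> coprod_rels R P A B" for s t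
    using that hom_rels_eval[OF A f, of s t Inl ?h] hom_rels_eval[OF B g, of s t Inr ?h]
    unfolding coprod_rels_def by auto
  note l = presented_lift[OF D, of ?G ?h, OF G E]
  show "copair D f g \<in> palg_hom R P (coprod R P A B) D"
    unfolding copair_def coprod_def by (rule l(1))
  show "a \<in> carrier A \<Longrightarrow> copair D f g (coprod_inl R P A B a) = f a"
    unfolding copair_def coprod_inl_def pres_class_def[symmetric] by (subst l(2)) auto
  show "b \<in> carrier B \<Longrightarrow> copair D f g (coprod_inr R P A B b) = g b"
    unfolding copair_def coprod_inr_def pres_class_def[symmetric] by (subst l(2)) auto
qed

section \<open>Quotients by ideals\<close>

text \<open>The closure properties of the kernel of a morphism. One entry in \<open>I\<close> forces
  the value of an operation into \<open>I\<close>, whatever the other entries are; negatives are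
  obtained by scaling with minus one.\<close>

definition palg_ideal :: "('r, 'm) ring_scheme \<Rightarrow> ('r, 'p) operad \<Rightarrow> ('r, 'p, 'a) palg \<Rightarrow> 'a set \<Rightarrow> bool"
  where "palg_ideal R P A I \<longleftrightarrow> I \<subseteq> carrier A \<and> \<zero>\<^bsub>A\<^esub> \<in> I \<and>
    (\<forall>x\<in>I. \<forall>y\<in>I. x \<oplus>\<^bsub>A\<^esub> y \<in> I) \<and> (\<forall>r\<in>carrier R. \<forall>x\<in>I. r \<odot>\<^bsub>A\<^esub> x \<in> I) \<and>
    (\<forall>xs x ys \<theta>. set xs \<subseteq> carrier A \<longrightarrow> set ys \<subseteq> carrier A \<longrightarrow> x \<in> I \<longrightarrow>
      \<theta> \<in> carrier (ops P (Suc (length xs + length ys))) \<longrightarrow> mu A (xs @ x # ys) \<theta> \<in> I)"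

context palgebra
begin

lemma neg_eq_smult: "x \<in> carrier A \<Longrightarrow> \<ominus>\<^bsub>A\<^esub> x = (\<ominus>\<^bsub>R\<^esub> \<one>\<^bsub>R\<^esub>) \<odot>\<^bsub>A\<^esub> x"
  by (simp add: A.smult_l_minus)

lemma ideal_subgroup:
  assumes "palg_ideal R P A I"
  shows "abelian_subgroup I A"
proof (rule abelian_subgroupI3[OF _ group_A], rule additive_subgroupI)
  have "\<ominus>\<^bsub>A\<^esub> x \<in> I" if "x \<in> I" for x
  proof -
    have "x \<in> carrier A" using that assms unfolding palg_ideal_def by auto
    then show ?thesis using neg_eq_smult[of x] that assms unfolding palg_ideal_def by simp
  qed
  then show "subgroup I (add_monoid A)"
    using assms unfolding palg_ideal_def by (auto intro!: subgroup.intro simp flip: a_inv_def)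
qed

lemma ideal_coset_eq_iff:
  assumes I: "palg_ideal R P A I" and "x \<in> carrier A" "y \<in> carrier A"
  shows "I +>\<^bsub>A\<^esub> x = I +>\<^bsub>A\<^esub> y \<longleftrightarrow> x \<ominus>\<^bsub>A\<^esub> y \<in> I"
proof -
  interpret S: abelian_subgroup I A by (rule ideal_subgroup[OF I])
  have "I +>\<^bsub>A\<^esub> x = I +>\<^bsub>A\<^esub> y \<longleftrightarrow> x \<in> I +>\<^bsub>A\<^esub> y"
    using S.a_rcos_self[OF assms(2)] S.a_repr_independence'[OF _ assms(3)] by metis
  then show ?thesis using S.a_rcos_module[OF assms(3,2)] by (simp add: a_minus_def)
qed

text \<open>The arguments are replaced one at a time, and \<open>zs\<close> collects those already
  replaced. By additivity, replacing x by y changes the value by the same operation with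
  \<open>x - y\<close> in that slot, and this lies in \<open>I\<close>.\<close>

lemma ideal_mu_cong:
  assumes I: "palg_ideal R P A I"
    and eq: "list_all2 (\<lambda>x y. x \<in> carrier A \<and> y \<in> carrier A \<and> I +>\<^bsub>A\<^esub> x = I +>\<^bsub>A\<^esub> y) xs ys"
    and "set zs \<subseteq> carrier A" "zs @ xs \<noteq> []" "\<theta> \<in> carrier (ops P (length zs + length xs))"
  shows "I +>\<^bsub>A\<^esub> mu A (zs @ xs) \<theta> = I +>\<^bsub>A\<^esub> mu A (zs @ ys) \<theta>"
  using eq assms(3-)
proof (induction arbitrary: zs)
  case (Cons x xs y ys)
  have c: "x \<in> carrier A" "y \<in> carrier A" "set xs \<subseteq> carrier A" "set ys \<subseteq> carrier A" "length xs = length ys"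
    using Cons(1,2) by (auto simp: list_all2_conv_all_nth in_set_conv_nth)
  have d: "x \<ominus>\<^bsub>A\<^esub> y \<in> I" using ideal_coset_eq_iff[OF I] Cons(1) by blast
  have dc: "x \<ominus>\<^bsub>A\<^esub> y \<in> carrier A" using c by simp
  have th: "\<theta> \<in> carrier (ops P (Suc (length zs + length xs)))" using Cons by simp
  have x: "x = y \<oplus>\<^bsub>A\<^esub> (x \<ominus>\<^bsub>A\<^esub> y)" using c by (simp add: a_minus_def M.a_lcomm M.r_neg)
  have m: "mu A (zs @ y # xs) \<theta> \<in> carrier A" "mu A (zs @ x # xs) \<theta> \<in> carrier A"
    "mu A (zs @ (x \<ominus>\<^bsub>A\<^esub> y) # xs) \<theta> \<in> carrier A"
    using c dc th Cons.prems by (auto intro!: mu_closed)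
  have "mu A (zs @ x # xs) \<theta> = mu A (zs @ y # xs) \<theta> \<oplus>\<^bsub>A\<^esub> mu A (zs @ (x \<ominus>\<^bsub>A\<^esub> y) # xs) \<theta>"
    using mu_add[of zs xs y "x \<ominus>\<^bsub>A\<^esub> y" \<theta>] x c dc th Cons.prems by metis
  then have "mu A (zs @ x # xs) \<theta> \<ominus>\<^bsub>A\<^esub> mu A (zs @ y # xs) \<theta> = mu A (zs @ (x \<ominus>\<^bsub>A\<^esub> y) # xs) \<theta>"
    using m by (simp add: a_minus_def M.a_ac M.r_neg1 M.r_neg2)
  also have "\<dots> \<in> I" using I d c th Cons.prems unfolding palg_ideal_def by blast
  finally have "I +>\<^bsub>A\<^esub> mu A (zs @ x # xs) \<theta> = I +>\<^bsub>A\<^esub> mu A (zs @ y # xs) \<theta>"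
    using ideal_coset_eq_iff[OF I m(2,1)] by blast
  then show ?case using Cons.IH[of "zs @ [y]"] Cons.prems c by simp
qed simp

text \<open>The unions in \<open>palg_quot\<close> run over representatives; they collapse because
  congruent arguments have congruent values, by \<open>ideal_mu_cong\<close> in the case of the
  operations.\<close>

lemma palg_quot_simps:
  assumes I: "palg_ideal R P A I"
  shows "carrier (palg_quot A I) = (\<lambda>x. I +>\<^bsub>A\<^esub> x) ` carrier A"
    and "\<lbrakk>x \<in> carrier A; y \<in> carrier A\<rbrakk> \<Longrightarrow>
      (I +>\<^bsub>A\<^esub> x) \<oplus>\<^bsub>palg_quot A I\<^esub> (I +>\<^bsub>A\<^esub> y) = I +>\<^bsub>A\<^esub> (x \<oplus>\<^bsub>A\<^esub> y)"
    and "\<zero>\<^bsub>palg_quot A I\<^esub> = I +>\<^bsub>A\<^esub> \<zero>\<^bsub>A\<^esub>"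
    and "\<lbrakk>r \<in> carrier R; x \<in> carrier A\<rbrakk> \<Longrightarrow> r \<odot>\<^bsub>palg_quot A I\<^esub> (I +>\<^bsub>A\<^esub> x) = I +>\<^bsub>A\<^esub> (r \<odot>\<^bsub>A\<^esub> x)"
    and "\<lbrakk>as \<noteq> []; set as \<subseteq> carrier A; \<theta> \<in> carrier (ops P (length as))\<rbrakk> \<Longrightarrow>
      mu (palg_quot A I) (map (\<lambda>x. I +>\<^bsub>A\<^esub> x) as) \<theta> = I +>\<^bsub>A\<^esub> mu A as \<theta>"
proof -
  interpret S: abelian_subgroup I A by (rule ideal_subgroup[OF I])
  have rep: "y \<in> carrier A \<and> I +>\<^bsub>A\<^esub> y = I +>\<^bsub>A\<^esub> x" if "x \<in> carrier A" "y \<in> I +>\<^bsub>A\<^esub> x" for x y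
    using that S.a_repr_independence'[OF that(2,1)] S.a_elemrcos_carrier[OF that] by metis
  show "carrier (palg_quot A I) = (\<lambda>x. I +>\<^bsub>A\<^esub> x) ` carrier A"
    by (auto simp: palg_quot_def A_RCOSETS_def')
  show "\<lbrakk>x \<in> carrier A; y \<in> carrier A\<rbrakk> \<Longrightarrow>
      (I +>\<^bsub>A\<^esub> x) \<oplus>\<^bsub>palg_quot A I\<^esub> (I +>\<^bsub>A\<^esub> y) = I +>\<^bsub>A\<^esub> (x \<oplus>\<^bsub>A\<^esub> y)"
    by (simp add: palg_quot_def S.a_rcos_sum)
  show "\<zero>\<^bsub>palg_quot A I\<^esub> = I +>\<^bsub>A\<^esub> \<zero>\<^bsub>A\<^esub>"
    using S.a_subset by (simp add: palg_quot_def)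
  show "r \<odot>\<^bsub>palg_quot A I\<^esub> (I +>\<^bsub>A\<^esub> x) = I +>\<^bsub>A\<^esub> (r \<odot>\<^bsub>A\<^esub> x)" if r: "r \<in> carrier R" and x: "x \<in> carrier A"
  proof -
    have "I +>\<^bsub>A\<^esub> (r \<odot>\<^bsub>A\<^esub> y) = I +>\<^bsub>A\<^esub> (r \<odot>\<^bsub>A\<^esub> x)" if "y \<in> I +>\<^bsub>A\<^esub> x" for y
    proof -
      have y: "y \<in> carrier A" "y \<ominus>\<^bsub>A\<^esub> x \<in> I" using rep[OF x that] ideal_coset_eq_iff[OF I _ x] by auto
      then have "r \<odot>\<^bsub>A\<^esub> (y \<ominus>\<^bsub>A\<^esub> x) \<in> I" using I r unfolding palg_ideal_def by auto
      then show ?thesis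
        using ideal_coset_eq_iff[OF I, of "r \<odot>\<^bsub>A\<^esub> y" "r \<odot>\<^bsub>A\<^esub> x"] x y r
        by (simp add: a_minus_def A.smult_r_distr A.smult_r_minus)
    qed
    then have "(\<Union>y\<in>I +>\<^bsub>A\<^esub> x. I +>\<^bsub>A\<^esub> (r \<odot>\<^bsub>A\<^esub> y)) = (\<Union>y\<in>I +>\<^bsub>A\<^esub> x. I +>\<^bsub>A\<^esub> (r \<odot>\<^bsub>A\<^esub> x))"
      by (intro SUP_cong refl)
    also have "\<dots> = I +>\<^bsub>A\<^esub> (r \<odot>\<^bsub>A\<^esub> x)" using S.a_rcos_self[OF x] by (intro UN_constant_eq) auto
    finally show ?thesis by (simp add: palg_quot_def)
  qed
  show "mu (palg_quot A I) (map (\<lambda>x. I +>\<^bsub>A\<^esub> x) as) \<theta> = I +>\<^bsub>A\<^esub> mu A as \<theta>"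
    if as: "as \<noteq> []" "set as \<subseteq> carrier A" "\<theta> \<in> carrier (ops P (length as))"
  proof -
    have "I +>\<^bsub>A\<^esub> mu A xs \<theta> = I +>\<^bsub>A\<^esub> mu A as \<theta>" if xs: "list_all2 (\<in>) xs (map (\<lambda>x. I +>\<^bsub>A\<^esub> x) as)" for xs
    proof -
      have "list_all2 (\<lambda>x y. x \<in> carrier A \<and> y \<in> carrier A \<and> I +>\<^bsub>A\<^esub> x = I +>\<^bsub>A\<^esub> y) xs as"
        unfolding list_all2_conv_all_nth
      proof (intro conjI allI impI)
        show "length xs = length as" using xs by (auto dest: list_all2_lengthD)
        fix i assume i: "i < length xs"
        then have il: "i < length as" using list_all2_lengthD[OF xs] by simp
        then have "as ! i \<in> carrier A" using as(2) by auto
        moreover have "xs ! i \<in> I +>\<^bsub>A\<^esub> (as ! i)" using list_all2_nthD[OF xs i] il by simp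
        ultimately show "xs ! i \<in> carrier A" "as ! i \<in> carrier A"
          "I +>\<^bsub>A\<^esub> (xs ! i) = I +>\<^bsub>A\<^esub> (as ! i)"
          using rep by blast+
      qed
      moreover have "length xs = length as" using xs by (auto dest: list_all2_lengthD)
      ultimately show ?thesis using ideal_mu_cong[OF I, of xs as "[]" \<theta>] as by auto
    qed
    moreover have "list_all2 (\<in>) as (map (\<lambda>x. I +>\<^bsub>A\<^esub> x) as)"
      using as(2) S.a_rcos_self by (simp add: list_all2_conv_all_nth subset_iff)
    ultimately have "{I +>\<^bsub>A\<^esub> mu A xs \<theta> |xs. list_all2 (\<in>) xs (map (\<lambda>x. I +>\<^bsub>A\<^esub> x) as)} = {I +>\<^bsub>A\<^esub> mu A as \<theta>}"
      by blast
    then show ?thesis unfolding palg_quot_def by simp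
  qed
qed

lemma palg_quot_palgebra:
  assumes I: "palg_ideal R P A I"
  shows "palgebra R P (palg_quot A I)" and "(\<lambda>x. I +>\<^bsub>A\<^esub> x) \<in> palg_hom R P A (palg_quot A I)"
  using palgebra_image[OF palgebra_axioms, of "palg_quot A I" "\<lambda>x. I +>\<^bsub>A\<^esub> x"] palg_quot_simps[OF I] by blast+

lemma palg_quot_lift:
  assumes I: "palg_ideal R P A I" and D: "palgebra R P D" and f: "f \<in> palg_hom R P A D"
    and ker: "\<And>x. x \<in> I \<Longrightarrow> f x = \<zero>\<^bsub>D\<^esub>"
  shows "class_lift f \<in> palg_hom R P (palg_quot A I) D"
    and "x \<in> carrier A \<Longrightarrow> class_lift f (I +>\<^bsub>A\<^esub> x) = f x"
proof -
  interpret S: abelian_subgroup I A by (rule ideal_subgroup[OF I])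
  interpret D: palgebra R P D by fact
  have val: "class_lift f (I +>\<^bsub>A\<^esub> x) = f x" if x: "x \<in> carrier A" for x
  proof (rule class_lift_eq[OF S.a_rcos_self[OF x]])
    fix y assume "y \<in> I +>\<^bsub>A\<^esub> x"
    then obtain i where i: "i \<in> I" "y = i \<oplus>\<^bsub>A\<^esub> x" unfolding a_r_coset_def' by auto
    then show "f y = f x"
      using ker x S.a_subset palg_homD(1,2)[OF f] by (simp add: D.M.l_zero subset_iff)
  qed
  show "x \<in> carrier A \<Longrightarrow> class_lift f (I +>\<^bsub>A\<^esub> x) = f x" by (rule val)
  show "class_lift f \<in> palg_hom R P (palg_quot A I) D"
  proof (rule palg_homI[OF lin_mapsI])
    fix Cs \<theta> assume a: "Cs \<noteq> []" "set Cs \<subseteq> carrier (palg_quot A I)" "\<theta> \<in> carrier (ops P (length Cs))"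
    then obtain as where as: "Cs = map (\<lambda>x. I +>\<^bsub>A\<^esub> x) as" "set as \<subseteq> carrier A"
      using subset_image_list[of Cs _ "carrier A"] unfolding palg_quot_simps[OF I] by metis
    have "map (class_lift f) Cs = map f as" using as val by auto
    then show "class_lift f (mu (palg_quot A I) Cs \<theta>) = mu D (map (class_lift f) Cs) \<theta>"
      using as a val[OF mu_closed[of as \<theta>]] palg_homD(4)[OF f, of as \<theta>] palg_quot_simps(5)[OF I, of as \<theta>]
      by (simp del: map_map map_eq_conv)
  qed (auto simp: palg_quot_simps[OF I] val palg_homD[OF f])
qed

end


section \<open>Decomposable elements and the triple commutator\<close>

definition products :: "('r, 'p) operad \<Rightarrow> ('r, 'p, 'a) palg \<Rightarrow> nat \<Rightarrow> 'a set"
  where "products P A k =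
    {mu A xs \<theta> | xs \<theta>. k \<le> length xs \<and> set xs \<subseteq> carrier A \<and> \<theta> \<in> carrier (ops P (length xs))}"

abbreviation decomposables :: "('r, 'p) operad \<Rightarrow> ('r, 'p, 'a) palg \<Rightarrow> nat \<Rightarrow> 'a set"
  where "decomposables P A k \<equiv> aspan A (products P A k)"

text \<open>For \<open>k = 3\<close> these are the two-nilpotent algebras, for \<open>k = 2\<close> the abelian ones.\<close>

definition products_vanish :: "('r, 'p) operad \<Rightarrow> ('r, 'p, 'a) palg \<Rightarrow> nat \<Rightarrow> bool"
  where "products_vanish P A k \<longleftrightarrow> products P A k \<subseteq> {\<zero>\<^bsub>A\<^esub>}"

lemma productsI:
  "\<lbrakk>k \<le> length xs; set xs \<subseteq> carrier A; \<theta> \<in> carrier (ops P (length xs))\<rbrakk> \<Longrightarrow> mu A xs \<theta> \<in> products P A k"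
  unfolding products_def by blast

lemma products_vanishD:
  "\<lbrakk>products_vanish P A k; k \<le> length xs; set xs \<subseteq> carrier A; \<theta> \<in> carrier (ops P (length xs))\<rbrakk>
    \<Longrightarrow> mu A xs \<theta> = \<zero>\<^bsub>A\<^esub>"
  unfolding products_vanish_def using productsI by fast

lemma products_vanishI:
  "(\<And>xs \<theta>. \<lbrakk>k \<le> length xs; set xs \<subseteq> carrier A; \<theta> \<in> carrier (ops P (length xs))\<rbrakk> \<Longrightarrow> mu A xs \<theta> = \<zero>\<^bsub>A\<^esub>)
    \<Longrightarrow> products_vanish P A k"
  unfolding products_vanish_def products_def by blast

context palgebra
begin

lemma products_closed: "1 \<le> k \<Longrightarrow> products P A k \<subseteq> carrier A"
  unfolding products_def by (auto intro!: mu_closed)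

text \<open>Composing \<theta> with the operation that produced \<open>z\<close> in one slot, and
  with the identity operation in the others, adds up the arities.\<close>

lemma mu_product_slot:
  assumes k: "1 \<le> k" and xs: "set xs \<subseteq> carrier A" "set ys \<subseteq> carrier A" and z: "z \<in> products P A k"
    and th: "\<theta> \<in> carrier (ops P (Suc (length xs + length ys)))"
  shows "mu A (xs @ z # ys) \<theta> \<in> products P A (k + length xs + length ys)"
proof -
  obtain zs \<eta> where zs: "z = mu A zs \<eta>" "k \<le> length zs" "set zs \<subseteq> carrier A" "\<eta> \<in> carrier (ops P (length zs))"
    using z unfolding products_def by blast
  \<comment> \<open>Entries of \<open>xs\<close> and \<open>ys\<close> that happen to equal
    \<open>z\<close> are expanded too. This can only raise the arity, so a lower bound on the length
    is enough below.\<close>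
  define X where "X y = (if y = z then zs else [y])" for y
  define H where "H y = (if y = z then \<eta> else opid P)" for y
  have c: "y = mu A (X y) (H y) \<and> X y \<noteq> [] \<and> set (X y) \<subseteq> carrier A \<and> H y \<in> carrier (ops P (length (X y)))"
    if "y \<in> set (xs @ z # ys)" for y
    using that zs xs k mu_opid opid_closed unfolding X_def H_def by auto
  then obtain \<zeta> where \<zeta>: "\<zeta> \<in> carrier (ops P (length (concat (map X (xs @ z # ys)))))"
    "mu A (xs @ z # ys) \<theta> = mu A (concat (map X (xs @ z # ys))) \<zeta>"
    using mu_expand[of "xs @ z # ys" \<theta> X H] th by auto
  have len: "length us \<le> length (concat (map X us))" for us
  proof (induction us)
    case (Cons u us)
    have "1 \<le> length (X u)" using zs(2) k unfolding X_def by auto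
    then show ?case using Cons by simp
  qed simp
  have "k + length xs + length ys \<le> length (concat (map X (xs @ z # ys)))"
    using len[of xs] len[of ys] zs(2) by (simp add: X_def)
  moreover have "set (concat (map X (xs @ z # ys))) \<subseteq> carrier A" using c by fastforce
  ultimately show ?thesis using \<zeta> productsI by metis
qed

text \<open>Inserting a product of at least k factors into any slot of an operation again gives a
  product of at least k factors, and a scalar can be moved into the operation.\<close>

lemma decomposables_ideal:
  assumes k: "1 \<le> k"
  shows "palg_ideal R P A (decomposables P A k)"
proof -
  note S = products_closed[OF k]
  have "r \<odot>\<^bsub>A\<^esub> x \<in> products P A k" if r: "r \<in> carrier R" and x: "x \<in> products P A k" for r x
  proof -
    obtain xs \<theta> where xs: "x = mu A xs \<theta>" "k \<le> length xs" "set xs \<subseteq> carrier A" "\<theta> \<in> carrier (ops P (length xs))"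
      using x unfolding products_def by blast
    interpret O: module R "ops P (length xs)" using ops_module[of "length xs"] xs(2) k by simp
    have "r \<odot>\<^bsub>A\<^esub> x = mu A xs (r \<odot>\<^bsub>ops P (length xs)\<^esub> \<theta>)"
      using mu_smult_op[of xs \<theta> r] xs r k by fastforce
    then show ?thesis
      using xs r O.smult_closed[of r \<theta>] productsI by metis
  qed
  moreover have "mu A (xs @ x # ys) \<theta> \<in> decomposables P A k"
    if a: "set xs \<subseteq> carrier A" "set ys \<subseteq> carrier A" "x \<in> decomposables P A k"
      "\<theta> \<in> carrier (ops P (Suc (length xs + length ys)))" for xs x ys \<theta>
  proof (rule aspan_map[OF mu_lin_slot[OF a(1,2,4)] group_A group_A S _ a(3)])
    have "products P A (k + length xs + length ys) \<subseteq> products P A k"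
      unfolding products_def by fastforce
    then show "(\<lambda>x. mu A (xs @ x # ys) \<theta>) ` products P A k \<subseteq> products P A k"
      using mu_product_slot[OF k a(1,2) _ a(4)] by blast
  qed
  ultimately show ?thesis
    unfolding palg_ideal_def
    by (intro conjI ballI allI impI subsetI)
      (blast intro: M.aspan_closed[OF _ S] M.aspan_add[OF S] A.aspan_smult[OF S] aspan_zero)+
qed

end

lemma hom_products:
  assumes A: "palgebra R P A" and f: "f \<in> palg_hom R P A B" and k: "1 \<le> k"
  shows "f ` products P A k \<subseteq> products P B k"
proof (intro image_subsetI)
  fix x assume "x \<in> products P A k"
  then obtain xs \<theta> where xs: "x = mu A xs \<theta>" "k \<le> length xs" "set xs \<subseteq> carrier A" "\<theta> \<in> carrier (ops P (length xs))"
    unfolding products_def by blast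
  then have "f x = mu B (map f xs) \<theta>" using palg_homD(4)[OF f, of xs \<theta>] k by fastforce
  then show "f x \<in> products P B k" using xs palg_homD(1)[OF f] productsI[of k "map f xs" B \<theta> P] by auto
qed

lemma hom_decomposables:
  assumes A: "palgebra R P A" and B: "palgebra R P B" and f: "f \<in> palg_hom R P A B" and k: "1 \<le> k"
    and x: "x \<in> decomposables P A k"
  shows "f x \<in> decomposables P B k"
  using aspan_map[OF palg_hom_lin[OF f] palgebra.group_A[OF A] palgebra.group_A[OF B]
      palgebra.products_closed[OF A k] hom_products[OF A f k] x] .

lemma products_vanish_decomposables:
  assumes A: "palgebra R P A" and "products_vanish P A k" "x \<in> decomposables P A k"
  shows "x = \<zero>\<^bsub>A\<^esub>"
proof -
  interpret palgebra R P A by fact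
  show ?thesis using assms(3) by induction (use assms(2) in \<open>auto simp: products_vanish_def\<close>)
qed

lemma hom_kills_decomposables:
  assumes "palgebra R P A" "palgebra R P B" "f \<in> palg_hom R P A B" "1 \<le> k" "products_vanish P B k"
    "x \<in> decomposables P A k"
  shows "f x = \<zero>\<^bsub>B\<^esub>"
  by (rule products_vanish_decomposables[OF assms(2,5) hom_decomposables[OF assms(1-4,6)]])

lemma products_decomposables: "\<lbrakk>palgebra R P A; 1 \<le> k; x \<in> products P A k\<rbrakk> \<Longrightarrow> x \<in> decomposables P A k"
  by (metis abelian_group.aspan_base palgebra.group_A palgebra.products_closed)

section \<open>The third cross effect and the triple commutator\<close>

lemma lin_maps_neg: "\<lbrakk>module R N; f \<in> lin_maps R M N\<rbrakk> \<Longrightarrow> (\<lambda>x. \<ominus>\<^bsub>N\<^esub> f x) \<in> lin_maps R M N"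
proof -
  assume N: "module R N" and f: "f \<in> lin_maps R M N"
  interpret module R N by fact
  show "(\<lambda>x. \<ominus>\<^bsub>N\<^esub> f x) \<in> lin_maps R M N"
    by (rule lin_mapsI) (simp_all add: lin_mapsD[OF f] M.minus_add smult_r_minus)
qed

text \<open>The cross effect of degree three of a triple of morphisms into \<open>X\<close>: on a product of
  generators it vanishes unless there are at least three factors.\<close>

lemma cross_effect_decomposable:
  assumes X: "palgebra R P X" and Y: "palgebra R P Y"
    and gen: "carrier Y \<subseteq> generated R P Y (i1 ` carrier X \<union> i2 ` carrier X \<union> i3 ` carrier X)"
    and i: "i1 \<in> palg_hom R P X Y" "i2 \<in> palg_hom R P X Y" "i3 \<in> palg_hom R P X Y"
    and h: "h123 \<in> palg_hom R P Y X" "h12 \<in> palg_hom R P Y X" "h13 \<in> palg_hom R P Y X"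
      "h23 \<in> palg_hom R P Y X" "h1 \<in> palg_hom R P Y X" "h2 \<in> palg_hom R P Y X" "h3 \<in> palg_hom R P Y X"
    and v1: "\<And>x. x \<in> carrier X \<Longrightarrow> h123 (i1 x) = x \<and> h12 (i1 x) = x \<and> h13 (i1 x) = x \<and>
        h23 (i1 x) = \<zero>\<^bsub>X\<^esub> \<and> h1 (i1 x) = x \<and> h2 (i1 x) = \<zero>\<^bsub>X\<^esub> \<and> h3 (i1 x) = \<zero>\<^bsub>X\<^esub>"
    and v2: "\<And>x. x \<in> carrier X \<Longrightarrow> h123 (i2 x) = x \<and> h12 (i2 x) = x \<and> h13 (i2 x) = \<zero>\<^bsub>X\<^esub> \<and>
        h23 (i2 x) = x \<and> h1 (i2 x) = \<zero>\<^bsub>X\<^esub> \<and> h2 (i2 x) = x \<and> h3 (i2 x) = \<zero>\<^bsub>X\<^esub>"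
    and v3: "\<And>x. x \<in> carrier X \<Longrightarrow> h123 (i3 x) = x \<and> h12 (i3 x) = \<zero>\<^bsub>X\<^esub> \<and> h13 (i3 x) = x \<and>
        h23 (i3 x) = x \<and> h1 (i3 x) = \<zero>\<^bsub>X\<^esub> \<and> h2 (i3 x) = \<zero>\<^bsub>X\<^esub> \<and> h3 (i3 x) = x"
    and u: "u \<in> carrier Y"
    and ker: "h12 u = \<zero>\<^bsub>X\<^esub>" "h13 u = \<zero>\<^bsub>X\<^esub>" "h23 u = \<zero>\<^bsub>X\<^esub>" "h1 u = \<zero>\<^bsub>X\<^esub>" "h2 u = \<zero>\<^bsub>X\<^esub>" "h3 u = \<zero>\<^bsub>X\<^esub>"
  shows "h123 u \<in> decomposables P X 3"
proof -
  interpret X: palgebra R P X by fact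
  interpret Y: palgebra R P Y by fact
  note lin = h[THEN palg_hom_lin]
  let ?G = "i1 ` carrier X \<union> i2 ` carrier X \<union> i3 ` carrier X"
  let ?D = "decomposables P X 3"
  have G: "?G \<subseteq> carrier Y" using palg_homD(1)[OF i(1)] palg_homD(1)[OF i(2)] palg_homD(1)[OF i(3)] by auto
  have I: "palg_ideal R P X ?D" by (rule X.decomposables_ideal) simp
  have D: "?D \<subseteq> carrier X" "\<zero>\<^bsub>X\<^esub> \<in> ?D" "\<And>x y. \<lbrakk>x \<in> ?D; y \<in> ?D\<rbrakk> \<Longrightarrow> x \<oplus>\<^bsub>X\<^esub> y \<in> ?D"
    using I unfolding palg_ideal_def by auto
  have Dneg: "\<ominus>\<^bsub>X\<^esub> x \<in> ?D" if "x \<in> ?D" for x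
    using I that X.neg_eq_smult[of x] D(1) unfolding palg_ideal_def by auto
  \<comment> \<open>For a set S of indices, \<open>hS\<close> is the identity on the copies of X
    with index in S and zero on the others. The difference of \<open>L\<close> and \<open>L'\<close>
    is the inclusion-exclusion sum over nonempty S, separated by sign. On \<open>u\<close> every
    term but \<open>h123 u\<close> vanishes.\<close>
  define L where "L u = h123 u \<oplus>\<^bsub>X\<^esub> (h1 u \<oplus>\<^bsub>X\<^esub> (h2 u \<oplus>\<^bsub>X\<^esub> h3 u))" for u
  define L' where "L' u = h12 u \<oplus>\<^bsub>X\<^esub> (h13 u \<oplus>\<^bsub>X\<^esub> h23 u)" for u
  have E: "(\<lambda>u. L u \<oplus>\<^bsub>X\<^esub> \<ominus>\<^bsub>X\<^esub> L' u) \<in> lin_maps R Y X"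
    unfolding L_def L'_def by (intro lin_maps_sum lin_maps_neg lin X.module_A)
  have hc: "h123 u \<in> carrier X" "h12 u \<in> carrier X" "h13 u \<in> carrier X" "h23 u \<in> carrier X"
      "h1 u \<in> carrier X" "h2 u \<in> carrier X" "h3 u \<in> carrier X" if "u \<in> carrier Y" for u
    using that h[THEN palg_homD(1)] by auto
  have mono: "L m \<oplus>\<^bsub>X\<^esub> \<ominus>\<^bsub>X\<^esub> L' m \<in> ?D" if m: "m \<in> monomials P Y ?G" for m
  proof -
    obtain ys \<theta> where ys: "m = mu Y ys \<theta>" "ys \<noteq> []" "set ys \<subseteq> ?G" "\<theta> \<in> carrier (ops P (length ys))"
      using m unfolding monomials_def by blast
    have ysc: "set ys \<subseteq> carrier Y" using ys(3) G by blast
    note hm = h[THEN palg_homD(4), OF ys(2) ysc ys(4), folded ys(1)]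
    consider a where "ys = [a]" | a b where "ys = [a, b]" | "3 \<le> length ys"
      using ys(2) by (cases ys; cases "tl ys"; cases "tl (tl ys)") auto
    then show ?thesis
    proof cases
      case 1
      have z: "mu X [\<zero>\<^bsub>X\<^esub>] \<theta> = \<zero>\<^bsub>X\<^esub>" using X.mu_zero[of "[\<zero>\<^bsub>X\<^esub>]" \<theta>] ys(4) 1 by simp
      have c: "mu X [x] \<theta> \<in> carrier X" if "x \<in> carrier X" for x using X.mu_closed[of "[x]" \<theta>] that ys(4) 1 by simp
      \<comment> \<open>A single generator lies in one copy; that copy is counted twice by
        \<open>L\<close>, through \<open>h123\<close> and one \<open>hi\<close>, and twice by
        \<open>L'\<close>. With two generators the counts are again two and two if they share a
        copy, and one and one otherwise.\<close>
      have "L m = L' m"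
        unfolding L_def L'_def hm using ys(3) 1 by (auto simp: v1 v2 v3 z c)
      then show ?thesis using D(2) X.M.r_neg hc[OF Y.mu_closed[OF ys(2) ysc ys(4)]] ys(1) unfolding L'_def by simp
    next
      case 2
      have z: "mu X [\<zero>\<^bsub>X\<^esub>, x] \<theta> = \<zero>\<^bsub>X\<^esub>" "mu X [x, \<zero>\<^bsub>X\<^esub>] \<theta> = \<zero>\<^bsub>X\<^esub>" if "x \<in> carrier X" for x
        using X.mu_zero[of "[\<zero>\<^bsub>X\<^esub>, x]" \<theta>] X.mu_zero[of "[x, \<zero>\<^bsub>X\<^esub>]" \<theta>] that ys(4) 2 by simp_all
      have c: "mu X [x, y] \<theta> \<in> carrier X" if "x \<in> carrier X" "y \<in> carrier X" for x y
        using X.mu_closed[of "[x, y]" \<theta>] that ys(4) 2 by simp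
      have "L m = L' m"
        unfolding L_def L'_def hm using ys(3) 2 by (auto simp: v1 v2 v3 z c)
      then show ?thesis using D(2) X.M.r_neg hc[OF Y.mu_closed[OF ys(2) ysc ys(4)]] ys(1) unfolding L'_def by simp
    next
      case 3
      have c: "mu X (map f ys) \<theta> \<in> ?D" if "f \<in> palg_hom R P Y X" for f
      proof -
        have "set (map f ys) \<subseteq> carrier X" using ysc palg_homD(1)[OF that] by auto
        then show ?thesis
          using productsI[of 3 "map f ys" X \<theta> P] products_decomposables[OF X, of 3] 3 ys(4) by auto
      qed
      then show ?thesis unfolding L_def L'_def hm by (intro D(3) Dneg c h)
    qed
  qed
  have "L u \<oplus>\<^bsub>X\<^esub> \<ominus>\<^bsub>X\<^esub> L' u \<in> aspan X ?D"
    by (rule aspan_map[OF E Y.group_A X.group_A Y.monomials_closed[OF G]])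
      (use mono Y.generated_aspan_monomials[OF G] u gen in auto)
  then have "L u \<oplus>\<^bsub>X\<^esub> \<ominus>\<^bsub>X\<^esub> L' u \<in> ?D" using X.M.aspan_aspan[OF X.products_closed] by simp
  moreover have "L u \<oplus>\<^bsub>X\<^esub> \<ominus>\<^bsub>X\<^esub> L' u = h123 u"
    using hc[OF u] unfolding L_def L'_def ker by simp
  ultimately show ?thesis by auto
qed

text \<open>One inclusion is the cross-effect argument applied to X + X + X. For the other, a
  product of at least three factors is lifted by distributing its factors over all three copies, so
  that each of the three maps defining the cosmash product meets a zero argument.\<close>

lemma triple_comm_eq:
  fixes X :: "('r, 'p, 'x) palg"
  assumes X: "palgebra R P X"
  shows "triple_comm R P X = decomposables P X 3"
proof -
  interpret X: palgebra R P X by fact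
  have op: "operad R P" by (rule X.operad_axioms)
  define C where "C = coprod R P X X"
  define Y where "Y = coprod R P C X"
  have C: "palgebra R P C" and Y: "palgebra R P Y" unfolding C_def Y_def by (rule coprod_palgebra[OF op])+
  interpret C: palgebra R P C by fact
  interpret Y: palgebra R P Y by fact
  let ?l = "coprod_inl R P X X" and ?r = "coprod_inr R P X X"
  let ?L = "coprod_inl R P C X" and ?R = "coprod_inr R P C X"
  have l: "?l \<in> palg_hom R P X C" and r: "?r \<in> palg_hom R P X C" unfolding C_def
    by (rule coprod_inl_hom[OF X] coprod_inr_hom[OF X])+
  have L: "?L \<in> palg_hom R P C Y" and R: "?R \<in> palg_hom R P X Y" unfolding Y_def
    by (rule coprod_inl_hom[OF C] coprod_inr_hom[OF X])+
  have id: "id \<in> palg_hom R P X X" by (rule palg_hom_id)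
  have idC: "id \<in> palg_hom R P C C" by (rule palg_hom_id)
  note z = zero_map_hom[OF X] zero_map_hom[OF C]
  have cX: "copair X f g \<in> palg_hom R P C X \<and> (\<forall>x\<in>carrier X. copair X f g (?l x) = f x) \<and> (\<forall>x\<in>carrier X. copair X f g (?r x) = g x)"
    if "f \<in> palg_hom R P X X" "g \<in> palg_hom R P X X" for f g
    using copair[OF X X X that] unfolding C_def by blast
  have cC: "copair C f g \<in> palg_hom R P C C \<and> (\<forall>x\<in>carrier X. copair C f g (?l x) = f x) \<and> (\<forall>x\<in>carrier X. copair C f g (?r x) = g x)"
    if "f \<in> palg_hom R P X C" "g \<in> palg_hom R P X C" for f g
    using copair[OF X X C that] unfolding C_def by blast
  have cYC: "copair C f g \<in> palg_hom R P Y C \<and> (\<forall>x\<in>carrier C. copair C f g (?L x) = f x) \<and> (\<forall>x\<in>carrier X. copair C f g (?R x) = g x)"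
    if "f \<in> palg_hom R P C C" "g \<in> palg_hom R P X C" for f g
    using copair[OF C X C that] unfolding Y_def by blast
  have cYX: "copair X f g \<in> palg_hom R P Y X \<and> (\<forall>x\<in>carrier C. copair X f g (?L x) = f x) \<and> (\<forall>x\<in>carrier X. copair X f g (?R x) = g x)"
    if "f \<in> palg_hom R P C X" "g \<in> palg_hom R P X X" for f g
    using copair[OF C X X that] unfolding Y_def by blast
  \<comment> \<open>The three components of the map defining the ternary cosmash product:
    \<open>k1\<close> kills the third copy of X, \<open>k2\<close> the second and \<open>k3\<close>
    the first.\<close>
  define k1 where "k1 = copair C id (zero_map C :: 'x \<Rightarrow> _)"
  define k2 where "k2 = copair C (copair C ?l (zero_map C :: 'x \<Rightarrow> _)) ?r"
  define k3 where "k3 = copair C (copair C (zero_map C :: 'x \<Rightarrow> _) ?l) ?r"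
  define nab where "nab = copair X (id :: 'x \<Rightarrow> 'x) (id :: 'x \<Rightarrow> 'x)"
  define pl where "pl = copair X (id :: 'x \<Rightarrow> 'x) (zero_map X :: 'x \<Rightarrow> 'x)"
  define pr where "pr = copair X (zero_map X :: 'x \<Rightarrow> 'x) (id :: 'x \<Rightarrow> 'x)"
  define N where "N = copair X nab (id :: 'x \<Rightarrow> 'x)"
  note k1 = cYC[OF idC z(2), folded k1_def]
  note k2 = cYC[OF cC[OF l z(2), THEN conjunct1] r, folded k2_def]
  note k3 = cYC[OF cC[OF z(2) l, THEN conjunct1] r, folded k3_def]
  note nab = cX[OF id id, folded nab_def]
  note pl = cX[OF id z(1), folded pl_def]
  note pr = cX[OF z(1) id, folded pr_def]
  note N = cYX[OF nab[THEN conjunct1] id, folded N_def]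
  note in2 = cC[OF l z(2)] cC[OF z(2) l]
  have carr: "?l x \<in> carrier C" "?r x \<in> carrier C" "?R x \<in> carrier Y" if "x \<in> carrier X" for x
    using that palg_homD(1)[OF l] palg_homD(1)[OF r] palg_homD(1)[OF R] by auto
  define i1 where "i1 x = ?L (?l x)" for x
  define i2 where "i2 x = ?L (?r x)" for x
  have i1: "i1 \<in> palg_hom R P X Y" and i2: "i2 \<in> palg_hom R P X Y"
    unfolding i1_def[abs_def] i2_def[abs_def] by (rule palg_hom_comp[OF l L] palg_hom_comp[OF r L])+
  have zz: "copair X (f :: 'x \<Rightarrow> 'x) (g :: 'x \<Rightarrow> 'x) \<zero>\<^bsub>C\<^esub> = \<zero>\<^bsub>X\<^esub>" if "f \<in> palg_hom R P X X" "g \<in> palg_hom R P X X" for f g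
    using palg_hom_zero[OF _ C X] cX[OF that] by blast
  note zv = zz[OF id id, folded nab_def] zz[OF id z(1), folded pl_def] zz[OF z(1) id, folded pr_def]
  have gen: "carrier Y \<subseteq> generated R P Y (i1 ` carrier X \<union> i2 ` carrier X \<union> ?R ` carrier X)" (is "_ \<subseteq> ?gen")
  proof
    fix y assume "y \<in> carrier Y"
    then have y: "y \<in> generated R P Y (?L ` carrier C \<union> ?R ` carrier X)"
      unfolding Y_def by (rule coprod_generated)
    have "?L c \<in> ?gen" if "c \<in> carrier C" for c
    proof (rule generated_hom_image[OF L C Y])
      show "c \<in> generated R P C (?l ` carrier X \<union> ?r ` carrier X)"
        using coprod_generated that unfolding C_def by blast
    qed (use carr in \<open>auto simp: i1_def i2_def intro!: generated_base\<close>)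
    \<comment> \<open>Applied to the identity morphism, \<open>generated_hom_image\<close> expresses
      transitivity of generation.\<close>
    then have "id ` (?L ` carrier C \<union> ?R ` carrier X) \<subseteq> ?gen"
      by (auto intro: generated_base)
    then show "y \<in> ?gen"
      using generated_hom_image[OF palg_hom_id Y Y _ _ y, of "i1 ` carrier X \<union> i2 ` carrier X \<union> ?R ` carrier X"]
        palg_homD(1)[OF L] carr by auto
  qed
  have kerY: "carrier (cosmash3 R P X X X) = {u \<in> carrier Y. k1 u = \<zero>\<^bsub>C\<^esub> \<and> k2 u = \<zero>\<^bsub>C\<^esub> \<and> k3 u = \<zero>\<^bsub>C\<^esub>}"
    unfolding cosmash3_def palg_kernel_def a_kernel_def' palg_prod_def cosmash3_map_def
      C_def[symmetric] Y_def[symmetric] k1_def[symmetric] k2_def[symmetric] k3_def[symmetric] by auto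
  have tc: "triple_comm R P X = N ` carrier (cosmash3 R P X X X)"
    unfolding triple_comm_def N_def nab_def ..
  show ?thesis
  proof
    show "triple_comm R P X \<subseteq> decomposables P X 3"
    proof
      fix x assume "x \<in> triple_comm R P X"
      then obtain u where u: "x = N u" "u \<in> carrier Y" "k1 u = \<zero>\<^bsub>C\<^esub>" "k2 u = \<zero>\<^bsub>C\<^esub>" "k3 u = \<zero>\<^bsub>C\<^esub>"
        unfolding tc kerY by blast
      \<comment> \<open>All proper terms of the inclusion-exclusion factor through
        \<open>k1\<close>, \<open>k2\<close>, \<open>k3\<close>: the terms for two indices by
        folding with \<open>nab\<close>, those for one index by a projection, namely
        \<open>pl\<close> and \<open>pr\<close> after \<open>k1\<close> and \<open>pr\<close> after
        \<open>k2\<close>.\<close>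
      have "N u \<in> decomposables P X 3"
        by (rule cross_effect_decomposable[OF X Y gen i1 i2 R N[THEN conjunct1]
            palg_hom_comp[OF k1[THEN conjunct1] nab[THEN conjunct1]]
            palg_hom_comp[OF k2[THEN conjunct1] nab[THEN conjunct1]]
            palg_hom_comp[OF k3[THEN conjunct1] nab[THEN conjunct1]]
            palg_hom_comp[OF k1[THEN conjunct1] pl[THEN conjunct1]]
            palg_hom_comp[OF k1[THEN conjunct1] pr[THEN conjunct1]]
            palg_hom_comp[OF k2[THEN conjunct1] pr[THEN conjunct1]]])
          (use u in \<open>simp_all add: i1_def i2_def carr k1 k2 k3 N nab pl pr in2 zv zero_map_apply C.M.zero_closed\<close>)
      then show "x \<in> decomposables P X 3" using u by simp
    qed
    show "decomposables P X 3 \<subseteq> triple_comm R P X"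
    proof
      fix x assume "x \<in> decomposables P X 3"
      then show "x \<in> triple_comm R P X"
      proof induction
        case aspan_zero
        have "\<zero>\<^bsub>Y\<^esub> \<in> carrier (cosmash3 R P X X X)"
          unfolding kerY using palg_hom_zero[OF _ Y C] k1 k2 k3 Y.M.zero_closed by blast
        moreover have "N \<zero>\<^bsub>Y\<^esub> = \<zero>\<^bsub>X\<^esub>" using palg_hom_zero[OF _ Y X] N by blast
        ultimately show ?case unfolding tc by force
      next
        case (aspan_step x y)
        obtain xs \<theta> where xs: "x = mu X xs \<theta>" "3 \<le> length xs" "set xs \<subseteq> carrier X" "\<theta> \<in> carrier (ops P (length xs))"
          using aspan_step(1) unfolding products_def by blast
        obtain a b c cs where abc: "xs = a # b # c # cs"
          using xs(2) by (metis (no_types, opaque_lifting) Suc_le_length_iff numeral_3_eq_3)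
        \<comment> \<open>The lift of the product: the first factor goes to the first copy, the
          second to the second copy and all others to the third. The codiagonal \<open>N\<close>
          returns the original factors.\<close>
        define us where "us = i1 a # i2 b # map ?R (c # cs)"
        define u where "u = mu Y us \<theta>"
        have us: "us \<noteq> []" "set us \<subseteq> carrier Y" "\<theta> \<in> carrier (ops P (length us))"
          using xs abc carr palg_homD(1)[OF i1] palg_homD(1)[OF i2] unfolding us_def by auto
        have uc: "u \<in> carrier Y" unfolding u_def by (rule Y.mu_closed[OF us])
        have k0: "k u = \<zero>\<^bsub>C\<^esub>" if k: "k \<in> palg_hom R P Y C" and "\<zero>\<^bsub>C\<^esub> \<in> k ` set us" for k
        proof -
          have "k u = mu C (map k us) \<theta>" unfolding u_def by (rule palg_homD(4)[OF k us])
          also have "\<dots> = \<zero>\<^bsub>C\<^esub>" using that us palg_homD(1)[OF k] by (intro C.mu_zero) auto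
          finally show ?thesis .
        qed
        have abcc: "a \<in> carrier X" "b \<in> carrier X" "c \<in> carrier X" "set cs \<subseteq> carrier X" using xs abc by auto
        have "k1 (?R c) = \<zero>\<^bsub>C\<^esub>" "k2 (i2 b) = \<zero>\<^bsub>C\<^esub>" "k3 (i1 a) = \<zero>\<^bsub>C\<^esub>"
          using abcc by (simp_all add: k1 k2 k3 i1_def i2_def carr in2 zero_map_apply)
        then have "\<zero>\<^bsub>C\<^esub> \<in> k1 ` set us" "\<zero>\<^bsub>C\<^esub> \<in> k2 ` set us" "\<zero>\<^bsub>C\<^esub> \<in> k3 ` set us"
          unfolding us_def by (force, force, force)
        then have uk: "u \<in> carrier (cosmash3 R P X X X)"
          unfolding kerY using uc k0 k1 k2 k3 by blast
        have "N u = mu X (map N us) \<theta>" unfolding u_def by (rule palg_homD(4)[OF N[THEN conjunct1] us])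
        also have "map N us = xs"
          unfolding us_def abc using abcc by (auto simp: N nab i1_def i2_def carr intro!: map_idI)
        finally have Nu: "N u = x" using xs by simp
        obtain v where v: "v \<in> carrier (cosmash3 R P X X X)" "y = N v" using aspan_step(3) unfolding tc by blast
        have "u \<oplus>\<^bsub>Y\<^esub> v \<in> carrier (cosmash3 R P X X X)"
          using uk v(1) k1[THEN conjunct1, THEN palg_homD(2)] k2[THEN conjunct1, THEN palg_homD(2)]
            k3[THEN conjunct1, THEN palg_homD(2)] unfolding kerY by simp
        moreover have "N (u \<oplus>\<^bsub>Y\<^esub> v) = x \<oplus>\<^bsub>X\<^esub> y"
          using N[THEN conjunct1, THEN palg_homD(2), OF uc, of v] v Nu unfolding kerY by simp
        ultimately show ?case unfolding tc by force
      qed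
    qed
  qed
qed

section \<open>The two-nilpotent reflection and its coproducts\<close>

lemma nil2_eq: "palgebra R P A \<Longrightarrow> nil2 R P A = palg_quot A (decomposables P A 3)"
  by (simp add: nil2_def triple_comm_eq)

lemma nil2_proj_eq: "palgebra R P A \<Longrightarrow> nil2_proj R P A = (\<lambda>x. decomposables P A 3 +>\<^bsub>A\<^esub> x)"
  by (simp add: nil2_proj_def[abs_def] triple_comm_eq)

lemma nil2:
  assumes A: "palgebra R P A"
  shows nil2_palgebra: "palgebra R P (nil2 R P A)"
    and nil2_proj_hom: "nil2_proj R P A \<in> palg_hom R P A (nil2 R P A)"
    and nil2_carrier: "carrier (nil2 R P A) = nil2_proj R P A ` carrier A"
    and nil2_products_vanish: "products_vanish P (nil2 R P A) 3"
    and nil2_proj_eq_iff: "\<lbrakk>x \<in> carrier A; y \<in> carrier A\<rbrakk>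
      \<Longrightarrow> nil2_proj R P A x = nil2_proj R P A y \<longleftrightarrow> x \<ominus>\<^bsub>A\<^esub> y \<in> decomposables P A 3"
proof -
  interpret palgebra R P A by fact
  have I: "palg_ideal R P A (decomposables P A 3)" by (rule decomposables_ideal) simp
  note pj = nil2_proj_eq[OF A]
  show N: "palgebra R P (nil2 R P A)" and h: "nil2_proj R P A \<in> palg_hom R P A (nil2 R P A)"
    unfolding pj nil2_eq[OF A] by (rule palg_quot_palgebra[OF I])+
  show car: "carrier (nil2 R P A) = nil2_proj R P A ` carrier A"
    unfolding pj nil2_eq[OF A] by (rule palg_quot_simps(1)[OF I])
  show eq: "nil2_proj R P A x = nil2_proj R P A y \<longleftrightarrow> x \<ominus>\<^bsub>A\<^esub> y \<in> decomposables P A 3"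
    if "x \<in> carrier A" "y \<in> carrier A" for x y
    unfolding pj by (rule ideal_coset_eq_iff[OF I that])
  show "products_vanish P (nil2 R P A) 3"
  proof (rule products_vanishI)
    fix xs \<theta> assume xs: "3 \<le> length xs" "set xs \<subseteq> carrier (nil2 R P A)" "\<theta> \<in> carrier (ops P (length xs))"
    then obtain as where as: "xs = map (nil2_proj R P A) as" "set as \<subseteq> carrier A"
      using subset_image_list[of xs "nil2_proj R P A" "carrier A"] unfolding car by metis
    have ne: "as \<noteq> []" using as xs by auto
    have th: "\<theta> \<in> carrier (ops P (length as))" using as xs by simp
    note c = mu_closed[OF ne as(2) th]
    have neg0: "\<ominus>\<^bsub>A\<^esub> \<zero>\<^bsub>A\<^esub> = \<zero>\<^bsub>A\<^esub>" by (metis M.zero_closed M.a_inv_closed M.l_neg M.r_zero)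
    have "mu A as \<theta> \<in> decomposables P A 3"
      using productsI[of 3 as A \<theta> P] products_decomposables[OF A, of 3] as xs by auto
    then have "nil2_proj R P A (mu A as \<theta>) = nil2_proj R P A \<zero>\<^bsub>A\<^esub>"
      using c by (subst eq) (auto simp: a_minus_def neg0)
    then show "mu (nil2 R P A) xs \<theta> = \<zero>\<^bsub>nil2 R P A\<^esub>"
      using palg_homD(4)[OF h ne as(2) th] palg_hom_zero[OF h A N] as by simp
  qed
qed

text \<open>The universal property of the reflection: a morphism preserves the number of factors,
  and products of three factors vanish in \<open>D\<close>.\<close>

lemma nil2_lift:
  assumes A: "palgebra R P A" and D: "palgebra R P D" "products_vanish P D 3" and f: "f \<in> palg_hom R P A D"
  shows nil2_lift_hom: "class_lift f \<in> palg_hom R P (nil2 R P A) D"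
    and nil2_lift_proj: "x \<in> carrier A \<Longrightarrow> class_lift f (nil2_proj R P A x) = f x"
proof -
  interpret palgebra R P A by fact
  have I: "palg_ideal R P A (decomposables P A 3)" by (rule decomposables_ideal) simp
  have ker: "f x = \<zero>\<^bsub>D\<^esub>" if "x \<in> decomposables P A 3" for x
    by (rule hom_kills_decomposables[OF A D(1) f _ D(2) that]) simp
  show "class_lift f \<in> palg_hom R P (nil2 R P A) D" "x \<in> carrier A \<Longrightarrow> class_lift f (nil2_proj R P A x) = f x"
    unfolding nil2_proj_eq[OF A] nil2_eq[OF A] by (rule palg_quot_lift[OF I D(1) f ker]; assumption)+
qed

lemma nil2_map:
  assumes A: "palgebra R P A" and B: "palgebra R P B" and f: "f \<in> palg_hom R P A B"
  shows nil2_map_hom: "nil2_map R P B f \<in> palg_hom R P (nil2 R P A) (nil2 R P B)"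
    and nil2_map_proj: "x \<in> carrier A \<Longrightarrow> nil2_map R P B f (nil2_proj R P A x) = nil2_proj R P B (f x)"
  unfolding nil2_map_def
  using nil2_lift[OF A nil2_palgebra[OF B] nil2_products_vanish[OF B] palg_hom_comp[OF f nil2_proj_hom[OF B]]]
  by blast+

section \<open>Coproducts of two-nilpotent algebras\<close>

lemma coprod2:
  assumes X: "palgebra R P X" and Y: "palgebra R P Y"
  shows coprod2_palgebra: "palgebra R P (coprod2 R P X Y)"
    and coprod2_products_vanish: "products_vanish P (coprod2 R P X Y) 3"
    and coprod2_inl_hom: "coprod2_inl R P X Y \<in> palg_hom R P X (coprod2 R P X Y)"
    and coprod2_inr_hom: "coprod2_inr R P X Y \<in> palg_hom R P Y (coprod2 R P X Y)"
    and coprod2_generated: "carrier (coprod2 R P X Y)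
      \<subseteq> generated R P (coprod2 R P X Y) (coprod2_inl R P X Y ` carrier X \<union> coprod2_inr R P X Y ` carrier Y)"
proof -
  have op: "operad R P" by (rule palgebra.axioms(1)[OF X])
  let ?C = "coprod R P X Y"
  have C: "palgebra R P ?C" by (rule coprod_palgebra[OF op])
  note n = nil2[OF C]
  show W: "palgebra R P (coprod2 R P X Y)" "products_vanish P (coprod2 R P X Y) 3"
    unfolding coprod2_def by (rule n)+
  show l: "coprod2_inl R P X Y \<in> palg_hom R P X (coprod2 R P X Y)"
    unfolding coprod2_def coprod2_inl_def[abs_def] by (rule palg_hom_comp[OF coprod_inl_hom[OF X] n(2)])
  show r: "coprod2_inr R P X Y \<in> palg_hom R P Y (coprod2 R P X Y)"
    unfolding coprod2_def coprod2_inr_def[abs_def] by (rule palg_hom_comp[OF coprod_inr_hom[OF Y] n(2)])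
  let ?g = "generated R P (coprod2 R P X Y) (coprod2_inl R P X Y ` carrier X \<union> coprod2_inr R P X Y ` carrier Y)"
  show "carrier (coprod2 R P X Y) \<subseteq> ?g"
  proof
    fix w assume "w \<in> carrier (coprod2 R P X Y)"
    then obtain u where u: "u \<in> carrier ?C" "w = nil2_proj R P ?C u" unfolding coprod2_def n(3) by blast
    have "nil2_proj R P ?C u \<in> ?g"
      by (rule generated_hom_image[OF n(2)[folded coprod2_def] C W(1) _ _ coprod_generated[OF u(1)]])
        (auto simp: image_Un image_image coprod2_inl_def[symmetric] coprod2_inr_def[symmetric]
          palg_homD(1)[OF coprod_inl_hom[OF X]] palg_homD(1)[OF coprod_inr_hom[OF Y]] intro: generated_base)
    then show "w \<in> ?g" using u by simp
  qed
qed

lemma copair2: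
  assumes X: "palgebra R P X" and Y: "palgebra R P Y" and D: "palgebra R P D" "products_vanish P D 3"
    and f: "f \<in> palg_hom R P X D" and g: "g \<in> palg_hom R P Y D"
  shows copair2_hom: "copair2 D f g \<in> palg_hom R P (coprod2 R P X Y) D"
    and copair2_inl: "x \<in> carrier X \<Longrightarrow> copair2 D f g (coprod2_inl R P X Y x) = f x"
    and copair2_inr: "y \<in> carrier Y \<Longrightarrow> copair2 D f g (coprod2_inr R P X Y y) = g y"
proof -
  have op: "operad R P" by (rule palgebra.axioms(1)[OF X])
  have C: "palgebra R P (coprod R P X Y)" by (rule coprod_palgebra[OF op])
  note l = nil2_lift[OF C D copair_hom[OF X Y D(1) f g], folded copair2_def]
  show "copair2 D f g \<in> palg_hom R P (coprod2 R P X Y) D"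
    unfolding coprod2_def by (rule l)
  show "x \<in> carrier X \<Longrightarrow> copair2 D f g (coprod2_inl R P X Y x) = f x"
    unfolding coprod2_inl_def
    by (simp add: l palg_homD(1)[OF coprod_inl_hom[OF X]] copair_inl[OF X Y D(1) f g])
  show "y \<in> carrier Y \<Longrightarrow> copair2 D f g (coprod2_inr R P X Y y) = g y"
    unfolding coprod2_inr_def
    by (simp add: l palg_homD(1)[OF coprod_inr_hom[OF Y]] copair_inr[OF X Y D(1) f g])
qed


section \<open>Generators of the cosmash product\<close>

definition swap2 :: "nat \<Rightarrow> nat" where "swap2 = Transposition.transpose 0 1"

lemma swap2_permutes: "swap2 permutes {..<2}"
  unfolding swap2_def by (rule permutes_swap_id) auto

lemma swap2_swap2: "swap2 \<circ> swap2 = id"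
  unfolding swap2_def by (rule transpose_comp_involutory)

lemma permute_list_swap2: "permute_list swap2 [x, y] = [y, x]"
  by (simp add: permute_list_def swap2_def numeral_2_eq_2 upt_rec)

lemma permutes2_cases:
  assumes "t permutes {..<(2::nat)}"
  shows "t = id \<or> t = swap2"
proof -
  have "t 0 \<in> {..<2}" "t 1 \<in> {..<2}" using permutes_in_image[OF assms] by auto
  moreover have "t 0 \<noteq> t 1" using permutes_inj[OF assms] by (metis inj_eq zero_neq_one)
  moreover have "t i = i" if "i \<ge> 2" for i using assms that by (auto simp: permutes_def)
  ultimately have "(\<forall>i. t i = i) \<or> (\<forall>i. t i = swap2 i)"
    unfolding swap2_def Transposition.transpose_def
    by (metis One_nat_def lessThan_iff less_2_cases not_le)
  then show ?thesis by auto
qed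

lemma (in palgebra) mu_swap2:
  assumes "x \<in> carrier A" "y \<in> carrier A" "\<theta> \<in> carrier (ops P 2)"
  shows "mu A [x, y] (operm P 2 swap2 \<theta>) = mu A [y, x] \<theta>"
  using mu_perm[of "[x, y]" swap2 \<theta>] assms swap2_permutes by (simp add: permute_list_swap2 numeral_2_eq_2)

lemma (in operad) swap2_closed: "\<theta> \<in> carrier (ops P 2) \<Longrightarrow> operm P 2 swap2 \<theta> \<in> carrier (ops P 2)"
  by (rule perm_closed[OF _ swap2_permutes]) auto

lemma (in operad) swap2_involutory:
  "\<theta> \<in> carrier (ops P 2) \<Longrightarrow> operm P 2 swap2 (operm P 2 swap2 \<theta>) = \<theta>"
  using perm_comp[OF _ swap2_permutes swap2_permutes, of \<theta>] perm_id[of 2 \<theta>] by (simp add: swap2_swap2)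

text \<open>A span is built from zero and addition alone and does not consult the carrier. Spans
  inside a kernel can therefore be computed in the ambient algebra.\<close>

lemma aspan_carrier_update: "aspan (A\<lparr>carrier := S\<rparr>) T = aspan A T"
proof -
  have "x \<in> aspan A T" if "x \<in> aspan (A\<lparr>carrier := S\<rparr>) T" for x
    using that by induction (use aspan_zero aspan_step in auto)
  moreover have "x \<in> aspan (A\<lparr>carrier := S\<rparr>) T" if "x \<in> aspan A T" for x
    using that
    by induction (use aspan_zero[of "A\<lparr>carrier := S\<rparr>"] aspan_step[of _ T _ "A\<lparr>carrier := S\<rparr>"] in auto)
  ultimately show ?thesis by blast
qed

definition tensor ::
  "('r, 'm) ring_scheme \<Rightarrow> ('r, 'p) operad \<Rightarrow> ('r, 'p, 'x) palg \<Rightarrow> ('r, 'p, 'y) palg \<Rightarrow> 'x \<Rightarrow> 'y \<Rightarrow> 'p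
    \<Rightarrow> ('r, 'p, 'x, 'y) coprod2"
  where "tensor R P X Y x y \<theta> = mu (coprod2 R P X Y) [coprod2_inl R P X Y x, coprod2_inr R P X Y y] \<theta>"

text \<open>Only products with the factor from X on the left are listed; the opposite order is
  absorbed by letting the transposition act on \<theta>.\<close>

definition tensors ::
  "('r, 'm) ring_scheme \<Rightarrow> ('r, 'p) operad \<Rightarrow> ('r, 'p, 'x) palg \<Rightarrow> ('r, 'p, 'y) palg
    \<Rightarrow> ('r, 'p, 'x, 'y) coprod2 set"
  where "tensors R P X Y =
    {tensor R P X Y x y \<theta> | x y \<theta>. x \<in> carrier X \<and> y \<in> carrier Y \<and> \<theta> \<in> carrier (ops P 2)}"

text \<open>The map from the two-nilpotent coproduct to the product of X and Y splits linearly, so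
  its kernel is the image of a linear projection. The coproduct is spanned by monomials in X and Y,
  hence the kernel is spanned by their projections.\<close>

lemma cosmash2:
  fixes X :: "('r, 'p, 'x) palg" and Y :: "('r, 'p, 'y) palg"
  assumes X: "palgebra R P X" "products_vanish P X 3" and Y: "palgebra R P Y" "products_vanish P Y 3"
  shows cosmash2_palgebra: "palgebra R P (cosmash2 R P X Y)"
    and cosmash2_products_vanish: "products_vanish P (cosmash2 R P X Y) 2"
    and cosmash2_carrier: "carrier (cosmash2 R P X Y) = aspan (cosmash2 R P X Y) (tensors R P X Y)"
    and cosmash2_subset: "carrier (cosmash2 R P X Y) \<subseteq> carrier (coprod2 R P X Y)"
    and tensors_subset: "tensors R P X Y \<subseteq> carrier (cosmash2 R P X Y)"
proof -
  let ?W = "coprod2 R P X Y" and ?l = "coprod2_inl R P X Y" and ?r = "coprod2_inr R P X Y"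
  interpret X: palgebra R P X by fact
  interpret Y: palgebra R P Y by fact
  interpret W: palgebra R P ?W by (rule coprod2_palgebra[OF X(1) Y(1)])
  define p where "p = copair2 X id (zero_map X :: 'y \<Rightarrow> _)"
  define q where "q = copair2 Y (zero_map Y :: 'x \<Rightarrow> _) id"
  note P = copair2[OF X(1) Y(1) X palg_hom_id zero_map_hom[OF X(1)], folded p_def]
  note Q = copair2[OF X(1) Y(1) Y zero_map_hom[OF Y(1)] palg_hom_id, folded q_def]
  note l = coprod2_inl_hom[OF X(1) Y(1)] and r = coprod2_inr_hom[OF X(1) Y(1)]
  have lc: "?l x \<in> carrier ?W" if "x \<in> carrier X" for x by (rule palg_homD(1)[OF l that])
  have rc: "?r x \<in> carrier ?W" if "x \<in> carrier Y" for x by (rule palg_homD(1)[OF r that])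
  define S where "S = {u \<in> carrier ?W. p u = \<zero>\<^bsub>X\<^esub> \<and> q u = \<zero>\<^bsub>Y\<^esub>}"
  have K: "cosmash2 R P X Y = ?W\<lparr>carrier := S\<rparr>"
    unfolding cosmash2_def palg_kernel_def p_def[symmetric] q_def[symmetric] a_kernel_def' palg_prod_def S_def
    by simp
  have kz: "p \<zero>\<^bsub>?W\<^esub> = \<zero>\<^bsub>X\<^esub>" "q \<zero>\<^bsub>?W\<^esub> = \<zero>\<^bsub>Y\<^esub>"
    using palg_hom_zero[OF P(1) W.palgebra_axioms X(1)] palg_hom_zero[OF Q(1) W.palgebra_axioms Y(1)] .
  have kmu: "h (mu ?W as \<theta>) = \<zero>\<^bsub>D\<^esub>"
    if "palgebra R P D" "h \<in> palg_hom R P ?W D" "x \<in> set as" "h x = \<zero>\<^bsub>D\<^esub>" "set as \<subseteq> carrier ?W" "\<theta> \<in> carrier (ops P (length as))"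
    for h D x as \<theta>
  proof -
    have "h (mu ?W as \<theta>) = mu D (map h as) \<theta>"
      using that by (intro palg_homD(4)[OF that(2)]) auto
    also have "\<dots> = \<zero>\<^bsub>D\<^esub>"
      using that palg_homD(1)[OF that(2)] by (intro palgebra.mu_zero[OF that(1)]) force+
    finally show ?thesis .
  qed
  show "palgebra R P (cosmash2 R P X Y)"
    unfolding K
  proof (rule palgebra_sub[OF W.palgebra_axioms])
    fix as \<theta> assume a: "as \<noteq> []" "set as \<subseteq> S" "\<theta> \<in> carrier (ops P (length as))"
    then have "hd as \<in> set as" "hd as \<in> S" by auto
    moreover have "set as \<subseteq> carrier ?W" using a S_def by auto
    ultimately show "mu ?W as \<theta> \<in> S"
      using kmu[OF X(1) P(1), of "hd as" as \<theta>] kmu[OF Y(1) Q(1), of "hd as" as \<theta>] W.mu_closed[of as \<theta>] a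
      unfolding S_def by auto
  qed (auto simp: S_def kz palg_homD[OF P(1)] palg_homD[OF Q(1)])
  show sub: "carrier (cosmash2 R P X Y) \<subseteq> carrier ?W" unfolding K S_def by auto
  have TW: "tensors R P X Y \<subseteq> carrier ?W"
    unfolding tensors_def tensor_def using W.mu_closed[of "[_, _]"] lc rc by (auto simp: numeral_2_eq_2)
  have TS: "tensors R P X Y \<subseteq> S"
  proof
    fix t assume "t \<in> tensors R P X Y"
    then obtain x y \<theta> where t: "t = mu ?W [?l x, ?r y] \<theta>" "x \<in> carrier X" "y \<in> carrier Y" "\<theta> \<in> carrier (ops P (length [?l x, ?r y]))"
      unfolding tensors_def tensor_def by (auto simp: numeral_2_eq_2)
    have c: "set [?l x, ?r y] \<subseteq> carrier ?W" using lc rc t by simp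
    have "p (mu ?W [?l x, ?r y] \<theta>) = \<zero>\<^bsub>X\<^esub>"
      by (rule kmu[OF X(1) P(1) _ _ c t(4), of "?r y"]) (use t P zero_map_apply in auto)
    moreover have "q (mu ?W [?l x, ?r y] \<theta>) = \<zero>\<^bsub>Y\<^esub>"
      by (rule kmu[OF Y(1) Q(1) _ _ c t(4), of "?l x"]) (use t Q zero_map_apply in auto)
    ultimately show "t \<in> S" unfolding S_def t(1) using W.mu_closed[OF _ c t(4)] by simp
  qed
  then show "tensors R P X Y \<subseteq> carrier (cosmash2 R P X Y)" unfolding K by simp
  have pl: "p (?l x) = x" "q (?l x) = \<zero>\<^bsub>Y\<^esub>" if "x \<in> carrier X" for x
    using that P(2) Q(2) by (auto simp: zero_map_apply)
  have pr: "p (?r y) = \<zero>\<^bsub>X\<^esub>" "q (?r y) = y" if "y \<in> carrier Y" for y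
    using that P(3) Q(3) by (auto simp: zero_map_apply)
  have lz: "?l \<zero>\<^bsub>X\<^esub> = \<zero>\<^bsub>?W\<^esub>" and rz: "?r \<zero>\<^bsub>Y\<^esub> = \<zero>\<^bsub>?W\<^esub>"
    using palg_hom_zero[OF l X(1) W.palgebra_axioms] palg_hom_zero[OF r Y(1) W.palgebra_axioms] by auto
  have z0: "\<ominus>\<^bsub>?W\<^esub> \<zero>\<^bsub>?W\<^esub> = \<zero>\<^bsub>?W\<^esub>" by (metis W.M.zero_closed W.M.a_inv_closed W.M.l_neg W.M.r_zero)
  \<comment> \<open>The linear projection onto the kernel. Its components \<open>p\<close> and
    \<open>q\<close> are left inverse to the two inclusions and zero on the opposite ones.
    \<open>E\<close> is compatible with sums and scalars, which suffices for spans.\<close>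
  define E where "E w = w \<oplus>\<^bsub>?W\<^esub> \<ominus>\<^bsub>?W\<^esub> (?l (p w) \<oplus>\<^bsub>?W\<^esub> ?r (q w))" for w
  note hl = palg_hom_lin
  have E: "E \<in> lin_maps R ?W ?W" unfolding E_def[abs_def]
    by (rule lin_maps_sum[OF W.module_A lin_maps_id lin_maps_neg[OF W.module_A lin_maps_sum[OF W.module_A
        lin_maps_comp[OF hl[OF P(1)] hl[OF l]] lin_maps_comp[OF hl[OF Q(1)] hl[OF r]]]]])
  have E0: "E w = w" if "w \<in> S" for w
    using that unfolding E_def S_def by (simp add: lz rz z0)
  let ?G = "?l ` carrier X \<union> ?r ` carrier Y"
  have G: "?G \<subseteq> carrier ?W" using lc rc by auto
  have mono: "E m \<in> aspan ?W (tensors R P X Y)" if m: "m \<in> monomials P ?W ?G" for m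
  proof -
    obtain zs \<theta> where zs: "m = mu ?W zs \<theta>" "zs \<noteq> []" "set zs \<subseteq> ?G" "\<theta> \<in> carrier (ops P (length zs))"
      using m unfolding monomials_def by blast
    have t: "E t \<in> aspan ?W (tensors R P X Y)" if "t \<in> tensors R P X Y" for t
      using that TS E0[of t] W.M.aspan_base[OF that TW] by auto
    \<comment> \<open>A monomial with all entries from one side is the image of an element of X or Y
      and is killed by \<open>E\<close>. A binary mixed monomial is a tensor, possibly after a
      transposition. All longer monomials vanish by two-nilpotency.\<close>
    consider "set zs \<subseteq> ?l ` carrier X" | "set zs \<subseteq> ?r ` carrier Y"
      | x y where "x \<in> carrier X" "y \<in> carrier Y" "zs = [?l x, ?r y]"
      | x y where "x \<in> carrier X" "y \<in> carrier Y" "zs = [?r y, ?l x]" | "3 \<le> length zs"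
      using zs(2,3) by (cases zs; cases "tl zs"; cases "tl (tl zs)") auto
    then show ?thesis
    proof cases
      case 1
      obtain xs where xs: "zs = map ?l xs" "set xs \<subseteq> carrier X"
        using subset_image_list[OF 1] by metis
      then have "m = ?l (mu X xs \<theta>)" "mu X xs \<theta> \<in> carrier X"
        using palg_homD(4)[OF l, of xs \<theta>] X.mu_closed[of xs \<theta>] zs by auto
      then have "E m = \<zero>\<^bsub>?W\<^esub>" unfolding E_def by (simp add: pl rz lc W.M.r_neg)
      then show ?thesis by (simp add: aspan_zero)
    next
      case 2
      obtain ys where ys: "zs = map ?r ys" "set ys \<subseteq> carrier Y"
        using subset_image_list[OF 2] by metis
      then have "m = ?r (mu Y ys \<theta>)" "mu Y ys \<theta> \<in> carrier Y"
        using palg_homD(4)[OF r, of ys \<theta>] Y.mu_closed[of ys \<theta>] zs by auto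
      then have "E m = \<zero>\<^bsub>?W\<^esub>" unfolding E_def by (simp add: pr lz rc W.M.r_neg)
      then show ?thesis by (simp add: aspan_zero)
    next
      case (3 x y)
      then show ?thesis
        using zs by (intro t) (auto simp: tensors_def tensor_def numeral_2_eq_2)
    next
      case (4 x y)
      then have th: "\<theta> \<in> carrier (ops P 2)" using zs by (simp add: numeral_2_eq_2)
      have "m = tensor R P X Y x y (operm P 2 swap2 \<theta>)"
        unfolding tensor_def using W.mu_swap2[OF lc rc th] 4 zs(1) by simp
      then show ?thesis using 4 X.swap2_closed[OF th] by (intro t) (auto simp: tensors_def)
    next
      case 5
      then have "m = \<zero>\<^bsub>?W\<^esub>"
        using products_vanishD[OF coprod2_products_vanish[OF X(1) Y(1)] 5] zs G by auto
      then show ?thesis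
        using lin_maps_zero[OF E W.group_A W.group_A] aspan_zero[of ?W] by simp
    qed
  qed
  have Sg: "S \<subseteq> aspan ?W (tensors R P X Y)"
  proof
    fix w assume w: "w \<in> S"
    have "E w \<in> aspan ?W (aspan ?W (tensors R P X Y))"
      by (rule aspan_map[OF E W.group_A W.group_A W.monomials_closed[OF G]])
        (use mono W.generated_aspan_monomials[OF G] coprod2_generated[OF X(1) Y(1)] w S_def in auto)
    then show "w \<in> aspan ?W (tensors R P X Y)" using W.M.aspan_aspan[OF TW] E0[OF w] by simp
  qed
  moreover have "aspan ?W (tensors R P X Y) \<subseteq> S"
  proof
    fix t assume "t \<in> aspan ?W (tensors R P X Y)"
    then show "t \<in> S"
      by induction (use TS in \<open>auto simp: S_def kz palg_homD[OF P(1)] palg_homD[OF Q(1)]\<close>)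
  qed
  ultimately show "carrier (cosmash2 R P X Y) = aspan (cosmash2 R P X Y) (tensors R P X Y)"
    unfolding K aspan_carrier_update by simp
  show "products_vanish P (cosmash2 R P X Y) 2"
  proof (rule products_vanishI)
    fix zs \<theta> assume zs: "2 \<le> length zs" "set zs \<subseteq> carrier (cosmash2 R P X Y)" "\<theta> \<in> carrier (ops P (length zs))"
    have "mu ?W zs \<theta> = \<zero>\<^bsub>?W\<^esub>"
    proof (rule W.mu_aspan_induct[OF TW, of zs])
      show "set zs \<subseteq> aspan ?W (tensors R P X Y)" using zs(2) Sg unfolding K by auto
      fix ys assume ys: "set ys \<subseteq> tensors R P X Y" "length ys = length zs"
      then obtain y y' us where y: "ys = y # y' # us" using zs(1) by (metis Suc_le_length_iff numeral_2_eq_2)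
      \<comment> \<open>A tensor is itself a product of two factors. Placed beside at least one
        further argument it yields a product of at least 2 + 1 = 3 factors, which is zero.\<close>
      have "y \<in> products P ?W 2"
        using ys y lc rc unfolding tensors_def tensor_def by (auto intro!: productsI simp: numeral_2_eq_2)
      then have "mu ?W ([] @ y # y' # us) \<theta> \<in> products P ?W (2 + length ([] :: ('r, 'p, 'x, 'y) coprod2 list) + length (y' # us))"
        using ys y zs TW by (intro W.mu_product_slot) auto
      then have "mu ?W ys \<theta> \<in> products P ?W 3"
        unfolding y products_def by fastforce
      then show "mu ?W ys \<theta> = \<zero>\<^bsub>?W\<^esub>"
        using coprod2_products_vanish[OF X(1) Y(1)] unfolding products_vanish_def by blast
    qed (use zs in auto)
    then show "mu (cosmash2 R P X Y) zs \<theta> = \<zero>\<^bsub>cosmash2 R P X Y\<^esub>" unfolding K by simp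
  qed
qed

section \<open>The universal property of the cosmash product\<close>

text \<open>The inverse of the isomorphism from R to P(1). It is given by a description because
  \<open>unary_ops_are_scalars\<close> asserts an isomorphism without naming one, and r maps to r
  times the identity under any of them.\<close>

definition op_scalar :: "('r, 'm) ring_scheme \<Rightarrow> ('r, 'p) operad \<Rightarrow> 'p \<Rightarrow> 'r"
  where "op_scalar R P \<theta> = (THE r. r \<in> carrier R \<and> r \<odot>\<^bsub>ops P 1\<^esub> opid P = \<theta>)"

section \<open>Unary operations as scalars\<close>

context operad
begin

lemma unary_scalars:
  assumes U: "unary_ops_are_scalars R P"
  shows op_scalar_closed: "\<theta> \<in> carrier (ops P 1) \<Longrightarrow> op_scalar R P \<theta> \<in> carrier R"
    and op_scalar_smult: "\<theta> \<in> carrier (ops P 1) \<Longrightarrow> op_scalar R P \<theta> \<odot>\<^bsub>ops P 1\<^esub> opid P = \<theta>"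
    and op_scalar_eqI: "\<lbrakk>r \<in> carrier R; r \<odot>\<^bsub>ops P 1\<^esub> opid P = \<theta>\<rbrakk> \<Longrightarrow> op_scalar R P \<theta> = r"
proof -
  obtain \<phi> where \<phi>: "bij_betw \<phi> (carrier R) (carrier (ops P 1))"
    "\<And>r s. \<lbrakk>r \<in> carrier R; s \<in> carrier R\<rbrakk> \<Longrightarrow> \<phi> (r \<otimes>\<^bsub>R\<^esub> s) = r \<odot>\<^bsub>ops P 1\<^esub> \<phi> s" "\<phi> \<one>\<^bsub>R\<^esub> = opid P"
    using U unfolding unary_ops_are_scalars_def by blast
  \<comment> \<open>Linearity and preservation of the unit determine \<phi>; the first uses that r
    is r times one.\<close>
  have \<phi>r: "\<phi> r = r \<odot>\<^bsub>ops P 1\<^esub> opid P" if "r \<in> carrier R" for r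
    using \<phi>(2)[of r "\<one>\<^bsub>R\<^esub>"] \<phi>(3) that by simp
  have ex: "\<exists>!r. r \<in> carrier R \<and> r \<odot>\<^bsub>ops P 1\<^esub> opid P = \<theta>" if "\<theta> \<in> carrier (ops P 1)" for \<theta>
    using \<phi>(1) that \<phi>r unfolding bij_betw_def inj_on_def by (metis image_iff)
  show "\<theta> \<in> carrier (ops P 1) \<Longrightarrow> op_scalar R P \<theta> \<in> carrier R"
    "\<theta> \<in> carrier (ops P 1) \<Longrightarrow> op_scalar R P \<theta> \<odot>\<^bsub>ops P 1\<^esub> opid P = \<theta>"
    using theI'[OF ex] unfolding op_scalar_def by auto
  show "op_scalar R P \<theta> = r" if "r \<in> carrier R" "r \<odot>\<^bsub>ops P 1\<^esub> opid P = \<theta>"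
  proof -
    have "\<theta> \<in> carrier (ops P 1)" using that \<phi>r \<phi>(1) bij_betw_apply by metis
    then show ?thesis unfolding op_scalar_def using the1_equality[OF ex] that by blast
  qed
qed

lemma op_scalar_linear:
  assumes U: "unary_ops_are_scalars R P" and "\<theta> \<in> carrier (ops P 1)"
  shows "\<theta>' \<in> carrier (ops P 1) \<Longrightarrow>
      op_scalar R P (\<theta> \<oplus>\<^bsub>ops P 1\<^esub> \<theta>') = op_scalar R P \<theta> \<oplus>\<^bsub>R\<^esub> op_scalar R P \<theta>'"
    and "r \<in> carrier R \<Longrightarrow> op_scalar R P (r \<odot>\<^bsub>ops P 1\<^esub> \<theta>) = r \<otimes>\<^bsub>R\<^esub> op_scalar R P \<theta>"
    and "op_scalar R P (opid P) = \<one>\<^bsub>R\<^esub>"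
proof -
  interpret O: module R "ops P 1" by (rule ops_module) simp
  note u = unary_scalars[OF U]
  show "\<theta>' \<in> carrier (ops P 1) \<Longrightarrow>
      op_scalar R P (\<theta> \<oplus>\<^bsub>ops P 1\<^esub> \<theta>') = op_scalar R P \<theta> \<oplus>\<^bsub>R\<^esub> op_scalar R P \<theta>'"
    using u(1)[OF assms(2)] u(2)[OF assms(2)] u(1)[of \<theta>'] u(2)[of \<theta>']
    by (intro u(3)) (simp_all only: O.smult_l_distr opid_closed R.a_closed)
  show "r \<in> carrier R \<Longrightarrow> op_scalar R P (r \<odot>\<^bsub>ops P 1\<^esub> \<theta>) = r \<otimes>\<^bsub>R\<^esub> op_scalar R P \<theta>"
    using u(1)[OF assms(2)] u(2)[OF assms(2)]
    by (intro u(3)) (simp_all only: O.smult_assoc1 opid_closed R.m_closed)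
  show "op_scalar R P (opid P) = \<one>\<^bsub>R\<^esub>"
    by (intro u(3)) (simp_all only: O.smult_one opid_closed R.one_closed)
qed

text \<open>This and the next lemma treat composites with scalars in the outer and in the inner
  position, the two places where unary operations enter the composition law of the extension algebra
  below.\<close>

lemma opcomp_unary:
  assumes U: "unary_ops_are_scalars R P" and k: "1 \<le> k" and "\<eta> \<in> carrier (ops P k)" "\<theta> \<in> carrier (ops P 1)"
  shows "opcomp P [k] [\<eta>] \<theta> = op_scalar R P \<theta> \<odot>\<^bsub>ops P k\<^esub> \<eta>"
proof -
  note u = unary_scalars[OF U]
  have "opcomp P [k] [\<eta>] (op_scalar R P \<theta> \<odot>\<^bsub>ops P 1\<^esub> opid P) = op_scalar R P \<theta> \<odot>\<^bsub>ops P k\<^esub> opcomp P [k] [\<eta>] (opid P)"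
    using lin_mapsD(3)[OF comp_linear[of "[k]" "[\<eta>]"], of "op_scalar R P \<theta>" "opid P"] u(1)[OF assms(4)] k assms(3) opid_closed
    by (simp add: arity_list_def opseqs_def)
  then show ?thesis using u(2)[OF assms(4)] comp_id_right[OF k assms(3)] by simp
qed

lemma opcomp_unary_pair:
  assumes U: "unary_ops_are_scalars R P"
    and \<eta>: "\<eta> \<in> carrier (ops P 1)" "\<eta>' \<in> carrier (ops P 1)" and \<theta>: "\<theta> \<in> carrier (ops P 2)"
  shows "opcomp P [1, 1] [\<eta>, \<eta>'] \<theta> = op_scalar R P \<eta> \<odot>\<^bsub>ops P 2\<^esub> (op_scalar R P \<eta>' \<odot>\<^bsub>ops P 2\<^esub> \<theta>)"
proof -
  note u = unary_scalars[OF U]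
  have ml: "multilinear R [ops P 1, ops P 1] (ops P 2) (\<lambda>\<theta>s. opcomp P [1, 1] \<theta>s \<theta>)"
    using comp_multilinear[of "[1, 1]" \<theta>] \<theta> by (simp add: arity_list_def numeral_2_eq_2)
  have 1: "(\<lambda>x. opcomp P [1, 1] [x, \<eta>'] \<theta>) \<in> lin_maps R (ops P 1) (ops P 2)"
    using ml[unfolded multilinear_def, rule_format, of "[\<eta>, \<eta>']" 0] \<eta> by (simp add: less_2_cases_iff nth_Cons')
  have 2: "(\<lambda>x. opcomp P [1, 1] [opid P, x] \<theta>) \<in> lin_maps R (ops P 1) (ops P 2)"
    using ml[unfolded multilinear_def, rule_format, of "[opid P, \<eta>']" 1] opid_closed by (simp add: less_2_cases_iff nth_Cons')
  have 3: "opcomp P [1, 1] [opid P, opid P] \<theta> = \<theta>"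
    using comp_id_left[of 2 \<theta>] \<theta> by (simp add: numeral_2_eq_2)
  have "opcomp P [1, 1] [\<eta>, \<eta>'] \<theta> = op_scalar R P \<eta> \<odot>\<^bsub>ops P 2\<^esub> opcomp P [1, 1] [opid P, \<eta>'] \<theta>"
    using lin_mapsD(3)[OF 1, of "op_scalar R P \<eta>" "opid P"] u(1,2)[OF \<eta>(1)] opid_closed by simp
  also have "opcomp P [1, 1] [opid P, \<eta>'] \<theta> = op_scalar R P \<eta>' \<odot>\<^bsub>ops P 2\<^esub> \<theta>"
    using lin_mapsD(3)[OF 2, of "op_scalar R P \<eta>'" "opid P"] u(1,2)[OF \<eta>(2)] opid_closed 3 by simp
  finally show ?thesis .
qed

end

lemma (in palgebra) mu_unary:
  assumes U: "unary_ops_are_scalars R P" and "a \<in> carrier A" "\<theta> \<in> carrier (ops P 1)"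
  shows "mu A [a] \<theta> = op_scalar R P \<theta> \<odot>\<^bsub>A\<^esub> a"
proof -
  have "mu A [a] (op_scalar R P \<theta> \<odot>\<^bsub>ops P 1\<^esub> opid P) = op_scalar R P \<theta> \<odot>\<^bsub>A\<^esub> mu A [a] (opid P)"
    using mu_smult_op[of "[a]" "opid P" "op_scalar R P \<theta>"] assms(2) opid_closed unary_scalars(1)[OF U assms(3)] by simp
  then show ?thesis using unary_scalars(2)[OF U assms(3)] mu_opid assms(2) by simp
qed

text \<open>The linear maps to M from the tensor product of P(2) with X and Y modulo their products
  of two or more factors, written on representatives and as functions of three arguments. The target
  M is a bare module.\<close>

locale bilinear_op = X: palgebra R P X + Y: palgebra R P Y + M: module R M
  for R :: "('r, 'm) ring_scheme" and P :: "('r, 'p) operad"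
    and X :: "('r, 'p, 'x) palg" and Y :: "('r, 'p, 'y) palg" and M :: "('r, 'z, 'k) module_scheme"
    and \<beta> :: "'x \<Rightarrow> 'y \<Rightarrow> 'p \<Rightarrow> 'z" +
  assumes lin1: "\<lbrakk>y \<in> carrier Y; \<theta> \<in> carrier (ops P 2)\<rbrakk> \<Longrightarrow> (\<lambda>x. \<beta> x y \<theta>) \<in> lin_maps R X M"
    and lin2: "\<lbrakk>x \<in> carrier X; \<theta> \<in> carrier (ops P 2)\<rbrakk> \<Longrightarrow> (\<lambda>y. \<beta> x y \<theta>) \<in> lin_maps R Y M"
    and lin3: "\<lbrakk>x \<in> carrier X; y \<in> carrier Y\<rbrakk> \<Longrightarrow> (\<lambda>\<theta>. \<beta> x y \<theta>) \<in> lin_maps R (ops P 2) M"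
    and decomposable1: "\<lbrakk>2 \<le> length xs; set xs \<subseteq> carrier X; \<eta> \<in> carrier (ops P (length xs)); y \<in> carrier Y;
      \<theta> \<in> carrier (ops P 2)\<rbrakk> \<Longrightarrow> \<beta> (mu X xs \<eta>) y \<theta> = \<zero>\<^bsub>M\<^esub>"
    and decomposable2: "\<lbrakk>2 \<le> length ys; set ys \<subseteq> carrier Y; \<eta> \<in> carrier (ops P (length ys)); x \<in> carrier X;
      \<theta> \<in> carrier (ops P 2)\<rbrakk> \<Longrightarrow> \<beta> x (mu Y ys \<eta>) \<theta> = \<zero>\<^bsub>M\<^esub>"
begin

text \<open>The unary case is the given module structure on \<open>M\<close>; the second summand of the binary
  case is forced by equivariance.\<close>

definition ext_mu :: "('x \<times> 'y \<times> 'z) list \<Rightarrow> 'p \<Rightarrow> 'z"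
  where "ext_mu us \<theta> = (case us of
      [u] \<Rightarrow> op_scalar R P \<theta> \<odot>\<^bsub>M\<^esub> snd (snd u)
    | [u, v] \<Rightarrow> \<beta> (fst u) (fst (snd v)) \<theta> \<oplus>\<^bsub>M\<^esub> \<beta> (fst v) (fst (snd u)) (operm P 2 swap2 \<theta>)
    | _ \<Rightarrow> \<zero>\<^bsub>M\<^esub>)"

text \<open>A central extension of the product of X and Y by M with cocycle \<beta>: the third
  coordinate of an argument enters unary operations only, and operations of arity at least three
  take the value zero there.\<close>

definition ext :: "('r, 'p, 'x \<times> 'y \<times> 'z) palg"
  where "ext =
    \<lparr>carrier = carrier X \<times> carrier Y \<times> carrier M,
     monoid.mult = (\<lambda>_ _. undefined), monoid.one = undefined,
     zero = (\<zero>\<^bsub>X\<^esub>, \<zero>\<^bsub>Y\<^esub>, \<zero>\<^bsub>M\<^esub>),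
     add = (\<lambda>u v. (fst u \<oplus>\<^bsub>X\<^esub> fst v, fst (snd u) \<oplus>\<^bsub>Y\<^esub> fst (snd v), snd (snd u) \<oplus>\<^bsub>M\<^esub> snd (snd v))),
     smult = (\<lambda>r u. (r \<odot>\<^bsub>X\<^esub> fst u, r \<odot>\<^bsub>Y\<^esub> fst (snd u), r \<odot>\<^bsub>M\<^esub> snd (snd u))),
     mu = (\<lambda>us \<theta>. (mu X (map fst us) \<theta>, mu Y (map (\<lambda>u. fst (snd u)) us) \<theta>, ext_mu us \<theta>))\<rparr>"

lemma ext_mu_simps:
  "ext_mu [u] \<theta> = op_scalar R P \<theta> \<odot>\<^bsub>M\<^esub> snd (snd u)"
  "ext_mu [u, v] \<theta> = \<beta> (fst u) (fst (snd v)) \<theta> \<oplus>\<^bsub>M\<^esub> \<beta> (fst v) (fst (snd u)) (operm P 2 swap2 \<theta>)"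
  "3 \<le> length us \<Longrightarrow> ext_mu us \<theta> = \<zero>\<^bsub>M\<^esub>"
  unfolding ext_mu_def by (auto split: list.splits)

lemma ext_simps:
  "carrier ext = carrier X \<times> carrier Y \<times> carrier M"
  "\<zero>\<^bsub>ext\<^esub> = (\<zero>\<^bsub>X\<^esub>, \<zero>\<^bsub>Y\<^esub>, \<zero>\<^bsub>M\<^esub>)"
  "u \<oplus>\<^bsub>ext\<^esub> v = (fst u \<oplus>\<^bsub>X\<^esub> fst v, fst (snd u) \<oplus>\<^bsub>Y\<^esub> fst (snd v), snd (snd u) \<oplus>\<^bsub>M\<^esub> snd (snd v))"
  "r \<odot>\<^bsub>ext\<^esub> u = (r \<odot>\<^bsub>X\<^esub> fst u, r \<odot>\<^bsub>Y\<^esub> fst (snd u), r \<odot>\<^bsub>M\<^esub> snd (snd u))"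
  "mu ext us \<theta> = (mu X (map fst us) \<theta>, mu Y (map (\<lambda>u. fst (snd u)) us) \<theta>, ext_mu us \<theta>)"
  by (simp_all add: ext_def)

lemma op_closed:
  "\<lbrakk>x \<in> carrier X; y \<in> carrier Y; \<theta> \<in> carrier (ops P 2)\<rbrakk> \<Longrightarrow> \<beta> x y \<theta> \<in> carrier M"
  using lin_mapsD(1)[OF lin1] by blast

lemma op_add:
  "\<lbrakk>x \<in> carrier X; x' \<in> carrier X; y \<in> carrier Y; \<theta> \<in> carrier (ops P 2)\<rbrakk>
    \<Longrightarrow> \<beta> (x \<oplus>\<^bsub>X\<^esub> x') y \<theta> = \<beta> x y \<theta> \<oplus>\<^bsub>M\<^esub> \<beta> x' y \<theta>"
  "\<lbrakk>x \<in> carrier X; y \<in> carrier Y; y' \<in> carrier Y; \<theta> \<in> carrier (ops P 2)\<rbrakk>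
    \<Longrightarrow> \<beta> x (y \<oplus>\<^bsub>Y\<^esub> y') \<theta> = \<beta> x y \<theta> \<oplus>\<^bsub>M\<^esub> \<beta> x y' \<theta>"
  "\<lbrakk>x \<in> carrier X; y \<in> carrier Y; \<theta> \<in> carrier (ops P 2); \<theta>' \<in> carrier (ops P 2)\<rbrakk>
    \<Longrightarrow> \<beta> x y (\<theta> \<oplus>\<^bsub>ops P 2\<^esub> \<theta>') = \<beta> x y \<theta> \<oplus>\<^bsub>M\<^esub> \<beta> x y \<theta>'"
  by (rule lin_mapsD(2)[OF lin1], assumption+, rule lin_mapsD(2)[OF lin2], assumption+,
      rule lin_mapsD(2)[OF lin3])

lemma op_smult:
  "\<lbrakk>r \<in> carrier R; x \<in> carrier X; y \<in> carrier Y; \<theta> \<in> carrier (ops P 2)\<rbrakk>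
    \<Longrightarrow> \<beta> (r \<odot>\<^bsub>X\<^esub> x) y \<theta> = r \<odot>\<^bsub>M\<^esub> \<beta> x y \<theta>"
  "\<lbrakk>r \<in> carrier R; x \<in> carrier X; y \<in> carrier Y; \<theta> \<in> carrier (ops P 2)\<rbrakk>
    \<Longrightarrow> \<beta> x (r \<odot>\<^bsub>Y\<^esub> y) \<theta> = r \<odot>\<^bsub>M\<^esub> \<beta> x y \<theta>"
  "\<lbrakk>r \<in> carrier R; x \<in> carrier X; y \<in> carrier Y; \<theta> \<in> carrier (ops P 2)\<rbrakk>
    \<Longrightarrow> \<beta> x y (r \<odot>\<^bsub>ops P 2\<^esub> \<theta>) = r \<odot>\<^bsub>M\<^esub> \<beta> x y \<theta>"
  by (rule lin_mapsD(3)[OF lin1], assumption+, rule lin_mapsD(3)[OF lin2], assumption+,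
      rule lin_mapsD(3)[OF lin3])

lemma op_zero:
  "\<lbrakk>y \<in> carrier Y; \<theta> \<in> carrier (ops P 2)\<rbrakk> \<Longrightarrow> \<beta> \<zero>\<^bsub>X\<^esub> y \<theta> = \<zero>\<^bsub>M\<^esub>"
  "\<lbrakk>x \<in> carrier X; \<theta> \<in> carrier (ops P 2)\<rbrakk> \<Longrightarrow> \<beta> x \<zero>\<^bsub>Y\<^esub> \<theta> = \<zero>\<^bsub>M\<^esub>"
  using lin_maps_zero[OF lin1 X.group_A] lin_maps_zero[OF lin2 Y.group_A] module.axioms(2)[OF M.module_axioms] by blast+

lemmas op_simps = op_closed op_add op_smult

lemma ext_module: "module R ext"
proof (rule moduleI)
  show "cring R" by (rule X.R.is_cring)
  show "abelian_group ext"
  proof (rule abelian_groupI)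
    fix u assume "u \<in> carrier ext"
    then show "\<exists>v\<in>carrier ext. v \<oplus>\<^bsub>ext\<^esub> u = \<zero>\<^bsub>ext\<^esub>"
      by (intro bexI[of _ "(\<ominus>\<^bsub>X\<^esub> fst u, \<ominus>\<^bsub>Y\<^esub> fst (snd u), \<ominus>\<^bsub>M\<^esub> snd (snd u))"])
        (auto simp: ext_simps X.M.l_neg Y.M.l_neg M.M.l_neg)
  qed (auto simp: ext_simps X.M.a_ac Y.M.a_ac M.M.a_ac)
qed (auto simp: ext_simps X.A.smult_l_distr Y.A.smult_l_distr M.smult_l_distr
    X.A.smult_r_distr Y.A.smult_r_distr M.smult_r_distr X.A.smult_assoc1 Y.A.smult_assoc1 M.smult_assoc1)

text \<open>In the first two coordinates the laws are those of X and Y. In the third, linearity and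
  equivariance are read off arity by arity, and the composition law holds because \<beta> kills
  decomposable arguments exactly where the flattened operation has arity three or more.\<close>

lemma ext_palgebra:
  assumes U: "unary_ops_are_scalars R P"
  shows "palgebra R P ext"
proof (rule palgebraI)
  note u = X.unary_scalars[OF U] and ul = X.op_scalar_linear[OF U]
  have ne3: "3 \<le> length us" if "us \<noteq> []" "\<And>a. us \<noteq> [a]" "\<And>a b. us \<noteq> [a, b]" for us :: "'u list"
    using that by (cases us; cases "tl us"; cases "tl (tl us)") auto
  have car: "set (map fst us) \<subseteq> carrier X" "set (map (\<lambda>u. fst (snd u)) us) \<subseteq> carrier Y"
    if "set us \<subseteq> carrier ext" for us
    using that by (fastforce simp: ext_simps)+
  have carm: "fst v \<in> carrier X" "fst (snd v) \<in> carrier Y" "snd (snd v) \<in> carrier M"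
    if "v \<in> carrier ext" for v
    using that by (auto simp: ext_simps)
  note sw = X.swap2_closed
  show "operad R P" by (rule X.operad_axioms)
  show "module R ext" by (rule ext_module)
  have proj: "fst \<in> lin_maps R ext X" "(\<lambda>u. fst (snd u)) \<in> lin_maps R ext Y" "(\<lambda>u. snd (snd u)) \<in> lin_maps R ext M"
    by (auto intro!: lin_mapsI simp: ext_simps)
  have into_ext: "f \<in> lin_maps R N ext"
    if "(\<lambda>x. fst (f x)) \<in> lin_maps R N X" "(\<lambda>x. fst (snd (f x))) \<in> lin_maps R N Y"
      "(\<lambda>x. snd (snd (f x))) \<in> lin_maps R N M"
    for f and N :: "('r, 'v, 'l) module_scheme"
    by (rule lin_mapsI)
      (auto simp: ext_simps prod_eq_iff lin_mapsD[OF that(1)] lin_mapsD[OF that(2)] lin_mapsD[OF that(3)] mem_Times_iff)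
  note MM = M.module_axioms
  show "(\<lambda>x. mu ext (xs @ x # ys) \<theta>) \<in> lin_maps R ext ext"
    if a: "set xs \<subseteq> carrier ext" "set ys \<subseteq> carrier ext" "\<theta> \<in> carrier (ops P (Suc (length xs + length ys)))"
    for xs ys \<theta>
  proof (rule into_ext)
    consider "xs = []" "ys = []" | v where "xs = []" "ys = [v]" | v where "xs = [v]" "ys = []"
      | "2 \<le> length xs + length ys"
      by (cases xs; cases ys; cases "tl xs"; cases "tl ys") auto
    then have "(\<lambda>x. ext_mu (xs @ x # ys) \<theta>) \<in> lin_maps R ext M"
    proof cases
      case 4
      then show ?thesis by (simp add: ext_mu_simps lin_maps_const_zero[OF MM])
    qed (use a in \<open>auto simp: ext_mu_simps ext_simps(1) numeral_2_eq_2[symmetric] intro!: lin_maps_scale[OF MM proj(3)]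
        lin_maps_sum[OF MM] lin_maps_comp[OF proj(1) lin1] lin_maps_comp[OF proj(2) lin2] u(1) sw\<close>)
    then show "(\<lambda>x. snd (snd (mu ext (xs @ x # ys) \<theta>))) \<in> lin_maps R ext M" by (simp add: ext_simps)
    show "(\<lambda>x. fst (mu ext (xs @ x # ys) \<theta>)) \<in> lin_maps R ext X"
      using lin_maps_comp[OF proj(1) X.mu_lin_slot[OF car(1)[OF a(1)] car(1)[OF a(2)]]] a(3) by (simp add: ext_simps)
    show "(\<lambda>x. fst (snd (mu ext (xs @ x # ys) \<theta>))) \<in> lin_maps R ext Y"
      using lin_maps_comp[OF proj(2) Y.mu_lin_slot[OF car(2)[OF a(1)] car(2)[OF a(2)]]] a(3) by (simp add: ext_simps)
  qed
  have swl: "operm P 2 swap2 \<in> lin_maps R (ops P 2) (ops P 2)"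
    by (rule X.perm_linear[OF _ swap2_permutes]) simp
  have ext_mu_lin: "ext_mu us \<in> lin_maps R (ops P (length us)) M" if a: "us \<noteq> []" "set us \<subseteq> carrier ext" for us
  proof -
    consider v where "us = [v]" | v w where "us = [v, w]" | "3 \<le> length us" using ne3 a(1) by metis
    then show ?thesis
    proof cases
      case (1 v)
      then show ?thesis
        using a carm(3)[of v] by (intro lin_mapsI)
          (auto simp: ext_mu_simps u(1) ul(1,2)[unfolded One_nat_def] M.smult_l_distr M.smult_assoc1)
    next
      case (2 v w)
      then have "ext_mu us = (\<lambda>\<theta>. \<beta> (fst v) (fst (snd w)) \<theta> \<oplus>\<^bsub>M\<^esub> \<beta> (fst w) (fst (snd v)) (operm P 2 swap2 \<theta>))"
        by (simp add: fun_eq_iff ext_mu_simps)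
      then show ?thesis
        using a 2 lin_maps_sum[OF MM lin3[of "fst v" "fst (snd w)"] lin_maps_comp[OF swl lin3[of "fst w" "fst (snd v)"]]]
        by (simp add: carm numeral_2_eq_2[symmetric])
    next
      case 3
      then have "ext_mu us = (\<lambda>\<theta>. \<zero>\<^bsub>M\<^esub>)" by (simp add: fun_eq_iff ext_mu_simps)
      then show ?thesis by (simp add: lin_maps_const_zero[OF MM])
    qed
  qed
  show "mu ext us \<in> lin_maps R (ops P (length us)) ext" if a: "us \<noteq> []" "set us \<subseteq> carrier ext" for us
    using X.mu_linear[OF _ car(1)[OF a(2)]] Y.mu_linear[OF _ car(2)[OF a(2)]] ext_mu_lin[OF a] a(1)
    by (intro into_ext) (simp_all add: ext_simps)
  show "mu ext [v] (opid P) = v" if "v \<in> carrier ext" for v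
    using carm[OF that] by (simp add: ext_simps ext_mu_simps X.mu_opid Y.mu_opid ul(3)[OF X.opid_closed])
  show "mu ext us (operm P (length us) t \<theta>) = mu ext (permute_list t us) \<theta>"
    if a: "us \<noteq> []" "set us \<subseteq> carrier ext" "t permutes {..<length us}" "\<theta> \<in> carrier (ops P (length us))"
    for us t \<theta>
  proof -
    consider v where "us = [v]" | v w where "us = [v, w]" | "3 \<le> length us" using ne3 a(1) by metis
    then have "ext_mu us (operm P (length us) t \<theta>) = ext_mu (permute_list t us) \<theta>"
    proof cases
      case (1 v)
      then have "t permutes {0}" using a(3) by (simp add: lessThan_Suc)
      then have "t = id" by (simp add: permutes_sing)
      then show ?thesis using a 1 X.perm_id[of 1 \<theta>] by (simp add: permute_list_id)
    next
      case (2 v w)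
      then have "t = id \<or> t = swap2" using a(3) permutes2_cases by (simp add: numeral_2_eq_2)
      then show ?thesis
      proof
        assume "t = id"
        then show ?thesis using a 2 X.perm_id[of 2 \<theta>] by (simp add: permute_list_id numeral_2_eq_2)
      next
        \<comment> \<open>The transposition is an involution, so it exchanges the two summands of
          the binary operation.\<close>
        assume t: "t = swap2"
        have th: "\<theta> \<in> carrier (ops P 2)" using a 2 by (simp add: numeral_2_eq_2)
        have "length us = 2" using 2 by simp
        then show ?thesis using a(2) 2 X.swap2_involutory[OF th] sw th
          by (simp add: t permute_list_swap2 ext_mu_simps carm op_closed M.M.a_comm numeral_2_eq_2[symmetric])
      qed
    qed (simp add: ext_mu_simps)
    then show ?thesis
      using X.mu_perm[of "map fst us" t \<theta>] Y.mu_perm[of "map (\<lambda>u. fst (snd u)) us" t \<theta>] car[OF a(2)] a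
      by (simp add: ext_simps permute_list_map)
  qed
  show "mu ext (concat uss) (opcomp P ks \<theta>s \<theta>) = mu ext (map2 (mu ext) uss \<theta>s) \<theta>"
    if a: "arity_list ks" "\<theta>s \<in> opseqs P ks" "\<theta> \<in> carrier (ops P (length ks))"
        "map length uss = ks" "\<forall>us\<in>set uss. set us \<subseteq> carrier ext"
    for ks \<theta>s \<theta> uss
  proof -
    have lt: "length uss = length \<theta>s" using a(2,4) unfolding opseqs_def by (auto dest: list_all2_lengthD)
    have thn: "\<theta>s ! i \<in> carrier (ops P (length (uss ! i)))" if "i < length uss" for i
      using a(2,4) that unfolding opseqs_def by (auto simp: list_all2_conv_all_nth)
    have ne: "us \<noteq> []" if "us \<in> set uss" for us using a(1,4) that unfolding arity_list_def by auto
    have une: "uss \<noteq> []" using a(1,4) unfolding arity_list_def by auto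
    \<comment> \<open>By the arity of the outer operation. Arity one is linearity. In arity two,
      either both inner operations are scalars, or one inner arity is at least two: then the
      flattened arity is at least three, and on the other side both summands contain a decomposable
      argument. From arity three on, both sides are zero.\<close>
    have cc: "ext_mu (concat uss) (opcomp P ks \<theta>s \<theta>) = ext_mu (map2 (mu ext) uss \<theta>s) \<theta>"
    proof -
      have len: "length us \<le> length (concat us)" if "\<forall>u\<in>set us. u \<noteq> []" for us :: "('x \<times> 'y \<times> 'z) list list"
        using that
      proof (induction us)
        case (Cons u us)
        then have "1 \<le> length u" by (cases u) auto
        then show ?case using Cons by simp
      qed simp
      consider us where "uss = [us]" | us us' where "uss = [us, us']" | "3 \<le> length uss" using ne3 une by metis
      then show ?thesis
      proof cases
        case (1 us)
        obtain \<eta> where \<eta>: "\<theta>s = [\<eta>]" "\<eta> \<in> carrier (ops P (length us))"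
          using lt thn[of 0] 1 by (cases \<theta>s) auto
        have th: "\<theta> \<in> carrier (ops P 1)" using a(3,4) 1 by auto
        have k: "1 \<le> length us" using ne[of us] 1 by (cases us) auto
        have oc: "opcomp P ks \<theta>s \<theta> = op_scalar R P \<theta> \<odot>\<^bsub>ops P (length us)\<^esub> \<eta>"
          using X.opcomp_unary[OF U k \<eta>(2) th] a(4) 1 \<eta> by auto
        have usc: "set us \<subseteq> carrier ext" using a(5) 1 by simp
        have "ext_mu us (op_scalar R P \<theta> \<odot>\<^bsub>ops P (length us)\<^esub> \<eta>) = op_scalar R P \<theta> \<odot>\<^bsub>M\<^esub> ext_mu us \<eta>"
          using lin_mapsD(3)[OF ext_mu_lin[OF _ usc]] ne[of us] 1 u(1)[OF th] \<eta>(2) by simp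
        then show ?thesis using 1 \<eta> oc by (simp add: ext_mu_simps ext_simps(5))
      next
        case (2 us us')
        obtain \<eta> \<eta>' where \<eta>: "\<theta>s = [\<eta>, \<eta>']" "\<eta> \<in> carrier (ops P (length us))" "\<eta>' \<in> carrier (ops P (length us'))"
          using lt thn[of 0] thn[of 1] 2 by (cases \<theta>s; cases "tl \<theta>s") auto
        have th: "\<theta> \<in> carrier (ops P 2)" using a(3,4) 2 by (auto simp: numeral_2_eq_2)
        have usc: "set us \<subseteq> carrier ext" "set us' \<subseteq> carrier ext" using a(5) 2 by auto
        have usn: "us \<noteq> []" "us' \<noteq> []" using ne 2 by auto
        have R: "ext_mu (map2 (mu ext) uss \<theta>s) \<theta> =
            \<beta> (mu X (map fst us) \<eta>) (mu Y (map (\<lambda>u. fst (snd u)) us') \<eta>') \<theta> \<oplus>\<^bsub>M\<^esub>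
            \<beta> (mu X (map fst us') \<eta>') (mu Y (map (\<lambda>u. fst (snd u)) us) \<eta>) (operm P 2 swap2 \<theta>)"
          using 2 \<eta> by (simp add: ext_mu_simps ext_simps(5))
        have mc: "mu X (map fst us) \<eta> \<in> carrier X" "mu X (map fst us') \<eta>' \<in> carrier X"
          "mu Y (map (\<lambda>u. fst (snd u)) us) \<eta> \<in> carrier Y" "mu Y (map (\<lambda>u. fst (snd u)) us') \<eta>' \<in> carrier Y"
          using X.mu_closed[OF _ car(1)[OF usc(1)]] X.mu_closed[OF _ car(1)[OF usc(2)]]
            Y.mu_closed[OF _ car(2)[OF usc(1)]] Y.mu_closed[OF _ car(2)[OF usc(2)]] \<eta> usn by auto
        consider v w where "us = [v]" "us' = [w]" | "2 \<le> length us" | "2 \<le> length us'"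
          using usn by (cases us; cases us'; cases "tl us"; cases "tl us'") auto
        then show ?thesis
        proof cases
          case (1 v w)
          have \<eta>1: "\<eta> \<in> carrier (ops P 1)" "\<eta>' \<in> carrier (ops P 1)" using \<eta> 1 by auto
          note s = u(1)[OF \<eta>1(1)] u(1)[OF \<eta>1(2)]
          interpret O: module R "ops P 2" by (rule X.ops_module) simp
          have oc: "opcomp P ks \<theta>s \<theta> = op_scalar R P \<eta> \<odot>\<^bsub>ops P 2\<^esub> (op_scalar R P \<eta>' \<odot>\<^bsub>ops P 2\<^esub> \<theta>)"
            using X.opcomp_unary_pair[OF U \<eta>1 th] a(4) 2 1 \<eta> by auto
          have c: "v \<in> carrier ext" "w \<in> carrier ext" using usc 1 by auto
          \<comment> \<open>In the second summand the arguments are exchanged, so the two scalars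
            come out in the opposite order.\<close>
          have comm: "op_scalar R P \<eta> \<odot>\<^bsub>M\<^esub> (op_scalar R P \<eta>' \<odot>\<^bsub>M\<^esub> z) = op_scalar R P \<eta>' \<odot>\<^bsub>M\<^esub> (op_scalar R P \<eta> \<odot>\<^bsub>M\<^esub> z)"
            if "z \<in> carrier M" for z using that s by (simp add: X.R.m_comm flip: M.smult_assoc1)
          have "ext_mu [v, w] (op_scalar R P \<eta> \<odot>\<^bsub>ops P 2\<^esub> (op_scalar R P \<eta>' \<odot>\<^bsub>ops P 2\<^esub> \<theta>)) =
            \<beta> (op_scalar R P \<eta> \<odot>\<^bsub>X\<^esub> fst v) (op_scalar R P \<eta>' \<odot>\<^bsub>Y\<^esub> fst (snd w)) \<theta> \<oplus>\<^bsub>M\<^esub>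
            \<beta> (op_scalar R P \<eta>' \<odot>\<^bsub>X\<^esub> fst w) (op_scalar R P \<eta> \<odot>\<^bsub>Y\<^esub> fst (snd v)) (operm P 2 swap2 \<theta>)"
            using c carm s th sw[OF th]
            by (simp add: ext_mu_simps op_smult op_closed lin_mapsD(3)[OF swl] O.smult_closed comm)
          then show ?thesis
            unfolding R using 1 2 oc c carm
            by (simp add: X.mu_unary[OF U _ \<eta>1(1)] X.mu_unary[OF U _ \<eta>1(2)] Y.mu_unary[OF U _ \<eta>1(1)] Y.mu_unary[OF U _ \<eta>1(2)])
        next
          case long: 2
          then have "3 \<le> length (concat uss)" using 2 usn by (cases us') auto
          then show ?thesis unfolding R
            using decomposable1[OF _ car(1)[OF usc(1)], of \<eta>] decomposable2[OF _ car(2)[OF usc(1)], of \<eta>] long \<eta> mc th sw[OF th]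
            by (simp add: ext_mu_simps)
        next
          case long: 3
          then have "3 \<le> length (concat uss)" using 2 usn by (cases us) auto
          then show ?thesis unfolding R
            using decomposable1[OF _ car(1)[OF usc(2)], of \<eta>'] decomposable2[OF _ car(2)[OF usc(2)], of \<eta>'] long \<eta> mc th sw[OF th]
            by (simp add: ext_mu_simps)
        qed
      next
        case 3
        moreover from 3 have "3 \<le> length (concat uss)" using len ne by fastforce
        ultimately show ?thesis using lt by (simp add: ext_mu_simps)
      qed
    qed
    have m2: "map fst (map2 (mu ext) uss \<theta>s) = map2 (mu X) (map (map fst) uss) \<theta>s"
      "map (\<lambda>u. fst (snd u)) (map2 (mu ext) uss \<theta>s) = map2 (mu Y) (map (map (\<lambda>u. fst (snd u))) uss) \<theta>s"
      by (simp_all add: zip_map1 comp_def case_prod_unfold ext_simps(5))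
    show ?thesis
      using X.mu_comp[OF a(1-3), of "map (map fst) uss"] Y.mu_comp[OF a(1-3), of "map (map (\<lambda>u. fst (snd u))) uss"]
        a(4,5) car cc unfolding ext_simps(5)[of "concat uss"] ext_simps(5)[of "map2 (mu ext) uss \<theta>s"] m2
      by (simp add: comp_def map_concat)
  qed
qed

lemma ext_products_vanish:
  assumes "products_vanish P X 3" "products_vanish P Y 3"
  shows "products_vanish P ext 3"
proof (rule products_vanishI)
  fix us \<theta> assume a: "3 \<le> length us" "set us \<subseteq> carrier ext" "\<theta> \<in> carrier (ops P (length us))"
  have "set (map fst us) \<subseteq> carrier X" "set (map (\<lambda>u. fst (snd u)) us) \<subseteq> carrier Y"
    using a(2) by (fastforce simp: ext_simps)+
  then show "mu ext us \<theta> = \<zero>\<^bsub>ext\<^esub>"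
    using products_vanishD[OF assms(1), of "map fst us" \<theta>] a(1,3)
      products_vanishD[OF assms(2), of "map (\<lambda>u. fst (snd u)) us" \<theta>]
    by (simp add: ext_simps ext_mu_simps)
qed

text \<open>On such elements every value of \<beta> has the zero of Y as its second argument, so the
  third coordinate stays zero.\<close>

lemma ext_inl_hom:
  assumes U: "unary_ops_are_scalars R P"
  shows "(\<lambda>x. (x, \<zero>\<^bsub>Y\<^esub>, \<zero>\<^bsub>M\<^esub>)) \<in> palg_hom R P X ext"
proof (rule palg_homI)
  show "(\<lambda>x. (x, \<zero>\<^bsub>Y\<^esub>, \<zero>\<^bsub>M\<^esub>)) \<in> lin_maps R X ext"
    by (rule lin_mapsI) (auto simp: ext_simps)
  fix as \<theta> assume a: "as \<noteq> []" "set as \<subseteq> carrier X" "\<theta> \<in> carrier (ops P (length as))"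
  consider v where "as = [v]" | v w where "as = [v, w]" | "3 \<le> length as"
    using a(1) by (cases as; cases "tl as"; cases "tl (tl as)") auto
  then have "ext_mu (map (\<lambda>x. (x, \<zero>\<^bsub>Y\<^esub>, \<zero>\<^bsub>M\<^esub>)) as) \<theta> = \<zero>\<^bsub>M\<^esub>"
    by cases (use a in \<open>auto simp: ext_mu_simps op_zero X.swap2_closed X.unary_scalars(1)[OF U] numeral_2_eq_2[symmetric]\<close>)
  moreover have "mu Y (map (\<lambda>x. \<zero>\<^bsub>Y\<^esub>) as) \<theta> = \<zero>\<^bsub>Y\<^esub>"
    using a by (intro Y.mu_zero) (cases as; auto)+
  ultimately show "(mu X as \<theta>, \<zero>\<^bsub>Y\<^esub>, \<zero>\<^bsub>M\<^esub>) = mu ext (map (\<lambda>x. (x, \<zero>\<^bsub>Y\<^esub>, \<zero>\<^bsub>M\<^esub>)) as) \<theta>"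
    by (simp add: ext_simps comp_def)
qed

lemma ext_inr_hom:
  assumes U: "unary_ops_are_scalars R P"
  shows "(\<lambda>y. (\<zero>\<^bsub>X\<^esub>, y, \<zero>\<^bsub>M\<^esub>)) \<in> palg_hom R P Y ext"
proof (rule palg_homI)
  show "(\<lambda>y. (\<zero>\<^bsub>X\<^esub>, y, \<zero>\<^bsub>M\<^esub>)) \<in> lin_maps R Y ext"
    by (rule lin_mapsI) (auto simp: ext_simps)
  fix as \<theta> assume a: "as \<noteq> []" "set as \<subseteq> carrier Y" "\<theta> \<in> carrier (ops P (length as))"
  consider v where "as = [v]" | v w where "as = [v, w]" | "3 \<le> length as"
    using a(1) by (cases as; cases "tl as"; cases "tl (tl as)") auto
  then have "ext_mu (map (\<lambda>y. (\<zero>\<^bsub>X\<^esub>, y, \<zero>\<^bsub>M\<^esub>)) as) \<theta> = \<zero>\<^bsub>M\<^esub>"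
    by cases (use a in \<open>auto simp: ext_mu_simps op_zero X.swap2_closed X.unary_scalars(1)[OF U] numeral_2_eq_2[symmetric]\<close>)
  moreover have "mu X (map (\<lambda>y. \<zero>\<^bsub>X\<^esub>) as) \<theta> = \<zero>\<^bsub>X\<^esub>"
    using a by (intro X.mu_zero) (cases as; auto)+
  ultimately show "(\<zero>\<^bsub>X\<^esub>, mu Y as \<theta>, \<zero>\<^bsub>M\<^esub>) = mu ext (map (\<lambda>y. (\<zero>\<^bsub>X\<^esub>, y, \<zero>\<^bsub>M\<^esub>)) as) \<theta>"
    by (simp add: ext_simps comp_def)
qed

text \<open>X and Y both embed in the two-nilpotent algebra \<open>ext\<close>. The third coordinate
  of the induced morphism on the coproduct, restricted to the kernel, is the required map.\<close>

lemma cosmash2_universal: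
  assumes U: "unary_ops_are_scalars R P" and nil: "products_vanish P X 3" "products_vanish P Y 3"
  shows "\<exists>f\<in>lin_maps R (cosmash2 R P X Y) M. \<forall>x\<in>carrier X. \<forall>y\<in>carrier Y. \<forall>\<theta>\<in>carrier (ops P 2).
    f (tensor R P X Y x y \<theta>) = \<beta> x y \<theta>"
proof -
  let ?W = "coprod2 R P X Y"
  have X: "palgebra R P X" and Y: "palgebra R P Y" by (rule X.palgebra_axioms Y.palgebra_axioms)+
  define F where "F = copair2 ext (\<lambda>x. (x, \<zero>\<^bsub>Y\<^esub>, \<zero>\<^bsub>M\<^esub>)) (\<lambda>y. (\<zero>\<^bsub>X\<^esub>, y, \<zero>\<^bsub>M\<^esub>))"
  note F = copair2[OF X Y ext_palgebra[OF U] ext_products_vanish[OF nil] ext_inl_hom[OF U] ext_inr_hom[OF U],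
      folded F_def]
  have K: "\<exists>S. cosmash2 R P X Y = ?W\<lparr>carrier := S\<rparr>" unfolding cosmash2_def palg_kernel_def by blast
  note sub = cosmash2_subset[OF X nil(1) Y nil(2)]
  have lin: "(\<lambda>w. snd (snd (F w))) \<in> lin_maps R (cosmash2 R P X Y) M"
    using K sub palg_homD(1-3)[OF F(1)] by (intro lin_mapsI) (auto simp: ext_simps subset_iff mem_Times_iff)
  have val: "snd (snd (F (tensor R P X Y x y \<theta>))) = \<beta> x y \<theta>"
    if a: "x \<in> carrier X" "y \<in> carrier Y" "\<theta> \<in> carrier (ops P 2)" for x y \<theta>
  proof -
    have c: "set [coprod2_inl R P X Y x, coprod2_inr R P X Y y] \<subseteq> carrier ?W"
      using palg_homD(1)[OF coprod2_inl_hom[OF X Y] a(1)] palg_homD(1)[OF coprod2_inr_hom[OF X Y] a(2)] by simp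
    have "F (tensor R P X Y x y \<theta>) = mu ext [(x, \<zero>\<^bsub>Y\<^esub>, \<zero>\<^bsub>M\<^esub>), (\<zero>\<^bsub>X\<^esub>, y, \<zero>\<^bsub>M\<^esub>)] \<theta>"
      unfolding tensor_def using palg_homD(4)[OF F(1) _ c, of \<theta>] a F(2,3) by (simp add: numeral_2_eq_2)
    \<comment> \<open>The second summand of the binary operation is \<beta> at two zeros, so only
      \<beta> at x, y and \<theta> survives.\<close>
    then show ?thesis
      using a by (simp add: ext_simps ext_mu_simps op_zero op_closed X.swap2_closed)
  qed
  show ?thesis by (intro bexI[OF _ lin] ballI val)
qed

end

section \<open>The bilinear product\<close>

text \<open>The conditions are symmetric in the two algebras and involve no permutation of \<theta>,
  so the arguments can be exchanged with \<theta> left as it is.\<close>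

lemma bilinear_op_flip:
  assumes "bilinear_op R P X Y M \<beta>"
  shows "bilinear_op R P Y X M (\<lambda>y x. \<beta> x y)"
proof -
  interpret bilinear_op R P X Y M \<beta> by fact
  show ?thesis
    by (intro bilinear_op.intro bilinear_op_axioms.intro X.palgebra_axioms Y.palgebra_axioms M.module_axioms
        lin1 lin2 lin3 decomposable1 decomposable2)
qed

text \<open>When all operations of arity at least two vanish, the unary ones remain, and these are
  scalars.\<close>

lemma lin_maps_palg_hom:
  assumes U: "unary_ops_are_scalars R P" and A: "palgebra R P A" "products_vanish P A 2"
    and B: "palgebra R P B" "products_vanish P B 2" and f: "f \<in> lin_maps R A B"
  shows "f \<in> palg_hom R P A B"
proof (rule palg_homI[OF f])
  interpret A: palgebra R P A by fact
  interpret B: palgebra R P B by fact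
  fix as \<theta> assume a: "as \<noteq> []" "set as \<subseteq> carrier A" "\<theta> \<in> carrier (ops P (length as))"
  consider v where "as = [v]" | "2 \<le> length as"
    using a(1) by (cases as; cases "tl as") auto
  then show "f (mu A as \<theta>) = mu B (map f as) \<theta>"
  proof cases
    case (1 v)
    then show ?thesis
      using a A.mu_unary[OF U, of v \<theta>] B.mu_unary[OF U, of "f v" \<theta>] lin_mapsD[OF f]
        A.unary_scalars(1)[OF U, of \<theta>] by simp
  next
    case 2
    have "set (map f as) \<subseteq> carrier B" using a(2) lin_mapsD(1)[OF f] by auto
    then show ?thesis
      using products_vanishD[OF A(2) 2 a(2,3)] products_vanishD[OF B(2), of "map f as" \<theta>] 2 a(3)
        lin_maps_zero[OF f A.group_A B.group_A] by simp
  qed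
qed

definition btensor ::
  "('r, 'm) ring_scheme \<Rightarrow> ('r, 'p) operad \<Rightarrow> ('r, 'p, 'a) palg \<Rightarrow> ('r, 'p, 'b) palg \<Rightarrow> 'a \<Rightarrow> 'b \<Rightarrow> 'p
    \<Rightarrow> ('r, 'p, 'a, 'b) bilin"
  where "btensor R P A B a b = tensor R P (nil2 R P A) (nil2 R P B) (nil2_proj R P A a) (nil2_proj R P B b)"

lemma bilin_palgebra: "\<lbrakk>palgebra R P A; palgebra R P B\<rbrakk> \<Longrightarrow> palgebra R P (bilin R P A B)"
  unfolding bilin_def by (intro cosmash2_palgebra nil2_palgebra nil2_products_vanish)

lemma bilin_products_vanish: "\<lbrakk>palgebra R P A; palgebra R P B\<rbrakk> \<Longrightarrow> products_vanish P (bilin R P A B) 2"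
  unfolding bilin_def by (intro cosmash2_products_vanish nil2_palgebra nil2_products_vanish)

lemma tensors_nil2:
  assumes "palgebra R P A" "palgebra R P B"
  shows "tensors R P (nil2 R P A) (nil2 R P B) =
    {btensor R P A B a b \<theta> | a b \<theta>. a \<in> carrier A \<and> b \<in> carrier B \<and> \<theta> \<in> carrier (ops P 2)}"
  unfolding tensors_def btensor_def nil2_carrier[OF assms(1)] nil2_carrier[OF assms(2)] by blast

text \<open>The uniqueness half of the universal property of the bilinear product, from its spanning
  set of tensors; \<open>bilin_universal\<close> is the existence half.\<close>

lemma bilin_eqI:
  assumes A: "palgebra R P A" and B: "palgebra R P B" and N: "module R N"
    and f: "f \<in> lin_maps R (bilin R P A B) N" and g: "g \<in> lin_maps R (bilin R P A B) N"
    and eq: "\<And>a b \<theta>. \<lbrakk>a \<in> carrier A; b \<in> carrier B; \<theta> \<in> carrier (ops P 2)\<rbrakk>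
      \<Longrightarrow> f (btensor R P A B a b \<theta>) = g (btensor R P A B a b \<theta>)"
    and x: "x \<in> carrier (bilin R P A B)"
  shows "f x = g x"
proof (rule lin_maps_eq_on_aspan[OF f g])
  note n = nil2_palgebra[OF A] nil2_products_vanish[OF A] nil2_palgebra[OF B] nil2_products_vanish[OF B]
  show "abelian_group (bilin R P A B)" by (rule palgebra.group_A[OF bilin_palgebra[OF A B]])
  show "abelian_group N" by (rule module.axioms(2)[OF N])
  show "tensors R P (nil2 R P A) (nil2 R P B) \<subseteq> carrier (bilin R P A B)"
    unfolding bilin_def by (rule tensors_subset[OF n])
  show "x \<in> aspan (bilin R P A B) (tensors R P (nil2 R P A) (nil2 R P B))"
    using x cosmash2_carrier[OF n] unfolding bilin_def by simp
qed (use eq in \<open>auto simp: tensors_nil2[OF A B]\<close>)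

lemma bilin_subalgebra: "\<exists>S. bilin R P A B = coprod2 R P (nil2 R P A) (nil2 R P B)\<lparr>carrier := S\<rparr>"
  unfolding bilin_def cosmash2_def palg_kernel_def by blast

text \<open>The universal example of such a \<beta>. It inherits linearity from the operations of
  the coproduct, whose restrictions are the operations of the kernel.\<close>

lemma btensor_bilinear_op:
  assumes A: "palgebra R P A" and B: "palgebra R P B"
  shows "bilinear_op R P A B (bilin R P A B) (btensor R P A B)"
proof -
  let ?W = "coprod2 R P (nil2 R P A) (nil2 R P B)" and ?K = "bilin R P A B"
  interpret A: palgebra R P A by fact
  interpret B: palgebra R P B by fact
  note nA = nil2_palgebra[OF A] and nB = nil2_palgebra[OF B]
  interpret W: palgebra R P ?W by (rule coprod2_palgebra[OF nA nB])
  define l where "l = (\<lambda>a. coprod2_inl R P (nil2 R P A) (nil2 R P B) (nil2_proj R P A a))"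
  define r where "r = (\<lambda>b. coprod2_inr R P (nil2 R P A) (nil2 R P B) (nil2_proj R P B b))"
  have l: "l \<in> palg_hom R P A ?W" unfolding l_def
    by (rule palg_hom_comp[OF nil2_proj_hom[OF A] coprod2_inl_hom[OF nA nB]])
  have r: "r \<in> palg_hom R P B ?W" unfolding r_def
    by (rule palg_hom_comp[OF nil2_proj_hom[OF B] coprod2_inr_hom[OF nA nB]])
  have bt: "btensor R P A B a b \<theta> = mu ?W [l a, r b] \<theta>" for a b \<theta>
    unfolding btensor_def tensor_def l_def r_def ..
  have closed: "btensor R P A B a b \<theta> \<in> carrier ?K"
    if "a \<in> carrier A" "b \<in> carrier B" "\<theta> \<in> carrier (ops P 2)" for a b \<theta>
    using that tensors_nil2[OF A B]
      tensors_subset[OF nA nil2_products_vanish[OF A] nB nil2_products_vanish[OF B]]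
    unfolding bilin_def by blast
  obtain S where K: "?K = ?W\<lparr>carrier := S\<rparr>" using bilin_subalgebra by blast
  have S: "S = carrier ?K" unfolding K by simp
  \<comment> \<open>A product of two or more factors in one slot of a binary operation makes at
    least three factors in all, hence zero in a two-nilpotent algebra.\<close>
  have zero: "mu ?W [mu ?W us \<eta>, v] \<theta> = \<zero>\<^bsub>?K\<^esub>" "mu ?W [v, mu ?W us \<eta>] \<theta> = \<zero>\<^bsub>?K\<^esub>"
    if "2 \<le> length us" "set us \<subseteq> carrier ?W" "\<eta> \<in> carrier (ops P (length us))" "v \<in> carrier ?W" "\<theta> \<in> carrier (ops P 2)"
    for us \<eta> v \<theta>
  proof -
    have "mu ?W us \<eta> \<in> products P ?W 2" by (rule productsI[OF that(1-3)])
    then have "mu ?W ([] @ mu ?W us \<eta> # [v]) \<theta> \<in> products P ?W (2 + 0 + 1)"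
      "mu ?W ([v] @ mu ?W us \<eta> # []) \<theta> \<in> products P ?W (2 + 1 + 0)"
      using W.mu_product_slot[of 2 "[]" "[v]" "mu ?W us \<eta>" \<theta>] W.mu_product_slot[of 2 "[v]" "[]" "mu ?W us \<eta>" \<theta>] that
      by (simp_all add: numeral_2_eq_2 numeral_3_eq_3)
    then show "mu ?W [mu ?W us \<eta>, v] \<theta> = \<zero>\<^bsub>?K\<^esub>" "mu ?W [v, mu ?W us \<eta>] \<theta> = \<zero>\<^bsub>?K\<^esub>"
      using coprod2_products_vanish[OF nA nB] unfolding products_vanish_def K by auto
  qed
  show ?thesis
  proof (intro bilinear_op.intro bilinear_op_axioms.intro A B palgebra.module_A[OF bilin_palgebra[OF A B]])
    fix b \<theta> assume b: "b \<in> carrier B" "\<theta> \<in> carrier (ops P 2)"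
    have "(\<lambda>u. mu ?W ([] @ u # [r b]) \<theta>) \<in> lin_maps R ?W ?W"
      by (rule W.mu_lin_slot) (use b palg_homD(1)[OF r] in \<open>auto simp: numeral_2_eq_2\<close>)
    then show "(\<lambda>a. btensor R P A B a b \<theta>) \<in> lin_maps R A ?K"
      using lin_maps_comp[OF palg_hom_lin[OF l]] closed b unfolding K
      by (intro lin_maps_into_subset) (auto simp: bt S)
    show "btensor R P A B (mu A xs \<eta>) b \<theta> = \<zero>\<^bsub>?K\<^esub>"
      if xs: "2 \<le> length xs" "set xs \<subseteq> carrier A" "\<eta> \<in> carrier (ops P (length xs))" for xs \<eta>
    proof -
      have "xs \<noteq> []" "set (map l xs) \<subseteq> carrier ?W" using xs palg_homD(1)[OF l] by auto
      then show ?thesis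
        unfolding bt using palg_homD(4)[OF l, of xs \<eta>] zero(1)[of "map l xs" \<eta> "r b" \<theta>] xs b palg_homD(1)[OF r] by simp
    qed
  next
    fix a \<theta> assume a: "a \<in> carrier A" "\<theta> \<in> carrier (ops P 2)"
    have "(\<lambda>u. mu ?W ([l a] @ u # []) \<theta>) \<in> lin_maps R ?W ?W"
      by (rule W.mu_lin_slot) (use a palg_homD(1)[OF l] in \<open>auto simp: numeral_2_eq_2\<close>)
    then show "(\<lambda>b. btensor R P A B a b \<theta>) \<in> lin_maps R B ?K"
      using lin_maps_comp[OF palg_hom_lin[OF r]] closed a unfolding K
      by (intro lin_maps_into_subset) (auto simp: bt S)
    show "btensor R P A B a (mu B ys \<eta>) \<theta> = \<zero>\<^bsub>?K\<^esub>"
      if ys: "2 \<le> length ys" "set ys \<subseteq> carrier B" "\<eta> \<in> carrier (ops P (length ys))" for ys \<eta>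
    proof -
      have "ys \<noteq> []" "set (map r ys) \<subseteq> carrier ?W" using ys palg_homD(1)[OF r] by auto
      then show ?thesis
        unfolding bt using palg_homD(4)[OF r, of ys \<eta>] zero(2)[of "map r ys" \<eta> "l a" \<theta>] ys a palg_homD(1)[OF l] by simp
    qed
  next
    fix a b assume ab: "a \<in> carrier A" "b \<in> carrier B"
    have "mu ?W [l a, r b] \<in> lin_maps R (ops P (length [l a, r b])) ?W"
      by (rule W.mu_linear) (use ab palg_homD(1)[OF l] palg_homD(1)[OF r] in auto)
    then show "btensor R P A B a b \<in> lin_maps R (ops P 2) ?K"
      using closed ab unfolding K
      by (intro lin_maps_into_subset) (auto simp: bt[abs_def] S numeral_2_eq_2)
  qed
qed

text \<open>Two representatives of a class differ by a sum of products of at least three factors,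
  and \<beta> kills products of two or more. Hence \<beta> descends to the reflection in its left
  argument.\<close>

lemma bilinear_op_nil2_left:
  assumes "bilinear_op R P A B M \<beta>"
  shows "\<exists>\<beta>'. bilinear_op R P (nil2 R P A) B M \<beta>' \<and>
    (\<forall>a\<in>carrier A. \<forall>b\<in>carrier B. \<forall>\<theta>\<in>carrier (ops P 2). \<beta>' (nil2_proj R P A a) b \<theta> = \<beta> a b \<theta>)"
proof -
  interpret bilinear_op R P A B M \<beta> by fact
  have A: "palgebra R P A" by (rule X.palgebra_axioms)
  let ?p = "nil2_proj R P A"
  note nA = nil2[OF A]
  \<comment> \<open>An arbitrary representative of each class; by the independence shown next, the
    choice does not affect \<beta>.\<close>
  define a' where "a' C = (SOME a. a \<in> carrier A \<and> ?p a = C)" for C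
  have a': "a' (?p a) \<in> carrier A \<and> ?p (a' (?p a)) = ?p a" if "a \<in> carrier A" for a
    unfolding a'_def by (rule someI[of _ a]) (use that in simp)
  have "\<beta> a b \<theta> = \<beta> a0 b \<theta>"
    if "a \<in> carrier A" "a0 \<in> carrier A" "?p a = ?p a0" "b \<in> carrier B" "\<theta> \<in> carrier (ops P 2)" for a a0 b \<theta>
  proof -
    have d: "a \<ominus>\<^bsub>A\<^esub> a0 \<in> decomposables P A 3" using nA(5) that by blast
    have "\<beta> (a \<ominus>\<^bsub>A\<^esub> a0) b \<theta> = \<zero>\<^bsub>M\<^esub>"
      by (rule lin_maps_eq_on_aspan[OF lin1[OF that(4,5)] lin_maps_const_zero[OF M.module_axioms] X.group_A
            module.axioms(2)[OF M.module_axioms] X.products_closed _ d])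
        (use that decomposable1 in \<open>auto simp: products_def\<close>)
    moreover have "a = (a \<ominus>\<^bsub>A\<^esub> a0) \<oplus>\<^bsub>A\<^esub> a0" using that by (simp add: a_minus_def X.M.a_assoc X.M.l_neg)
    ultimately show ?thesis
      using op_add(1)[of "a \<ominus>\<^bsub>A\<^esub> a0" a0 b \<theta>] op_closed[of a0 b \<theta>] that by simp
  qed
  then have val: "\<beta> (a' (?p a)) b \<theta> = \<beta> a b \<theta>"
    if "a \<in> carrier A" "b \<in> carrier B" "\<theta> \<in> carrier (ops P 2)" for a b \<theta>
    using a' that by metis
  have "bilinear_op R P (nil2 R P A) B M (\<lambda>C. \<beta> (a' C))"
  proof (intro bilinear_op.intro bilinear_op_axioms.intro nA(1) Y.palgebra_axioms M.module_axioms)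
    fix b \<theta> assume b: "b \<in> carrier B" "\<theta> \<in> carrier (ops P 2)"
    show "(\<lambda>C. \<beta> (a' C) b \<theta>) \<in> lin_maps R (nil2 R P A) M"
      by (rule lin_mapsI)
        (use b in \<open>auto simp: nA(3) val op_simps simp flip: palg_homD(2,3)[OF nA(2)]\<close>)
    show "\<beta> (a' (mu (nil2 R P A) Cs \<eta>)) b \<theta> = \<zero>\<^bsub>M\<^esub>"
      if Cs: "2 \<le> length Cs" "set Cs \<subseteq> carrier (nil2 R P A)" "\<eta> \<in> carrier (ops P (length Cs))" for Cs \<eta>
    proof -
      obtain as where as: "Cs = map ?p as" "set as \<subseteq> carrier A"
        using subset_image_list[of Cs ?p "carrier A"] Cs(2) unfolding nA(3) by metis
      have ne: "as \<noteq> []" and eta: "\<eta> \<in> carrier (ops P (length as))" using as Cs by auto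
      then have "mu (nil2 R P A) Cs \<eta> = ?p (mu A as \<eta>)" using palg_homD(4)[OF nA(2), of as \<eta>] as by simp
      then show ?thesis
        using val[OF X.mu_closed[OF ne as(2) eta] b] decomposable1[of as \<eta> b \<theta>] as b Cs by simp
    qed
  qed (use a' lin2 lin3 decomposable2 in \<open>auto simp: nA(3)\<close>)
  then show ?thesis using val by blast
qed

text \<open>The map \<beta> descends to the reflections one argument at a time. The flip turns the
  right argument into a left one, and a second flip restores the order.\<close>

lemma bilin_universal:
  assumes U: "unary_ops_are_scalars R P" and op: "bilinear_op R P A B M \<beta>"
  shows "\<exists>f\<in>lin_maps R (bilin R P A B) M. \<forall>a\<in>carrier A. \<forall>b\<in>carrier B. \<forall>\<theta>\<in>carrier (ops P 2).
    f (btensor R P A B a b \<theta>) = \<beta> a b \<theta>"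
proof -
  interpret bilinear_op R P A B M \<beta> by fact
  have A: "palgebra R P A" and B: "palgebra R P B" by (rule X.palgebra_axioms Y.palgebra_axioms)+
  note nA = nil2[OF A] and nB = nil2[OF B]
  obtain \<beta>' where \<beta>': "bilinear_op R P (nil2 R P A) B M \<beta>'"
    "\<forall>a\<in>carrier A. \<forall>b\<in>carrier B. \<forall>\<theta>\<in>carrier (ops P 2). \<beta>' (nil2_proj R P A a) b \<theta> = \<beta> a b \<theta>"
    using bilinear_op_nil2_left[OF op] by blast
  obtain \<beta>'' where \<beta>'': "bilinear_op R P (nil2 R P B) (nil2 R P A) M \<beta>''"
    "\<forall>b\<in>carrier B. \<forall>a\<in>carrier (nil2 R P A). \<forall>\<theta>\<in>carrier (ops P 2). \<beta>'' (nil2_proj R P B b) a \<theta> = \<beta>' a b \<theta>"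
    using bilinear_op_nil2_left[OF bilinear_op_flip[OF \<beta>'(1)]] by blast
  obtain f where f: "f \<in> lin_maps R (bilin R P A B) M"
    "\<forall>x\<in>carrier (nil2 R P A). \<forall>y\<in>carrier (nil2 R P B). \<forall>\<theta>\<in>carrier (ops P 2).
      f (tensor R P (nil2 R P A) (nil2 R P B) x y \<theta>) = \<beta>'' y x \<theta>"
    using bilinear_op.cosmash2_universal[OF bilinear_op_flip[OF \<beta>''(1)] U nA(4) nB(4)] unfolding bilin_def by blast
  show ?thesis
    by (rule bexI[OF _ f(1)]) (use f(2) \<beta>'(2) \<beta>''(2) in \<open>simp add: btensor_def nA(3) nB(3)\<close>)
qed

section \<open>Functoriality of the bilinear product\<close>

lemma bilin_map:
  assumes A: "palgebra R P A" and A': "palgebra R P A'" and B: "palgebra R P B" and B': "palgebra R P B'"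
    and f: "f \<in> palg_hom R P A A'" and g: "g \<in> palg_hom R P B B'"
  shows bilin_map_hom: "bilin_map R P A' B' f g \<in> palg_hom R P (bilin R P A B) (bilin R P A' B')"
    and bilin_map_btensor: "\<lbrakk>a \<in> carrier A; b \<in> carrier B; \<theta> \<in> carrier (ops P 2)\<rbrakk>
      \<Longrightarrow> bilin_map R P A' B' f g (btensor R P A B a b \<theta>) = btensor R P A' B' (f a) (g b) \<theta>"
proof -
  let ?W = "coprod2 R P (nil2 R P A) (nil2 R P B)" and ?W' = "coprod2 R P (nil2 R P A') (nil2 R P B')"
  let ?h = "bilin_map R P A' B' f g"
  note nA = nil2_palgebra[OF A] nil2_products_vanish[OF A] and nB = nil2_palgebra[OF B] nil2_products_vanish[OF B]
  note nA' = nil2_palgebra[OF A'] nil2_products_vanish[OF A'] and nB' = nil2_palgebra[OF B'] nil2_products_vanish[OF B']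
  have W: "palgebra R P ?W" and W': "palgebra R P ?W'"
    by (rule coprod2_palgebra[OF nA(1) nB(1)] coprod2_palgebra[OF nA'(1) nB'(1)])+
  note c = copair2[OF nA(1) nB(1) W' coprod2_products_vanish[OF nA'(1) nB'(1)]
      palg_hom_comp[OF nil2_map_hom[OF A A' f] coprod2_inl_hom[OF nA'(1) nB'(1)]]
      palg_hom_comp[OF nil2_map_hom[OF B B' g] coprod2_inr_hom[OF nA'(1) nB'(1)]], folded bilin_map_def]
  show val: "?h (btensor R P A B a b \<theta>) = btensor R P A' B' (f a) (g b) \<theta>"
    if ab: "a \<in> carrier A" "b \<in> carrier B" "\<theta> \<in> carrier (ops P 2)" for a b \<theta>
  proof -
    have pq: "nil2_proj R P A a \<in> carrier (nil2 R P A)" "nil2_proj R P B b \<in> carrier (nil2 R P B)"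
      using ab palg_homD(1)[OF nil2_proj_hom[OF A]] palg_homD(1)[OF nil2_proj_hom[OF B]] by auto
    then show ?thesis
      unfolding btensor_def tensor_def
      using palg_homD(4)[OF c(1), of "[coprod2_inl R P (nil2 R P A) (nil2 R P B) (nil2_proj R P A a),
          coprod2_inr R P (nil2 R P A) (nil2 R P B) (nil2_proj R P B b)]" \<theta>] ab c(2)[OF pq(1)] c(3)[OF pq(2)]
        palg_homD(1)[OF coprod2_inl_hom[OF nA(1) nB(1)] pq(1)] palg_homD(1)[OF coprod2_inr_hom[OF nA(1) nB(1)] pq(2)]
      by (simp add: nil2_map_proj[OF A A' f] nil2_map_proj[OF B B' g] numeral_2_eq_2)
  qed
  obtain S where S: "bilin R P A B = ?W\<lparr>carrier := S\<rparr>" using bilin_subalgebra by blast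
  obtain S' where S': "bilin R P A' B' = ?W'\<lparr>carrier := S'\<rparr>" using bilin_subalgebra by blast
  note cs = cosmash2_carrier[OF nA nB, folded bilin_def] cosmash2_carrier[OF nA' nB', folded bilin_def]
  have T: "tensors R P (nil2 R P A) (nil2 R P B) \<subseteq> carrier ?W"
    using tensors_subset[OF nA nB] cosmash2_subset[OF nA nB] by blast
  have im: "?h ` tensors R P (nil2 R P A) (nil2 R P B) \<subseteq> tensors R P (nil2 R P A') (nil2 R P B')"
    unfolding tensors_nil2[OF A B] tensors_nil2[OF A' B'] using val palg_homD(1)[OF f] palg_homD(1)[OF g] by fast
  \<comment> \<open>That kernel is mapped to kernel is checked on the spanning tensors instead of
    through the equations defining the kernels.\<close>
  have into: "?h x \<in> S'" if "x \<in> S" for x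
  proof -
    have "x \<in> aspan ?W (tensors R P (nil2 R P A) (nil2 R P B))"
      using that cs(1) unfolding S aspan_carrier_update by simp
    then have "?h x \<in> aspan ?W' (tensors R P (nil2 R P A') (nil2 R P B'))"
      by (rule aspan_map[OF palg_hom_lin[OF c(1)] palgebra.group_A[OF W] palgebra.group_A[OF W'] T im])
    then show ?thesis using cs(2) unfolding S' aspan_carrier_update by simp
  qed
  have sub: "S \<subseteq> carrier ?W" using cosmash2_subset[OF nA nB] unfolding bilin_def[symmetric] S by simp
  show "?h \<in> palg_hom R P (bilin R P A B) (bilin R P A' B')"
    unfolding S S'
    by (intro palg_homI lin_mapsI) (use sub into palg_homD(2-4)[OF c(1)] in \<open>auto simp: subset_iff\<close>)
qed


section \<open>Associativity\<close>

text \<open>Additivity and homogeneity in z, for fixed z, are equations between linear functions of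
  u, so it suffices to verify them for pure tensors u.\<close>

lemma bilin_lin_parameter:
  assumes A: "palgebra R P A" and B: "palgebra R P B" and Z: "module R Z" and N: "module R N"
    and lin: "\<And>z. z \<in> carrier Z \<Longrightarrow> (\<lambda>u. F u z) \<in> lin_maps R (bilin R P A B) N"
    and btensor: "\<And>a b \<theta>. \<lbrakk>a \<in> carrier A; b \<in> carrier B; \<theta> \<in> carrier (ops P 2)\<rbrakk>
      \<Longrightarrow> F (btensor R P A B a b \<theta>) \<in> lin_maps R Z N"
    and u: "u \<in> carrier (bilin R P A B)"
  shows "F u \<in> lin_maps R Z N"
proof (rule lin_mapsI)
  interpret Z: module R Z by fact
  note eqI = bilin_eqI[OF A B N]
  show "F u z \<in> carrier N" if "z \<in> carrier Z" for z by (rule lin_mapsD(1)[OF lin[OF that] u])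
  show "F u (y \<oplus>\<^bsub>Z\<^esub> z) = F u y \<oplus>\<^bsub>N\<^esub> F u z" if z: "y \<in> carrier Z" "z \<in> carrier Z" for y z
    by (rule eqI[OF lin[OF Z.M.a_closed[OF z]] lin_maps_sum[OF N lin[OF z(1)] lin[OF z(2)]] _ u])
      (rule lin_mapsD(2)[OF btensor z])
  show "F u (r \<odot>\<^bsub>Z\<^esub> z) = r \<odot>\<^bsub>N\<^esub> F u z" if z: "r \<in> carrier R" "z \<in> carrier Z" for r z
    by (rule eqI[OF lin[OF Z.smult_closed[OF z]] lin_maps_scale[OF N lin[OF z(2)] z(1)] _ u])
      (rule lin_mapsD(3)[OF btensor z])
qed

text \<open>Extends an expression linear in each of its five arguments from a, b and \<theta> to
  elements of A \<otimes> B. For fixed c and \<theta>' this is the universal property; uniqueness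
  then yields the conditions in c and \<theta>'.\<close>

lemma bilin_curry:
  assumes U: "unary_ops_are_scalars R P" and A: "palgebra R P A" and B: "palgebra R P B" and C: "palgebra R P C"
    and N: "module R N"
    and AB: "\<And>c \<theta>'. \<lbrakk>c \<in> carrier C; \<theta>' \<in> carrier (ops P 2)\<rbrakk> \<Longrightarrow> bilinear_op R P A B N (\<lambda>a b \<theta>. G a b \<theta> c \<theta>')"
    and c_lin: "\<And>a b \<theta> \<theta>'. \<lbrakk>a \<in> carrier A; b \<in> carrier B; \<theta> \<in> carrier (ops P 2); \<theta>' \<in> carrier (ops P 2)\<rbrakk>
      \<Longrightarrow> (\<lambda>c. G a b \<theta> c \<theta>') \<in> lin_maps R C N"
    and op_lin: "\<And>a b \<theta> c. \<lbrakk>a \<in> carrier A; b \<in> carrier B; \<theta> \<in> carrier (ops P 2); c \<in> carrier C\<rbrakk>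
      \<Longrightarrow> (\<lambda>\<theta>'. G a b \<theta> c \<theta>') \<in> lin_maps R (ops P 2) N"
    and c_dec: "\<And>a b \<theta> cs \<eta> \<theta>'. \<lbrakk>a \<in> carrier A; b \<in> carrier B; \<theta> \<in> carrier (ops P 2); \<theta>' \<in> carrier (ops P 2);
        2 \<le> length cs; set cs \<subseteq> carrier C; \<eta> \<in> carrier (ops P (length cs))\<rbrakk>
      \<Longrightarrow> G a b \<theta> (mu C cs \<eta>) \<theta>' = \<zero>\<^bsub>N\<^esub>"
  shows "\<exists>\<Phi>. bilinear_op R P (bilin R P A B) C N \<Phi> \<and>
    (\<forall>a\<in>carrier A. \<forall>b\<in>carrier B. \<forall>\<theta>\<in>carrier (ops P 2). \<forall>c\<in>carrier C. \<forall>\<theta>'\<in>carrier (ops P 2).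
      \<Phi> (btensor R P A B a b \<theta>) c \<theta>' = G a b \<theta> c \<theta>')"
proof -
  let ?T = "bilin R P A B"
  interpret A: palgebra R P A by fact
  interpret C: palgebra R P C by fact
  interpret T: palgebra R P ?T by (rule bilin_palgebra[OF A B])
  interpret O: module R "ops P 2" by (rule A.ops_module) simp
  interpret N: module R N by fact
  \<comment> \<open>One linear map is chosen for each pair of c and \<theta>', with no coherence
    between the choices. Since each is determined on A \<otimes> B by its values on tensors, the
    family still depends linearly on c and on \<theta>'.\<close>
  define \<Phi> where "\<Phi> u c \<theta>' = (SOME f. f \<in> lin_maps R ?T N \<and> (\<forall>a\<in>carrier A. \<forall>b\<in>carrier B. \<forall>\<theta>\<in>carrier (ops P 2).
      f (btensor R P A B a b \<theta>) = G a b \<theta> c \<theta>')) u" for u c \<theta>'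
  have \<Phi>: "(\<lambda>u. \<Phi> u c \<theta>') \<in> lin_maps R ?T N \<and> (\<forall>a\<in>carrier A. \<forall>b\<in>carrier B. \<forall>\<theta>\<in>carrier (ops P 2).
      \<Phi> (btensor R P A B a b \<theta>) c \<theta>' = G a b \<theta> c \<theta>')"
    if "c \<in> carrier C" "\<theta>' \<in> carrier (ops P 2)" for c \<theta>'
  proof -
    have "\<exists>f. f \<in> lin_maps R ?T N \<and> (\<forall>a\<in>carrier A. \<forall>b\<in>carrier B. \<forall>\<theta>\<in>carrier (ops P 2).
        f (btensor R P A B a b \<theta>) = G a b \<theta> c \<theta>')"
      using bilin_universal[OF U AB[OF that]] by blast
    from someI_ex[OF this] show ?thesis unfolding \<Phi>_def .
  qed
  have lin: "(\<lambda>u. \<Phi> u c \<theta>') \<in> lin_maps R ?T N" if "c \<in> carrier C" "\<theta>' \<in> carrier (ops P 2)" for c \<theta>'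
    using \<Phi>[OF that] by blast
  have val: "\<Phi> (btensor R P A B a b \<theta>) c \<theta>' = G a b \<theta> c \<theta>'"
    if "a \<in> carrier A" "b \<in> carrier B" "\<theta> \<in> carrier (ops P 2)" "c \<in> carrier C" "\<theta>' \<in> carrier (ops P 2)" for a b \<theta> c \<theta>'
    using \<Phi> that by blast
  note eqI = bilin_eqI[OF A B N]
  have "bilinear_op R P ?T C N \<Phi>"
  proof (intro bilinear_op.intro bilinear_op_axioms.intro T.palgebra_axioms C N lin)
    fix u \<theta>' assume u: "u \<in> carrier ?T" and th: "\<theta>' \<in> carrier (ops P 2)"
    show "(\<lambda>c. \<Phi> u c \<theta>') \<in> lin_maps R C N"
      by (rule bilin_lin_parameter[OF A B C.module_A N lin[OF _ th] _ u])
        (assumption, rule lin_mapsI, simp_all add: val th lin_mapsD[OF c_lin])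
    show "\<Phi> u (mu C cs \<eta>) \<theta>' = \<zero>\<^bsub>N\<^esub>"
      if cs: "2 \<le> length cs" "set cs \<subseteq> carrier C" "\<eta> \<in> carrier (ops P (length cs))" for cs \<eta>
    proof -
      have m: "mu C cs \<eta> \<in> carrier C" by (rule C.mu_closed[OF _ cs(2,3)]) (use cs(1) in auto)
      show ?thesis
        by (rule eqI[OF lin[OF m th] lin_maps_const_zero[OF N] _ u]) (simp add: val m th c_dec cs)
    qed
  next
    fix u c assume u: "u \<in> carrier ?T" and c: "c \<in> carrier C"
    show "\<Phi> u c \<in> lin_maps R (ops P 2) N"
      by (rule bilin_lin_parameter[OF A B O.module_axioms N lin[OF c] _ u])
        (assumption, rule lin_mapsI, simp_all add: val c lin_mapsD[OF op_lin])
  next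
    \<comment> \<open>Products of elements of A \<otimes> B are zero, so here the condition is only
      that a linear map preserves zero.\<close>
    fix us \<eta> c \<theta>' assume a: "2 \<le> length us" "set us \<subseteq> carrier ?T" "\<eta> \<in> carrier (ops P (length us))"
      "c \<in> carrier C" "\<theta>' \<in> carrier (ops P 2)"
    show "\<Phi> (mu ?T us \<eta>) c \<theta>' = \<zero>\<^bsub>N\<^esub>"
      using products_vanishD[OF bilin_products_vanish[OF A B] a(1-3)]
        lin_maps_zero[OF lin[OF a(4,5)] T.group_A module.axioms(2)[OF N]] by simp
  qed
  then show ?thesis using val by blast
qed

context
  fixes R :: "('r, 'm) ring_scheme" and P :: "('r, 'p) operad"
    and A :: "('r, 'p, 'a) palg" and B :: "('r, 'p, 'b) palg" and C :: "('r, 'p, 'c) palg"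
  assumes A: "palgebra R P A" and B: "palgebra R P B" and C: "palgebra R P C"
begin

text \<open>The right-hand expression is linear in each of its five arguments. A product in place of
  a is killed by the outer tensor; in place of b or c it is killed by the inner one, and the outer
  tensor then has a zero argument.\<close>

lemma bilin_assoc_map:
  assumes U: "unary_ops_are_scalars R P"
  shows "\<exists>\<alpha>\<in>lin_maps R (bilin R P (bilin R P A B) C) (bilin R P A (bilin R P B C)).
    \<forall>a\<in>carrier A. \<forall>b\<in>carrier B. \<forall>\<theta>\<in>carrier (ops P 2). \<forall>c\<in>carrier C. \<forall>\<theta>'\<in>carrier (ops P 2).
      \<alpha> (btensor R P (bilin R P A B) C (btensor R P A B a b \<theta>) c \<theta>') =
      btensor R P A (bilin R P B C) a (btensor R P B C b c \<theta>) \<theta>'"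
proof -
  let ?N = "bilin R P A (bilin R P B C)"
  note BC = bilin_palgebra[OF B C]
  interpret BC: bilinear_op R P B C "bilin R P B C" "btensor R P B C" by (rule btensor_bilinear_op[OF B C])
  interpret N: bilinear_op R P A "bilin R P B C" ?N "btensor R P A (bilin R P B C)"
    by (rule btensor_bilinear_op[OF A BC])
  have "\<exists>\<Phi>. bilinear_op R P (bilin R P A B) C ?N \<Phi> \<and>
    (\<forall>a\<in>carrier A. \<forall>b\<in>carrier B. \<forall>\<theta>\<in>carrier (ops P 2). \<forall>c\<in>carrier C. \<forall>\<theta>'\<in>carrier (ops P 2).
      \<Phi> (btensor R P A B a b \<theta>) c \<theta>' = btensor R P A (bilin R P B C) a (btensor R P B C b c \<theta>) \<theta>')"
  proof (rule bilin_curry[OF U A B C N.M.module_axioms])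
    show "bilinear_op R P A B ?N (\<lambda>a b \<theta>. btensor R P A (bilin R P B C) a (btensor R P B C b c \<theta>) \<theta>')"
      if c: "c \<in> carrier C" "\<theta>' \<in> carrier (ops P 2)" for c \<theta>'
      by (intro bilinear_op.intro bilinear_op_axioms.intro A B N.M.module_axioms)
        (simp_all add: c BC.op_closed N.lin1 N.decomposable1 BC.decomposable1 N.op_zero
          lin_maps_comp[OF BC.lin1 N.lin2] lin_maps_comp[OF BC.lin3 N.lin2])
  qed (simp_all add: BC.op_closed N.lin3 BC.decomposable2 N.op_zero lin_maps_comp[OF BC.lin2 N.lin2])
  then obtain \<Phi> where \<Phi>: "bilinear_op R P (bilin R P A B) C ?N \<Phi>"
    "\<And>a b \<theta> c \<theta>'. \<lbrakk>a \<in> carrier A; b \<in> carrier B; \<theta> \<in> carrier (ops P 2); c \<in> carrier C; \<theta>' \<in> carrier (ops P 2)\<rbrakk>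
      \<Longrightarrow> \<Phi> (btensor R P A B a b \<theta>) c \<theta>' = btensor R P A (bilin R P B C) a (btensor R P B C b c \<theta>) \<theta>'"
    by blast
  have cl: "btensor R P A B a b \<theta> \<in> carrier (bilin R P A B)"
    if "a \<in> carrier A" "b \<in> carrier B" "\<theta> \<in> carrier (ops P 2)" for a b \<theta>
    by (rule bilinear_op.op_closed[OF btensor_bilinear_op[OF A B] that])
  from bilin_universal[OF U \<Phi>(1)] show ?thesis
    by (elim bexE) (rule bexI, auto simp: \<Phi>(2) cl)
qed

text \<open>The mirror image of the preceding construction: now a product in place of c is killed by
  the outer tensor, and in place of a or b by the inner one.\<close>

lemma bilin_assoc_inverse_map:
  assumes U: "unary_ops_are_scalars R P"
  shows "\<exists>\<alpha>\<in>lin_maps R (bilin R P A (bilin R P B C)) (bilin R P (bilin R P A B) C).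
    \<forall>a\<in>carrier A. \<forall>b\<in>carrier B. \<forall>\<theta>\<in>carrier (ops P 2). \<forall>c\<in>carrier C. \<forall>\<theta>'\<in>carrier (ops P 2).
      \<alpha> (btensor R P A (bilin R P B C) a (btensor R P B C b c \<theta>) \<theta>') =
      btensor R P (bilin R P A B) C (btensor R P A B a b \<theta>) c \<theta>'"
proof -
  let ?L = "bilin R P (bilin R P A B) C"
  note AB = bilin_palgebra[OF A B]
  interpret AB: bilinear_op R P A B "bilin R P A B" "btensor R P A B" by (rule btensor_bilinear_op[OF A B])
  interpret L: bilinear_op R P "bilin R P A B" C ?L "btensor R P (bilin R P A B) C"
    by (rule btensor_bilinear_op[OF AB C])
  have "\<exists>\<Phi>. bilinear_op R P (bilin R P B C) A ?L \<Phi> \<and>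
    (\<forall>b\<in>carrier B. \<forall>c\<in>carrier C. \<forall>\<theta>\<in>carrier (ops P 2). \<forall>a\<in>carrier A. \<forall>\<theta>'\<in>carrier (ops P 2).
      \<Phi> (btensor R P B C b c \<theta>) a \<theta>' = btensor R P (bilin R P A B) C (btensor R P A B a b \<theta>) c \<theta>')"
  proof (rule bilin_curry[OF U B C A L.M.module_axioms])
    show "bilinear_op R P B C ?L (\<lambda>b c \<theta>. btensor R P (bilin R P A B) C (btensor R P A B a b \<theta>) c \<theta>')"
      if a: "a \<in> carrier A" "\<theta>' \<in> carrier (ops P 2)" for a \<theta>'
      by (intro bilinear_op.intro bilinear_op_axioms.intro B C L.M.module_axioms)
        (simp_all add: a AB.op_closed L.lin2 L.decomposable2 AB.decomposable2 L.op_zero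
          lin_maps_comp[OF AB.lin2 L.lin1] lin_maps_comp[OF AB.lin3 L.lin1])
  qed (simp_all add: AB.op_closed L.lin3 AB.decomposable1 L.op_zero lin_maps_comp[OF AB.lin1 L.lin1])
  then obtain \<Phi> where \<Phi>: "bilinear_op R P (bilin R P B C) A ?L \<Phi>"
    "\<And>a b \<theta> c \<theta>'. \<lbrakk>a \<in> carrier A; b \<in> carrier B; \<theta> \<in> carrier (ops P 2); c \<in> carrier C; \<theta>' \<in> carrier (ops P 2)\<rbrakk>
      \<Longrightarrow> \<Phi> (btensor R P B C b c \<theta>) a \<theta>' = btensor R P (bilin R P A B) C (btensor R P A B a b \<theta>) c \<theta>'"
    by blast
  have cl: "btensor R P B C b c \<theta> \<in> carrier (bilin R P B C)"
    if "b \<in> carrier B" "c \<in> carrier C" "\<theta> \<in> carrier (ops P 2)" for b c \<theta>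
    by (rule bilinear_op.op_closed[OF btensor_bilinear_op[OF B C] that])
  \<comment> \<open>Currying places the inner tensor product on the left; the flip moves A back in
    front of B \<otimes> C.\<close>
  from bilin_universal[OF U bilinear_op_flip[OF \<Phi>(1)]] show ?thesis
    by (elim bexE) (rule bexI, auto simp: \<Phi>(2) cl)
qed

text \<open>Uniqueness is applied twice: first to tensors of u and c with u in A \<otimes> B, and
  then, with c and \<theta>' fixed, to u.\<close>

lemma bilin_left_eqI:
  assumes N: "module R N"
    and f: "f \<in> lin_maps R (bilin R P (bilin R P A B) C) N" and g: "g \<in> lin_maps R (bilin R P (bilin R P A B) C) N"
    and eq: "\<And>a b \<theta> c \<theta>'. \<lbrakk>a \<in> carrier A; b \<in> carrier B; \<theta> \<in> carrier (ops P 2); c \<in> carrier C; \<theta>' \<in> carrier (ops P 2)\<rbrakk>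
      \<Longrightarrow> f (btensor R P (bilin R P A B) C (btensor R P A B a b \<theta>) c \<theta>') =
        g (btensor R P (bilin R P A B) C (btensor R P A B a b \<theta>) c \<theta>')"
    and x: "x \<in> carrier (bilin R P (bilin R P A B) C)"
  shows "f x = g x"
proof (rule bilin_eqI[OF bilin_palgebra[OF A B] C N f g _ x])
  interpret L: bilinear_op R P "bilin R P A B" C "bilin R P (bilin R P A B) C" "btensor R P (bilin R P A B) C"
    by (rule btensor_bilinear_op[OF bilin_palgebra[OF A B] C])
  fix u c \<theta>' assume a: "u \<in> carrier (bilin R P A B)" "c \<in> carrier C" "\<theta>' \<in> carrier (ops P 2)"
  show "f (btensor R P (bilin R P A B) C u c \<theta>') = g (btensor R P (bilin R P A B) C u c \<theta>')"
    by (rule bilin_eqI[OF A B N lin_maps_comp[OF L.lin1[OF a(2,3)] f] lin_maps_comp[OF L.lin1[OF a(2,3)] g] _ a(1)])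
      (rule eq, use a in auto)
qed

lemma bilin_right_eqI:
  assumes N: "module R N"
    and f: "f \<in> lin_maps R (bilin R P A (bilin R P B C)) N" and g: "g \<in> lin_maps R (bilin R P A (bilin R P B C)) N"
    and eq: "\<And>a b \<theta> c \<theta>'. \<lbrakk>a \<in> carrier A; b \<in> carrier B; \<theta> \<in> carrier (ops P 2); c \<in> carrier C; \<theta>' \<in> carrier (ops P 2)\<rbrakk>
      \<Longrightarrow> f (btensor R P A (bilin R P B C) a (btensor R P B C b c \<theta>) \<theta>') =
        g (btensor R P A (bilin R P B C) a (btensor R P B C b c \<theta>) \<theta>')"
    and x: "x \<in> carrier (bilin R P A (bilin R P B C))"
  shows "f x = g x"
proof (rule bilin_eqI[OF A bilin_palgebra[OF B C] N f g _ x])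
  interpret L: bilinear_op R P A "bilin R P B C" "bilin R P A (bilin R P B C)" "btensor R P A (bilin R P B C)"
    by (rule btensor_bilinear_op[OF A bilin_palgebra[OF B C]])
  fix a v \<theta>' assume a: "a \<in> carrier A" "v \<in> carrier (bilin R P B C)" "\<theta>' \<in> carrier (ops P 2)"
  show "f (btensor R P A (bilin R P B C) a v \<theta>') = g (btensor R P A (bilin R P B C) a v \<theta>')"
    by (rule bilin_eqI[OF B C N lin_maps_comp[OF L.lin2[OF a(1,3)] f] lin_maps_comp[OF L.lin2[OF a(1,3)] g] _ a(2)])
      (rule eq, use a in auto)
qed

end

text \<open>A single family over all triples of algebras is needed, as naturality compares two
  members of it. The choice is harmless: on the carrier, \<open>bilin_left_eqI\<close> leaves one
  possibility.\<close>

definition bilin_assoc ::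
  "('r, 'm) ring_scheme \<Rightarrow> ('r, 'p) operad \<Rightarrow> ('r, 'p, 'a) palg \<Rightarrow> ('r, 'p, 'b) palg \<Rightarrow> ('r, 'p, 'c) palg
    \<Rightarrow> ('r, 'p, ('r, 'p, 'a, 'b) bilin, 'c) bilin \<Rightarrow> ('r, 'p, 'a, ('r, 'p, 'b, 'c) bilin) bilin"
  where "bilin_assoc R P A B C =
    (SOME \<alpha>. \<alpha> \<in> lin_maps R (bilin R P (bilin R P A B) C) (bilin R P A (bilin R P B C)) \<and>
      (\<forall>a\<in>carrier A. \<forall>b\<in>carrier B. \<forall>\<theta>\<in>carrier (ops P 2). \<forall>c\<in>carrier C. \<forall>\<theta>'\<in>carrier (ops P 2).
        \<alpha> (btensor R P (bilin R P A B) C (btensor R P A B a b \<theta>) c \<theta>') =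
        btensor R P A (bilin R P B C) a (btensor R P B C b c \<theta>) \<theta>'))"

lemma bilin_assoc:
  assumes U: "unary_ops_are_scalars R P"
    and A: "palgebra R P A" and B: "palgebra R P B" and C: "palgebra R P C"
  shows bilin_assoc_lin: "bilin_assoc R P A B C \<in> lin_maps R (bilin R P (bilin R P A B) C) (bilin R P A (bilin R P B C))"
    and bilin_assoc_btensor: "\<lbrakk>a \<in> carrier A; b \<in> carrier B; \<theta> \<in> carrier (ops P 2); c \<in> carrier C; \<theta>' \<in> carrier (ops P 2)\<rbrakk>
      \<Longrightarrow> bilin_assoc R P A B C (btensor R P (bilin R P A B) C (btensor R P A B a b \<theta>) c \<theta>') =
        btensor R P A (bilin R P B C) a (btensor R P B C b c \<theta>) \<theta>'"
  using someI_ex[OF bilin_assoc_map[OF A B C U, unfolded Bex_def], folded bilin_assoc_def] by blast+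

text \<open>The two composites with the map in the other direction fix the nested tensors, hence
  everything. Linearity is enough for a morphism because products vanish on both sides.\<close>

lemma bilin_assoc_iso:
  assumes U: "unary_ops_are_scalars R P"
    and A: "palgebra R P A" and B: "palgebra R P B" and C: "palgebra R P C"
  shows "bilin_assoc R P A B C \<in> palg_iso R P (bilin R P (bilin R P A B) C) (bilin R P A (bilin R P B C))"
proof -
  let ?L = "bilin R P (bilin R P A B) C" and ?N = "bilin R P A (bilin R P B C)" and ?\<alpha> = "bilin_assoc R P A B C"
  note AB = bilin_palgebra[OF A B] and BC = bilin_palgebra[OF B C]
  note L = bilin_palgebra[OF AB C] bilin_products_vanish[OF AB C]
  note N = bilin_palgebra[OF A BC] bilin_products_vanish[OF A BC]
  note \<alpha> = bilin_assoc[OF U A B C]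
  obtain \<alpha>' where \<alpha>': "\<alpha>' \<in> lin_maps R ?N ?L"
    "\<And>a b \<theta> c \<theta>'. \<lbrakk>a \<in> carrier A; b \<in> carrier B; \<theta> \<in> carrier (ops P 2); c \<in> carrier C; \<theta>' \<in> carrier (ops P 2)\<rbrakk>
      \<Longrightarrow> \<alpha>' (btensor R P A (bilin R P B C) a (btensor R P B C b c \<theta>) \<theta>') =
        btensor R P (bilin R P A B) C (btensor R P A B a b \<theta>) c \<theta>'"
    using bilin_assoc_inverse_map[OF A B C U] by blast
  have "\<alpha>' (?\<alpha> x) = x" if "x \<in> carrier ?L" for x
    by (rule bilin_left_eqI[OF A B C palgebra.module_A[OF L(1)] lin_maps_comp[OF \<alpha>(1) \<alpha>'(1)] lin_maps_id _ that])
      (simp add: \<alpha> \<alpha>'(2))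
  moreover have "?\<alpha> (\<alpha>' x) = x" if "x \<in> carrier ?N" for x
    by (rule bilin_right_eqI[OF A B C palgebra.module_A[OF N(1)] lin_maps_comp[OF \<alpha>'(1) \<alpha>(1)] lin_maps_id _ that])
      (simp add: \<alpha> \<alpha>'(2))
  ultimately have "bij_betw ?\<alpha> (carrier ?L) (carrier ?N)"
    using lin_mapsD(1)[OF \<alpha>(1)] lin_mapsD(1)[OF \<alpha>'(1)] by (intro bij_betw_byWitness[where f' = \<alpha>']) auto
  then show ?thesis
    unfolding palg_iso_def using lin_maps_palg_hom[OF U L N \<alpha>(1)] by blast
qed

text \<open>Both composites are linear and send a nested tensor of a, b and c to the rebracketed
  tensor of \<open>f a\<close>, \<open>g b\<close> and \<open>h c\<close> with the same two
  operations.\<close>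

lemma bilin_assoc_natural:
  assumes U: "unary_ops_are_scalars R P"
    and A: "palgebra R P A" "palgebra R P A'" and B: "palgebra R P B" "palgebra R P B'"
    and C: "palgebra R P C" "palgebra R P C'"
    and f: "f \<in> palg_hom R P A A'" and g: "g \<in> palg_hom R P B B'" and h: "h \<in> palg_hom R P C C'"
    and x: "x \<in> carrier (bilin R P (bilin R P A B) C)"
  shows "bilin_assoc R P A' B' C' (bilin_map R P (bilin R P A' B') C' (bilin_map R P A' B' f g) h x) =
    bilin_map R P A' (bilin R P B' C') f (bilin_map R P B' C' g h) (bilin_assoc R P A B C x)"
proof -
  note AB = bilin_palgebra[OF A(1) B(1)] bilin_palgebra[OF A(2) B(2)]
  note BC = bilin_palgebra[OF B(1) C(1)] bilin_palgebra[OF B(2) C(2)]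
  note fg = bilin_map[OF A B f g] and gh = bilin_map[OF B C g h]
  note fg_h = bilin_map[OF AB C fg(1) h] and f_gh = bilin_map[OF A BC f gh(1)]
  note \<alpha> = bilin_assoc[OF U A(1) B(1) C(1)] and \<alpha>' = bilin_assoc[OF U A(2) B(2) C(2)]
  show ?thesis
  proof (rule bilin_left_eqI[OF A(1) B(1) C(1) palgebra.module_A[OF bilin_palgebra[OF A(2) BC(2)]]
        lin_maps_comp[OF palg_hom_lin[OF fg_h(1)] \<alpha>'(1)] lin_maps_comp[OF \<alpha>(1) palg_hom_lin[OF f_gh(1)]] _ x])
    fix a b \<theta> c \<theta>'
    assume a: "a \<in> carrier A" "b \<in> carrier B" "\<theta> \<in> carrier (ops P 2)" "c \<in> carrier C" "\<theta>' \<in> carrier (ops P 2)"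
    have "btensor R P A B a b \<theta> \<in> carrier (bilin R P A B)" "btensor R P B C b c \<theta> \<in> carrier (bilin R P B C)"
      by (rule bilinear_op.op_closed[OF btensor_bilinear_op]; use A B C a in simp)+
    then show "bilin_assoc R P A' B' C' (bilin_map R P (bilin R P A' B') C' (bilin_map R P A' B' f g) h
          (btensor R P (bilin R P A B) C (btensor R P A B a b \<theta>) c \<theta>')) =
        bilin_map R P A' (bilin R P B' C') f (bilin_map R P B' C' g h)
          (bilin_assoc R P A B C (btensor R P (bilin R P A B) C (btensor R P A B a b \<theta>) c \<theta>'))"
      using a palg_homD(1)[OF f] palg_homD(1)[OF g] palg_homD(1)[OF h]
      by (simp add: fg_h(2) fg(2) gh(2) f_gh(2) \<alpha>(2) \<alpha>'(2))
  qed
qed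

theorem proposition6p14:
  fixes R :: "('r, 'm) ring_scheme" and P :: "('r, 'p) operad"
  assumes "cring R" and "operad R P" and "unary_ops_are_scalars R P"
  shows "\<exists>\<alpha> :: ('r, 'p, 'a) palg \<Rightarrow> ('r, 'p, 'b) palg \<Rightarrow> ('r, 'p, 'c) palg
              \<Rightarrow> ('r, 'p, ('r, 'p, 'a, 'b) bilin, 'c) bilin
              \<Rightarrow> ('r, 'p, 'a, ('r, 'p, 'b, 'c) bilin) bilin.
    (\<forall>A B C. palgebra R P A \<longrightarrow> palgebra R P B \<longrightarrow> palgebra R P C \<longrightarrow>
       \<alpha> A B C \<in> palg_iso R P (bilin R P (bilin R P A B) C) (bilin R P A (bilin R P B C))) \<and>
    (\<forall>A A' B B' C C' f g h.
       palgebra R P A \<longrightarrow> palgebra R P A' \<longrightarrow> palgebra R P B \<longrightarrow> palgebra R P B' \<longrightarrow>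
       palgebra R P C \<longrightarrow> palgebra R P C' \<longrightarrow>
       f \<in> palg_hom R P A A' \<longrightarrow> g \<in> palg_hom R P B B' \<longrightarrow> h \<in> palg_hom R P C C' \<longrightarrow>
       (\<forall>x\<in>carrier (bilin R P (bilin R P A B) C).
          \<alpha> A' B' C' (bilin_map R P (bilin R P A' B') C' (bilin_map R P A' B' f g) h x) =
          bilin_map R P A' (bilin R P B' C') f (bilin_map R P B' C' g h) (\<alpha> A B C x)))"
  by (intro exI[of _ "bilin_assoc R P"] conjI allI impI ballI bilin_assoc_iso bilin_assoc_natural assms)

end
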